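(* Let $L$ be a logical system of dimension $d_L$, let $\mathcal{E}$ be any encoding channel from $L$ and $\mathcal{N}$ any noise channel, and let $\widehat{\mathcal{N}\circ\mathcal{E}}$ be a complementary channel of $\mathcal{N}\circ\mathcal{E}$. Fix a basis $\{|x\rangle\}$ of $L$ and define $\rho^{x,x'}=\widehat{\mathcal{N}\circ\mathcal{E}}(|x\rangle\langle x'|)$. Suppose there is a state $\zeta$ and constants $\epsilon,\nu\geq0$ such that $F(\rho^{x,x},\zeta)\geq\sqrt{1-\epsilon^2}$ for all $x$ and $\|\rho^{x,x'}\|_1\leq\nu$ for all $x\neq x'$. Then $$\epsilon_{\mathrm{worst}}(\mathcal{N}\circ\mathcal{E})\leq\epsilon+d_L\sqrt{\nu}.$$ Moreover, if the noise is $\mathcal{N}(\cdot)=\sum_\alpha q_\alpha|\alpha\rangle\langle\alpha|_C\otimes\mathcal{N}^\alpha(\cdot)$ for a probability distribution $\{q_\alpha\}$, orthonormal record states $|\alpha\rangle_C$ and channels $\mathcal{N}^\alpha$, and for each $\alpha$ there is a state $\zeta_\alpha$ such that the operators $\rho_\alpha^{x,x'}=\widehat{\mathcal{N}^\alpha\circ\mathcal{E}}(|x\rangle\langle x'|)$ satisfy $F(\rho_\alpha^{x,x},\zeta_\alpha)\geq\sqrt{1-\epsilon^2}$ for all $x$ and $\|\rho_\alpha^{x,x'}\|_1\leq\nu$ for all $x\neq x'$, then $\epsilon_{\mathrm{worst}}(\mathcal{N}\circ\mathcal{E})\leq\epsilon+d_L\sqrt{\nu}$.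
   Context: A complementary channel of a channel $\mathcal{F}(\cdot)=\operatorname{tr}_E(W(\cdot)W^\dagger)$ with Stinespring isometry $W:X\to B\otimes E$ is $\hat{\mathcal{F}}(\cdot)=\operatorname{tr}_B(W(\cdot)W^\dagger)$. Fidelity $F(\rho,\sigma)=\|\sqrt\rho\sqrt\sigma\|_1$. For channels $\mathcal{K},\mathcal{K}'$ with input $L$ and pure state $|\phi\rangle_{LR}$, $F_{|\phi\rangle}(\mathcal{K},\mathcal{K}')=F((\mathcal{K}\otimes\mathrm{id}_R)(\phi),(\mathcal{K}'\otimes\mathrm{id}_R)(\phi))$. For a channel $\mathcal{M}$ from $L$ to $B$: $f_{\mathrm{worst}}(\mathcal{M})=\max_{\mathcal{R}}\min_{|\phi\rangle}F_{|\phi\rangle}(\mathcal{R}\circ\mathcal{M},\mathrm{id}_L)$ over recovery channels $\mathcal{R}:B\to L$ and pure states $|\phi\rangle$ on $L$ and a reference; $\epsilon_{\mathrm{worst}}(\mathcal{M})=\sqrt{1-f_{\mathrm{worst}}^2(\mathcal{M})}$. *)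

theory Defs
  imports Complex_Main "Jordan_Normal_Form.Matrix"
begin

definition adj :: "complex mat \<Rightarrow> complex mat" where
  "adj A = mat (dim_col A) (dim_row A) (\<lambda>(i,j). cnj (A $$ (j,i)))"

definition ketbra :: "complex vec \<Rightarrow> complex vec \<Rightarrow> complex mat" where
  "ketbra u v = mat (dim_vec u) (dim_vec v) (\<lambda>(i,j). u $ i * cnj (v $ j))"

definition unit_vec_c :: "nat \<Rightarrow> complex vec \<Rightarrow> bool" where
  "unit_vec_c n v \<longleftrightarrow> v \<in> carrier_vec n \<and> (\<Sum>i<n. (cmod (v $ i))\<^sup>2) = 1"

definition orthonormal_c :: "nat \<Rightarrow> nat \<Rightarrow> (nat \<Rightarrow> complex vec) \<Rightarrow> bool" where
  "orthonormal_c n m b \<longleftrightarrow> (\<forall>x<m. b x \<in> carrier_vec n) \<and>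
     (\<forall>x<m. \<forall>y<m. (\<Sum>i<n. b x $ i * cnj (b y $ i)) = (if x = y then 1 else 0))"

definition mtrace :: "complex mat \<Rightarrow> complex" where
  "mtrace A = (\<Sum>i<dim_row A. A $$ (i,i))"

definition psd :: "nat \<Rightarrow> complex mat \<Rightarrow> bool" where
  "psd n A \<longleftrightarrow> A \<in> carrier_mat n n \<and> adj A = A \<and>
     (\<forall>v \<in> carrier_vec n. Re (\<Sum>i<n. cnj (v $ i) * (A *\<^sub>v v) $ i) \<ge> 0)"

definition density :: "nat \<Rightarrow> complex mat \<Rightarrow> bool" where
  "density n A \<longleftrightarrow> psd n A \<and> mtrace A = 1"

definition msqrt :: "complex mat \<Rightarrow> complex mat" where
  "msqrt A = (THE B. psd (dim_row A) B \<and> B * B = A)"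

definition trace_norm :: "complex mat \<Rightarrow> real" where
  "trace_norm A = Re (mtrace (msqrt (adj A * A)))"

definition fidelity :: "complex mat \<Rightarrow> complex mat \<Rightarrow> real" where
  "fidelity \<rho> \<sigma> = trace_norm (msqrt \<rho> * msqrt \<sigma>)"

definition is_channel :: "nat \<Rightarrow> nat \<Rightarrow> (complex mat \<Rightarrow> complex mat) \<Rightarrow> bool" where
  "is_channel m n \<Phi> \<longleftrightarrow> (\<exists>Ks. (\<forall>K \<in> set Ks. K \<in> carrier_mat n m) \<and>
      foldr (\<lambda>K acc. adj K * K + acc) Ks (0\<^sub>m m m) = 1\<^sub>m m \<and>
      (\<forall>\<rho> \<in> carrier_mat m m. \<Phi> \<rho> = foldr (\<lambda>K acc. K * \<rho> * adj K + acc) Ks (0\<^sub>m n n)))"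

text \<open>Tensor product convention: index (a,b) of C^p \<otimes> C^q is a*q+b.\<close>
definition kron :: "complex mat \<Rightarrow> complex mat \<Rightarrow> complex mat" where
  "kron A B = mat (dim_row A * dim_row B) (dim_col A * dim_col B)
     (\<lambda>(i,j). A $$ (i div dim_row B, j div dim_col B) * B $$ (i mod dim_row B, j mod dim_col B))"

definition ptrace2 :: "nat \<Rightarrow> nat \<Rightarrow> complex mat \<Rightarrow> complex mat" where
  "ptrace2 p q M = mat p p (\<lambda>(a,a'). \<Sum>e<q. M $$ (a*q+e, a'*q+e))"

definition ptrace1 :: "nat \<Rightarrow> nat \<Rightarrow> complex mat \<Rightarrow> complex mat" where
  "ptrace1 p q M = mat q q (\<lambda>(e,e'). \<Sum>a<p. M $$ (a*q+e, a*q+e'))"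

definition isometry :: "nat \<Rightarrow> nat \<Rightarrow> complex mat \<Rightarrow> bool" where
  "isometry m n W \<longleftrightarrow> W \<in> carrier_mat n m \<and> adj W * W = 1\<^sub>m m"

definition stinespring :: "nat \<Rightarrow> nat \<Rightarrow> nat \<Rightarrow> (complex mat \<Rightarrow> complex mat) \<Rightarrow> complex mat \<Rightarrow> bool" where
  "stinespring m b e \<Phi> W \<longleftrightarrow> isometry m (b*e) W \<and>
     (\<forall>\<rho> \<in> carrier_mat m m. \<Phi> \<rho> = ptrace2 b e (W * \<rho> * adj W))"

definition complementary :: "nat \<Rightarrow> nat \<Rightarrow> complex mat \<Rightarrow> complex mat \<Rightarrow> complex mat" where
  "complementary b e W \<rho> = ptrace1 b e (W * \<rho> * adj W)"

text \<open>(\<Phi> \<otimes> id_R) applied to an operator X on C^m \<otimes> C^r, \<Phi> a (linear) map from m to n.\<close>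
definition tensor_id :: "(complex mat \<Rightarrow> complex mat) \<Rightarrow> nat \<Rightarrow> nat \<Rightarrow> nat \<Rightarrow> complex mat \<Rightarrow> complex mat" where
  "tensor_id \<Phi> m n r X = mat (n*r) (n*r) (\<lambda>(i,j).
     \<Phi> (mat m m (\<lambda>(l,l'). X $$ (l*r + i mod r, l'*r + j mod r))) $$ (i div r, j div r))"

definition fid_phi :: "nat \<Rightarrow> nat \<Rightarrow> nat \<Rightarrow> complex vec \<Rightarrow>
    (complex mat \<Rightarrow> complex mat) \<Rightarrow> (complex mat \<Rightarrow> complex mat) \<Rightarrow> real" where
  "fid_phi m n r \<phi> K K' = fidelity (tensor_id K m n r (ketbra \<phi> \<phi>)) (tensor_id K' m n r (ketbra \<phi> \<phi>))"

definition f_worst :: "nat \<Rightarrow> nat \<Rightarrow> (complex mat \<Rightarrow> complex mat) \<Rightarrow> real" where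
  "f_worst dL dB M = (SUP R \<in> {R. is_channel dB dL R}.
      INF p \<in> {(r, \<phi>). 0 < r \<and> unit_vec_c (dL*r) \<phi>}.
        fid_phi dL dL (fst p) (snd p) (R \<circ> M) id)"

definition eps_worst :: "nat \<Rightarrow> nat \<Rightarrow> (complex mat \<Rightarrow> complex mat) \<Rightarrow> real" where
  "eps_worst dL dB M = sqrt (1 - (f_worst dL dB M)\<^sup>2)"

end

theory Submission
  imports Defs "HOL-Analysis.L2_Norm" "Jordan_Normal_Form.Spectral_Radius"
begin

text \<open>
  The recovery is written down explicitly, so no minimax argument over recovery channels is needed.
  Let \<open>T\<close> be the matrix with entries \<open>T (x,e) \<beta> = (W b\<^sub>x) (\<beta>,e)\<close>. Then \<open>M = T T\<^sup>*\<close> is the block matrix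
  of the operators \<open>\<rho>\<^sup>x\<^sup>y\<close>, and by polar decomposition some contraction \<open>V\<close> satisfies
  \<open>T V\<^sup>* = sqrt M\<close>. The Powers--Stormer inequality bounds the Frobenius distance of \<open>sqrt M\<close> to
  the block diagonal matrix of the \<open>sqrt \<rho>\<^sup>x\<^sup>x\<close> by the square root of the off-diagonal trace norms,
  that is, by \<open>d sqrt \<nu>\<close>. Contractions \<open>U\<^sub>x\<close> attaining the fidelities of \<open>\<rho>\<^sup>x\<^sup>x\<close> and \<open>\<zeta>\<close> then rotate
  the diagonal blocks towards \<open>\<zeta>\<close>. The columns of \<open>V\<^sup>* diag(U\<^sub>x)\<close> give Kraus operators with a
  uniform entanglement fidelity, since the purified distance to a fixed vector is a seminorm and the errors
  \<open>\<epsilon>\<close> and \<open>d sqrt \<nu>\<close> therefore add. With a classical record the recovery reads the record first.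
\<close>

subsection \<open>Matrices and contractions\<close>

text \<open>A pure state on the code and a reference is kept as a \<open>d\<close> by
  \<open>r\<close> matrix of Frobenius norm one, so its squared fidelity after recovery is a sum of
  squared amplitudes, indexed by an environment index \<open>e\<close> of the channel and an index
  \<open>f\<close> of the recovery operator. Cauchy-Schwarz against the entries of the square root
  of \<open>\<zeta>\<close>, also of Frobenius norm one, bounds this sum below by the square of one
  overlap of two vectors, and that overlap is what the perturbation argument estimates. In the block
  diagonal model the fidelity hypothesis acts on each basis state separately and is averaged with
  the weights of the input state, whatever the reference. The constant \<open>d * sqrt \<nu>\<close>
  is the root of \<open>d * d * \<nu>\<close>: at most \<open>d * d\<close> off-diagonal blocks,
  each contributing at most \<open>\<nu>\<close> to a squared Frobenius distance. Contractions stand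
  in for unitaries and partial isometries, so no space has to be enlarged to match dimensions; the
  recovery they yield is only trace-nonincreasing, and completing it to a channel can only raise the
  fidelity.\<close>

definition cdot :: "complex vec \<Rightarrow> complex vec \<Rightarrow> complex" where
  "cdot u v = (\<Sum>i<dim_vec v. cnj (u $ i) * v $ i)"

definition vnsq :: "complex vec \<Rightarrow> real" where
  "vnsq v = (\<Sum>i<dim_vec v. (cmod (v $ i))\<^sup>2)"

text \<open>Operator norm at most one, phrased through vectors so that rectangular matrices need no
  singular values.\<close>

definition contraction :: "complex mat \<Rightarrow> bool" where
  "contraction A \<longleftrightarrow> (\<forall>v \<in> carrier_vec (dim_col A). vnsq (A *\<^sub>v v) \<le> vnsq v)"

definition unitary_mat :: "nat \<Rightarrow> complex mat \<Rightarrow> bool" where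
  "unitary_mat n U \<longleftrightarrow> U \<in> carrier_mat n n \<and> adj U * U = 1\<^sub>m n \<and> U * adj U = 1\<^sub>m n"

definition diagm :: "nat \<Rightarrow> (nat \<Rightarrow> real) \<Rightarrow> complex mat" where
  "diagm n d = mat n n (\<lambda>(i,j). if i = j then of_real (d i) else 0)"

lemma adj_dim [simp]: "dim_row (adj A) = dim_col A" "dim_col (adj A) = dim_row A"
  by (auto simp: adj_def)

lemma adj_carrier [simp]: "A \<in> carrier_mat n m \<Longrightarrow> adj A \<in> carrier_mat m n"
  by (auto simp: adj_def)

lemma adj_index [simp]: "i < dim_col A \<Longrightarrow> j < dim_row A \<Longrightarrow> adj A $$ (i,j) = cnj (A $$ (j,i))"
  by (auto simp: adj_def)

lemma adj_adj [simp]: "adj (adj A) = A"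
  by (rule eq_matI) auto

lemma adj_one [simp]: "adj (1\<^sub>m n) = 1\<^sub>m n"
  by (rule eq_matI) auto

lemma index_mult_mat_sum:
  assumes "A \<in> carrier_mat n m" "B \<in> carrier_mat m k" "i < n" "j < k"
  shows "(A * B) $$ (i,j) = (\<Sum>l<m. A $$ (i,l) * B $$ (l,j))"
  using assms by (auto simp: scalar_prod_def atLeast0LessThan)

lemma index_mult_mat_vec_sum:
  assumes "A \<in> carrier_mat n m" "v \<in> carrier_vec m" "i < n"
  shows "(A *\<^sub>v v) $ i = (\<Sum>l<m. A $$ (i,l) * v $ l)"
  using assms by (auto simp: scalar_prod_def atLeast0LessThan)

lemma mat_assoc:
  fixes A B C :: "complex mat"
  assumes "dim_col A = dim_row B" "dim_col B = dim_row C"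
  shows "A * B * C = A * (B * C)"
  by (rule assoc_mult_mat[of _ "dim_row A" "dim_col A" _ "dim_col B" _ "dim_col C"]) (use assms in auto)

lemma adj_mult:
  assumes "dim_col A = dim_row B"
  shows "adj (A * B) = adj B * adj A"
proof (rule eq_matI)
  define n m k where "n = dim_row A" and "m = dim_col A" and "k = dim_col B"
  have A: "A \<in> carrier_mat n m" and B: "B \<in> carrier_mat m k" using assms by (auto simp: n_def m_def k_def)
  fix i j assume "i < dim_row (adj B * adj A)" "j < dim_col (adj B * adj A)"
  hence ij: "i < k" "j < n" using A B by auto
  have "adj (A * B) $$ (i,j) = cnj ((A * B) $$ (j,i))" using ij A B by simp
  also have "\<dots> = (\<Sum>l<m. adj B $$ (i,l) * adj A $$ (l,j))"
    using ij A B by (simp add: index_mult_mat_sum[OF A B] mult.commute del: index_mult_mat)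
  also have "\<dots> = (adj B * adj A) $$ (i,j)"
    using index_mult_mat_sum[of "adj B" k m "adj A" n i j] A B ij by simp
  finally show "adj (A * B) $$ (i,j) = (adj B * adj A) $$ (i,j)" .
qed auto

lemma adj_add:
  assumes "A \<in> carrier_mat n m" "B \<in> carrier_mat n m"
  shows "adj (A + B) = adj A + adj B"
  by (rule eq_matI) (use assms in auto)

lemma adj_minus:
  assumes "A \<in> carrier_mat n m" "B \<in> carrier_mat n m"
  shows "adj (A - B) = adj A - adj B"
  by (rule eq_matI) (use assms in auto)

lemma diagm_carrier [simp]: "diagm n d \<in> carrier_mat n n"
  by (simp add: diagm_def)

lemma diagm_dim [simp]: "dim_row (diagm n d) = n" "dim_col (diagm n d) = n"
  by (auto simp: diagm_def)

lemma adj_diagm [simp]: "adj (diagm n d) = diagm n d"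
  by (rule eq_matI) (auto simp: diagm_def)

lemma diagm_mult: "diagm n d * diagm n d' = diagm n (\<lambda>i. d i * d' i)"
proof (rule eq_matI)
  fix i j assume "i < dim_row (diagm n (\<lambda>i. d i * d' i))" "j < dim_col (diagm n (\<lambda>i. d i * d' i))"
  hence ij: "i < n" "j < n" by (auto simp: diagm_def)
  have "(diagm n d * diagm n d') $$ (i,j) = (\<Sum>l<n. diagm n d $$ (i,l) * diagm n d' $$ (l,j))"
    by (rule index_mult_mat_sum) (use ij in auto)
  also have "\<dots> = (\<Sum>l<n. if l = i then of_real (d i) * (if i = j then of_real (d' i) else 0) else 0)"
    by (rule sum.cong) (use ij in \<open>auto simp: diagm_def\<close>)
  finally show "(diagm n d * diagm n d') $$ (i,j) = diagm n (\<lambda>i. d i * d' i) $$ (i,j)"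
    using ij by (auto simp: diagm_def)
qed (auto simp: diagm_def)

lemma diagm_sqrt_mult:
  assumes "\<And>i. i < n \<Longrightarrow> 0 \<le> d i"
  shows "diagm n (\<lambda>i. sqrt (d i) * sqrt (d i)) = diagm n d"
  by (rule eq_matI) (auto simp: diagm_def assms of_real_mult[symmetric] simp del: of_real_mult)

lemma diagm_mult_vec:
  assumes "v \<in> carrier_vec n" "i < n"
  shows "(diagm n d *\<^sub>v v) $ i = of_real (d i) * v $ i"
proof -
  have "(diagm n d *\<^sub>v v) $ i = (\<Sum>l<n. diagm n d $$ (i,l) * v $ l)"
    by (rule index_mult_mat_vec_sum) (use assms in auto)
  also have "\<dots> = (\<Sum>l<n. if l = i then of_real (d i) * v $ i else 0)"
    by (rule sum.cong) (use assms in \<open>auto simp: diagm_def\<close>)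
  finally show ?thesis using assms by simp
qed

lemma vnsq_nonneg [simp]: "0 \<le> vnsq v"
  by (simp add: vnsq_def sum_nonneg)

lemma cdot_self: "cdot v v = of_real (vnsq v)"
  by (simp add: cdot_def vnsq_def complex_norm_square mult.commute del: of_real_power)

lemma cdot_adj:
  assumes A: "A \<in> carrier_mat n m" and u: "u \<in> carrier_vec n" and v: "v \<in> carrier_vec m"
  shows "cdot u (A *\<^sub>v v) = cdot (adj A *\<^sub>v u) v"
proof -
  have "cdot u (A *\<^sub>v v) = (\<Sum>i<n. \<Sum>j<m. cnj (u $ i) * (A $$ (i,j) * v $ j))"
    using A v by (simp add: cdot_def index_mult_mat_vec_sum[OF A v] sum_distrib_left del: index_mult_mat_vec)
  also have "\<dots> = (\<Sum>j<m. \<Sum>i<n. cnj (u $ i) * (A $$ (i,j) * v $ j))"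
    by (rule sum.swap)
  also have "\<dots> = (\<Sum>j<m. cnj ((adj A *\<^sub>v u) $ j) * v $ j)"
    using A u by (intro sum.cong refl)
      (simp add: index_mult_mat_vec_sum[of "adj A" m n] sum_distrib_right mult.assoc mult.left_commute
        del: index_mult_mat_vec)
  finally show ?thesis using v by (simp add: cdot_def)
qed

lemma cdot_Cauchy_Schwarz:
  assumes "u \<in> carrier_vec n" "v \<in> carrier_vec n"
  shows "(cmod (cdot u v))\<^sup>2 \<le> vnsq u * vnsq v"
proof -
  have "cmod (cdot u v) \<le> (\<Sum>i<n. \<bar>cmod (u $ i)\<bar> * \<bar>cmod (v $ i)\<bar>)"
    using assms norm_sum[of "\<lambda>i. cnj (u $ i) * v $ i" "{..<n}"] by (simp add: cdot_def norm_mult)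
  also have "\<dots> \<le> L2_set (\<lambda>i. cmod (u $ i)) {..<n} * L2_set (\<lambda>i. cmod (v $ i)) {..<n}"
    by (rule L2_set_mult_ineq)
  finally have "(cmod (cdot u v))\<^sup>2 \<le> (L2_set (\<lambda>i. cmod (u $ i)) {..<n} * L2_set (\<lambda>i. cmod (v $ i)) {..<n})\<^sup>2"
    by (rule power_mono) simp
  thus ?thesis using assms by (simp add: power_mult_distrib L2_set_def sum_nonneg vnsq_def)
qed

lemma vnsq_mult:
  assumes A: "A \<in> carrier_mat n m" and v: "v \<in> carrier_vec m"
  shows "complex_of_real (vnsq (A *\<^sub>v v)) = cdot ((adj A * A) *\<^sub>v v) v"
proof -
  have "complex_of_real (vnsq (A *\<^sub>v v)) = cdot (A *\<^sub>v v) (A *\<^sub>v v)" by (simp add: cdot_self)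
  also have "\<dots> = cdot (adj A *\<^sub>v (A *\<^sub>v v)) v" by (rule cdot_adj) (use A v in auto)
  also have "adj A *\<^sub>v (A *\<^sub>v v) = (adj A * A) *\<^sub>v v"
    by (rule assoc_mult_mat_vec[symmetric]) (use A v in auto)
  finally show ?thesis .
qed

lemma vnsq_isometry:
  assumes "A \<in> carrier_mat n m" "adj A * A = 1\<^sub>m m" "v \<in> carrier_vec m"
  shows "vnsq (A *\<^sub>v v) = vnsq v"
  using vnsq_mult[OF assms(1,3)] assms by (simp add: cdot_self)

lemma contractionD: "contraction A \<Longrightarrow> A \<in> carrier_mat n m \<Longrightarrow> v \<in> carrier_vec m \<Longrightarrow> vnsq (A *\<^sub>v v) \<le> vnsq v"
  by (auto simp: contraction_def)

text \<open>For \<open>w = adj A *\<^sub>v v\<close> the squared norm of \<open>w\<close> is the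
  inner product of \<open>A *\<^sub>v w\<close> with \<open>v\<close>. Cauchy-Schwarz and the bound
  for \<open>A\<close> give \<open>vnsq w * vnsq w \<le> vnsq w * vnsq v\<close>, and the common
  factor cancels.\<close>

lemma contraction_adj:
  assumes A: "A \<in> carrier_mat n m" and "contraction A"
  shows "contraction (adj A)"
  unfolding contraction_def
proof
  fix v :: "complex vec" assume "v \<in> carrier_vec (dim_col (adj A))"
  hence v: "v \<in> carrier_vec n" using A by simp
  let ?w = "adj A *\<^sub>v v"
  have w: "?w \<in> carrier_vec m" by (rule mult_mat_vec_carrier[OF adj_carrier[OF A] v])
  have "complex_of_real (vnsq ?w) = cdot ?w (adj A *\<^sub>v v)" by (simp add: cdot_self)
  also have "\<dots> = cdot (A *\<^sub>v ?w) v" using cdot_adj[of "adj A" m n ?w v] A v w by simp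
  finally have "(vnsq ?w)\<^sup>2 = (cmod (cdot (A *\<^sub>v ?w) v))\<^sup>2" by (metis norm_of_real power2_abs)
  also have "\<dots> \<le> vnsq (A *\<^sub>v ?w) * vnsq v"
    by (rule cdot_Cauchy_Schwarz) (use A w v in auto)
  also have "\<dots> \<le> vnsq ?w * vnsq v"
    by (rule mult_right_mono) (use contractionD[OF assms(2) A w] in auto)
  finally have "vnsq ?w * vnsq ?w \<le> vnsq ?w * vnsq v" by (simp add: power2_eq_square)
  thus "vnsq ?w \<le> vnsq v"
    by (metis mult_le_cancel_left_pos order_le_less vnsq_nonneg)
qed

lemma contraction_mult:
  assumes A: "A \<in> carrier_mat n m" and B: "B \<in> carrier_mat m k"
    and "contraction A" "contraction B"
  shows "contraction (A * B)"
  unfolding contraction_def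
proof
  fix v :: "complex vec" assume "v \<in> carrier_vec (dim_col (A * B))"
  hence v: "v \<in> carrier_vec k" using B by simp
  have "vnsq ((A * B) *\<^sub>v v) = vnsq (A *\<^sub>v (B *\<^sub>v v))"
    using A B v by (simp add: assoc_mult_mat_vec)
  also have "\<dots> \<le> vnsq (B *\<^sub>v v)" by (rule contractionD[OF assms(3) A]) (use B v in auto)
  also have "\<dots> \<le> vnsq v" by (rule contractionD[OF assms(4) B v])
  finally show "vnsq ((A * B) *\<^sub>v v) \<le> vnsq v" .
qed

lemma unitary_contraction: "unitary_mat n U \<Longrightarrow> contraction U"
  by (auto simp: contraction_def unitary_mat_def vnsq_isometry)

lemma contraction_diagm:
  assumes "\<And>i. i < n \<Longrightarrow> \<bar>d i\<bar> \<le> 1"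
  shows "contraction (diagm n d)"
  unfolding contraction_def
proof
  fix v :: "complex vec" assume "v \<in> carrier_vec (dim_col (diagm n d))"
  hence v: "v \<in> carrier_vec n" by (simp add: diagm_def)
  have "(cmod ((diagm n d *\<^sub>v v) $ i))\<^sup>2 \<le> (cmod (v $ i))\<^sup>2" if "i < n" for i
    unfolding diagm_mult_vec[OF v that] norm_mult norm_of_real
    using assms[OF that] by (intro power_mono mult_left_le_one_le) auto
  thus "vnsq (diagm n d *\<^sub>v v) \<le> vnsq v"
    using v by (auto simp: vnsq_def diagm_def intro!: sum_mono)
qed

lemma unitary_adj: "unitary_mat n U \<Longrightarrow> unitary_mat n (adj U)"
  by (auto simp: unitary_mat_def)

lemma unitary_cancel:
  assumes "unitary_mat n U" "dim_row X = n"
  shows "adj U * (U * X) = X" "U * (adj U * X) = X"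
  using assms mat_assoc[of "adj U" U X] mat_assoc[of U "adj U" X]
  by (auto simp: unitary_mat_def)

lemma unitary_mult:
  assumes "unitary_mat n U" "unitary_mat n V"
  shows "unitary_mat n (U * V)"
proof -
  have U: "U \<in> carrier_mat n n" "adj U \<in> carrier_mat n n" "adj U * U = 1\<^sub>m n" "U * adj U = 1\<^sub>m n"
   and V: "V \<in> carrier_mat n n" "adj V \<in> carrier_mat n n" "adj V * V = 1\<^sub>m n" "V * adj V = 1\<^sub>m n"
    using assms by (auto simp: unitary_mat_def)
  have "adj (U * V) * (U * V) = 1\<^sub>m n"
    using U V unitary_cancel[OF assms(1), of V]
    by (simp add: adj_mult mat_assoc)
  moreover have "(U * V) * adj (U * V) = 1\<^sub>m n"
    using U V unitary_cancel[OF assms(2), of "adj U"]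
    by (simp add: adj_mult mat_assoc)
  ultimately show ?thesis using U V by (simp add: unitary_mat_def)
qed

section \<open>The spectral theorem for Hermitian matrices, by deflation\<close>

definition lift_mat :: "complex \<Rightarrow> complex mat \<Rightarrow> complex mat" where
  "lift_mat c B = mat (Suc (dim_row B)) (Suc (dim_col B))
     (\<lambda>(i,j). if i = 0 \<and> j = 0 then c else if i = 0 \<or> j = 0 then 0 else B $$ (i - 1, j - 1))"

lemma lift_mat_carrier [simp]: "B \<in> carrier_mat n m \<Longrightarrow> lift_mat c B \<in> carrier_mat (Suc n) (Suc m)"
  by (auto simp: lift_mat_def)

lemma lift_mat_dim [simp]: "dim_row (lift_mat c B) = Suc (dim_row B)" "dim_col (lift_mat c B) = Suc (dim_col B)"
  by (auto simp: lift_mat_def)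

lemma lift_mat_mult:
  assumes B: "B \<in> carrier_mat n n" and C: "C \<in> carrier_mat n n"
  shows "lift_mat b B * lift_mat c C = lift_mat (b * c) (B * C)"
proof (rule eq_matI)
  fix i j assume "i < dim_row (lift_mat (b * c) (B * C))" "j < dim_col (lift_mat (b * c) (B * C))"
  hence ij: "i < Suc n" "j < Suc n" using B C by (auto simp: lift_mat_def)
  have "(lift_mat b B * lift_mat c C) $$ (i,j) = (\<Sum>l<Suc n. lift_mat b B $$ (i,l) * lift_mat c C $$ (l,j))"
    by (rule index_mult_mat_sum) (use B C ij in auto)
  also have "\<dots> = lift_mat b B $$ (i,0) * lift_mat c C $$ (0,j)
      + (\<Sum>l<n. lift_mat b B $$ (i,Suc l) * lift_mat c C $$ (Suc l,j))"
    by (rule sum.lessThan_Suc_shift)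
  also have "\<dots> = lift_mat (b * c) (B * C) $$ (i,j)"
  proof (cases "i = 0 \<or> j = 0")
    case True thus ?thesis using B C ij by (auto simp: lift_mat_def)
  next
    case False
    have "(B * C) $$ (i - 1, j - 1) = (\<Sum>l<n. B $$ (i - 1,l) * C $$ (l,j - 1))"
      by (rule index_mult_mat_sum) (use B C ij False in auto)
    thus ?thesis using False B C ij by (auto simp: lift_mat_def)
  qed
  finally show "(lift_mat b B * lift_mat c C) $$ (i,j) = lift_mat (b * c) (B * C) $$ (i,j)" .
qed (use B C in \<open>auto simp: lift_mat_def\<close>)

lemma adj_lift_mat: "adj (lift_mat c B) = lift_mat (cnj c) (adj B)"
  by (rule eq_matI) (auto simp: lift_mat_def)

lemma lift_mat_one: "lift_mat 1 (1\<^sub>m n) = 1\<^sub>m (Suc n)"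
  by (rule eq_matI) (auto simp: lift_mat_def)

lemma lift_mat_diagm: "lift_mat (of_real e) (diagm n d) = diagm (Suc n) (case_nat e d)"
  by (rule eq_matI) (auto simp: lift_mat_def diagm_def split: nat.split)

text \<open>Normalising the first entry of \<open>v\<close> to be real and nonpositive keeps the denominator
  of the Householder reflection that maps the first basis vector to \<open>v\<close> away from zero.\<close>

lemma householder:
  fixes v :: "complex vec" and t :: real
  assumes v: "v \<in> carrier_vec (Suc n)" and v1: "vnsq v = 1" and v0: "v $ 0 = of_real t" and t: "t \<le> 0"
  shows "\<exists>H. unitary_mat (Suc n) H \<and> adj H = H \<and> col H 0 = v"
proof -
  define u where "u i = v $ i - (if i = 0 then 1 else 0)" for i
  \<comment> \<open>For \<open>u\<close> the difference of \<open>v\<close> and the first basis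
    vector, the squared norm of \<open>u\<close> is \<open>2 * (1 - t)\<close>. Hence dividing by
    \<open>c\<close> gives exactly the reflection along \<open>u\<close>, which exchanges the two
    unit vectors.\<close>
  define c where "c = complex_of_real (1 - t)"
  define H where "H = mat (Suc n) (Suc n) (\<lambda>(i,j). (if i = j then 1 else 0) - u i * cnj (u j) / c)"
  have c0: "c \<noteq> 0" using t unfolding c_def of_real_eq_0_iff by simp
  have cc: "cnj c = c" by (simp add: c_def)
  have H: "H \<in> carrier_mat (Suc n) (Suc n)" by (simp add: H_def)
  have adjH: "adj H = H"
    by (rule eq_matI) (auto simp: H_def cc)
  have vs: "complex_of_real (cmod (v $ 0)^2) + (\<Sum>i<n. v $ Suc i * cnj (v $ Suc i)) = 1"
  proof -
    have "complex_of_real (vnsq v) = (\<Sum>i<Suc n. v $ i * cnj (v $ i))"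
      using v by (simp add: vnsq_def complex_norm_square del: of_real_power sum.lessThan_Suc)
    also have "\<dots> = v $ 0 * cnj (v $ 0) + (\<Sum>i<n. v $ Suc i * cnj (v $ Suc i))"
      by (rule sum.lessThan_Suc_shift)
    finally show ?thesis using v1 by (simp add: complex_norm_square del: of_real_power)
  qed
  have uu: "(\<Sum>i<Suc n. cnj (u i) * u i) = 2 * c"
  proof -
    have "(\<Sum>i<Suc n. cnj (u i) * u i) = cnj (u 0) * u 0 + (\<Sum>i<n. cnj (u (Suc i)) * u (Suc i))"
      by (rule sum.lessThan_Suc_shift)
    also have "(\<Sum>i<n. cnj (u (Suc i)) * u (Suc i)) = 1 - of_real (t^2)"
      using vs by (simp add: u_def v0 mult.commute algebra_simps)
    also have "cnj (u 0) * u 0 = of_real ((t - 1)^2)" by (simp add: u_def v0 power2_eq_square)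
    finally show ?thesis by (simp add: c_def power2_eq_square algebra_simps)
  qed
  have "H * H = 1\<^sub>m (Suc n)"
  proof (rule eq_matI)
    fix i j assume "i < dim_row (1\<^sub>m (Suc n) :: complex mat)" "j < dim_col (1\<^sub>m (Suc n) :: complex mat)"
    hence ij: "i < Suc n" "j < Suc n" by auto
    have "(H * H) $$ (i,j) = (\<Sum>l<Suc n. H $$ (i,l) * H $$ (l,j))"
      by (rule index_mult_mat_sum[OF H H]) (use ij in auto)
    also have "\<dots> = (\<Sum>l<Suc n. (if l = i then (if i = j then 1 else 0) else 0)
        - (if l = i then u i * cnj (u j) / c else 0) - (if l = j then u i * cnj (u j) / c else 0)
        + u i * cnj (u j) / (c * c) * (cnj (u l) * u l))"
      by (rule sum.cong) (use ij in \<open>auto simp: H_def algebra_simps\<close>)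
    also have "\<dots> = (if i = j then 1 else 0) - u i * cnj (u j) / c - u i * cnj (u j) / c
        + u i * cnj (u j) / (c * c) * (\<Sum>l<Suc n. cnj (u l) * u l)"
      unfolding sum.distrib sum_subtractf sum_distrib_left[symmetric] using ij
      by (simp only: sum.delta finite_lessThan lessThan_iff if_True)
    also have "\<dots> = (if i = j then 1 else 0)"
      unfolding uu using c0 by (simp add: field_simps)
    finally show "(H * H) $$ (i,j) = 1\<^sub>m (Suc n) $$ (i,j)" using ij by simp
  qed (use H in auto)
  hence "unitary_mat (Suc n) H" using H adjH by (simp add: unitary_mat_def)
  moreover have "col H 0 = v"
  proof (rule eq_vecI)
    fix i assume "i < dim_vec v"
    hence i: "i < Suc n" using v by simp
    have "cnj (u 0) = - c" by (simp add: u_def v0 c_def)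
    hence "col H 0 $ i = (if i = 0 then 1 else 0) + u i"
      using i c0 H by (simp add: H_def)
    thus "col H 0 $ i = v $ i" by (simp add: u_def)
  qed (use v H in simp)
  ultimately show ?thesis using adjH by blast
qed

lemma unit_eigenvector:
  assumes A: "A \<in> carrier_mat (Suc n) (Suc n)"
  shows "\<exists>e v t. v \<in> carrier_vec (Suc n) \<and> vnsq v = 1 \<and> v $ 0 = of_real t \<and> t \<le> 0 \<and> A *\<^sub>v v = e \<cdot>\<^sub>v v"
proof -
  from spectrum_non_empty[OF A] obtain e where "eigenvalue A e" by (auto simp: spectrum_def)
  then obtain w where w: "w \<in> carrier_vec (Suc n)" "w \<noteq> 0\<^sub>v (Suc n)" "A *\<^sub>v w = e \<cdot>\<^sub>v w"
    using A by (auto simp: eigenvalue_def eigenvector_def)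
  have pos: "vnsq w > 0"
  proof (rule ccontr)
    assume "\<not> vnsq w > 0"
    hence "vnsq w = 0" using vnsq_nonneg[of w] by linarith
    hence "\<forall>i<Suc n. w $ i = 0" using w(1)
      by (auto simp: vnsq_def sum_nonneg_eq_0_iff simp del: sum.lessThan_Suc)
    hence "w = 0\<^sub>v (Suc n)" using w(1) by (intro eq_vecI) auto
    thus False using w(2) by simp
  qed
  \<comment> \<open>The phase that turns the first entry into minus its modulus, as the reflection
    requires; if that entry is zero any phase will do.\<close>
  define p where "p = (if w $ 0 = 0 then 1 else - cnj (w $ 0) / of_real (cmod (w $ 0)))"
  have p1: "cmod p = 1" by (simp add: p_def norm_divide)
  have p0: "p * w $ 0 = - of_real (cmod (w $ 0))"
    by (auto simp: p_def field_simps complex_norm_square[symmetric] power2_eq_square[symmetric] simp del: of_real_power)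
       (simp add: complex_norm_square[symmetric] power2_eq_square mult.commute)
  define s where "s = p / of_real (sqrt (vnsq w))"
  define v where "v = s \<cdot>\<^sub>v w"
  have "vnsq v = (\<Sum>i<Suc n. (cmod s)\<^sup>2 * (cmod (w $ i))\<^sup>2)"
    using w(1) by (simp add: v_def vnsq_def norm_mult power_mult_distrib del: sum.lessThan_Suc)
  also have "\<dots> = (cmod s)\<^sup>2 * vnsq w" using w(1) by (simp add: vnsq_def sum_distrib_left del: sum.lessThan_Suc)
  also have "\<dots> = 1" using pos p1 by (simp add: s_def norm_divide power_divide)
  finally have 1: "vnsq v = 1" .
  have 2: "v $ 0 = of_real (- cmod (w $ 0) / sqrt (vnsq w))"
    using w(1) p0 by (simp add: v_def s_def)
  have 3: "A *\<^sub>v v = e \<cdot>\<^sub>v v"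
    using A w by (simp add: v_def mult_mat_vec[OF A w(1)] smult_smult_assoc mult.commute)
  show ?thesis using 1 2 3 w(1) pos
    by (intro exI[of _ e] exI[of _ v] exI[of _ "- cmod (w $ 0) / sqrt (vnsq w)"] conjI)
       (auto simp: v_def divide_nonpos_nonneg)
qed

text \<open>Conjugation by the reflection \<open>H\<close> carries a unit eigenvector to the first
  basis vector, so the first column becomes diagonal. Hermitian symmetry then clears the first row
  and makes the eigenvalue real, leaving a direct sum of a real scalar and a smaller Hermitian block
  for the induction.\<close>

theorem hermitian_spectral:
  assumes "A \<in> carrier_mat n n" "adj A = A"
  shows "\<exists>U d. unitary_mat n U \<and> A = U * diagm n d * adj U"
  using assms
proof (induction n arbitrary: A)
  case 0
  have "unitary_mat 0 (1\<^sub>m 0)" by (simp add: unitary_mat_def)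
  moreover have "A = 1\<^sub>m 0 * diagm 0 (\<lambda>_. 0) * adj (1\<^sub>m 0)" using 0(1) by (intro eq_matI) auto
  ultimately show ?case by blast
next
  case (Suc n)
  note A = Suc.prems(1)
  obtain e v t where v: "v \<in> carrier_vec (Suc n)" "vnsq v = 1" "v $ 0 = of_real t" "t \<le> 0" "A *\<^sub>v v = e \<cdot>\<^sub>v v"
    using unit_eigenvector[OF A] by blast
  obtain H where H: "unitary_mat (Suc n) H" "adj H = H" "col H 0 = v" using householder[OF v(1-4)] by blast
  have Hc: "H \<in> carrier_mat (Suc n) (Suc n)" and HH: "H * H = 1\<^sub>m (Suc n)"
    using H(1,2) by (auto simp: unitary_mat_def)
  define A' where "A' = H * A * H"
  have A': "A' \<in> carrier_mat (Suc n) (Suc n)" using A Hc by (auto simp: A'_def)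
  have adjA': "adj A' = A'" using A Hc Suc.prems(2) H(2)
    by (simp add: A'_def adj_mult mat_assoc)
  have "col A' 0 = (H * A) *\<^sub>v col H 0"
    unfolding A'_def by (rule col_mult2) (use A Hc in auto)
  also have "\<dots> = H *\<^sub>v (e \<cdot>\<^sub>v v)" using A Hc v H(3) by (simp add: assoc_mult_mat_vec[of _ "Suc n" "Suc n" _ "Suc n"])
  also have "\<dots> = e \<cdot>\<^sub>v (H *\<^sub>v col H 0)" using Hc v H(3) by (simp add: mult_mat_vec)
  also have "H *\<^sub>v col H 0 = col (1\<^sub>m (Suc n)) 0" using col_mult2[OF Hc Hc, of 0] HH by simp
  finally have c0: "col A' 0 = e \<cdot>\<^sub>v unit_vec (Suc n) 0" by simp
  have a0: "A' $$ (i,0) = (if i = 0 then e else 0)" if "i < Suc n" for i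
    using arg_cong[OF c0, of "\<lambda>v. v $ i"] that A' by (auto simp: unit_vec_def)
  have a0': "A' $$ (0,i) = cnj (A' $$ (i,0))" if "i < Suc n" for i
    using that A' arg_cong[OF adjA', of "\<lambda>M. M $$ (0,i)"] by simp
  define B where "B = mat n n (\<lambda>(i,j). A' $$ (Suc i, Suc j))"
  have B: "B \<in> carrier_mat n n" by (simp add: B_def)
  have adjB: "adj B = B"
  proof (rule eq_matI)
    fix i j assume "i < dim_row B" "j < dim_col B"
    hence ij: "i < n" "j < n" using B by auto
    thus "adj B $$ (i,j) = B $$ (i,j)"
      using A' arg_cong[OF adjA', of "\<lambda>M. M $$ (Suc i,Suc j)"] by (simp add: B_def)
  qed (use B in auto)
  have eR: "e = of_real (Re e)" using a0'[of 0] a0[of 0] by (simp add: complex_eq_iff)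
  have A'B: "A' = lift_mat (of_real (Re e)) B"
    unfolding eR[symmetric]
    by (rule eq_matI) (use A' a0 a0' in \<open>auto simp: lift_mat_def B_def\<close>)
  obtain U d where U: "unitary_mat n U" and BU: "B = U * diagm n d * adj U"
    using Suc.IH[OF B adjB] by blast
  have Uc: "U \<in> carrier_mat n n" using U by (simp add: unitary_mat_def)
  have LU: "unitary_mat (Suc n) (lift_mat 1 U)"
    using U by (auto simp: unitary_mat_def adj_lift_mat lift_mat_mult[of _ n] lift_mat_one)
  have "A' = lift_mat 1 U * diagm (Suc n) (case_nat (Re e) d) * adj (lift_mat 1 U)"
    unfolding A'B BU lift_mat_diagm[symmetric] adj_lift_mat
    using Uc by (simp add: lift_mat_mult[of _ n])
  moreover have "A = H * A' * H"
  proof -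
    have "H * A' * H = (H * H) * A * (H * H)"
      unfolding A'_def using A Hc by (simp add: mat_assoc)
    thus ?thesis using HH A by simp
  qed
  ultimately have "A = (H * lift_mat 1 U) * diagm (Suc n) (case_nat (Re e) d) * adj (H * lift_mat 1 U)"
    using Hc Uc H(2) by (simp add: adj_mult 
        mat_assoc)
  moreover have "unitary_mat (Suc n) (H * lift_mat 1 U)" using H(1) LU by (rule unitary_mult)
  ultimately show ?case by blast
qed

subsection \<open>Positive matrices, square roots and trace norm\<close>

text \<open>The squared Frobenius norm. For the square root of a positive matrix it is the trace,
  hence one for states.\<close>

definition fro :: "complex mat \<Rightarrow> real" where
  "fro A = (\<Sum>i<dim_row A. \<Sum>j<dim_col A. (cmod (A $$ (i,j)))\<^sup>2)"

lemma fro_nonneg [simp]: "0 \<le> fro A"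
  by (simp add: fro_def sum_nonneg)

lemma mtrace_mult:
  assumes "A \<in> carrier_mat n m" "B \<in> carrier_mat m n"
  shows "mtrace (A * B) = (\<Sum>i<n. \<Sum>l<m. A $$ (i,l) * B $$ (l,i))"
proof -
  have "mtrace (A * B) = (\<Sum>i<n. (A * B) $$ (i,i))" using assms by (simp add: mtrace_def)
  also have "\<dots> = (\<Sum>i<n. \<Sum>l<m. A $$ (i,l) * B $$ (l,i))"
    by (intro sum.cong refl index_mult_mat_sum[OF assms]) auto
  finally show ?thesis .
qed

lemma mtrace_mult_comm:
  assumes "A \<in> carrier_mat n m" "B \<in> carrier_mat m n"
  shows "mtrace (A * B) = mtrace (B * A)"
  unfolding mtrace_mult[OF assms] mtrace_mult[OF assms(2,1)]
  by (subst sum.swap) (simp add: mult.commute)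

lemma mtrace_add: "A \<in> carrier_mat n n \<Longrightarrow> B \<in> carrier_mat n n \<Longrightarrow> mtrace (A + B) = mtrace A + mtrace B"
  by (simp add: mtrace_def sum.distrib)

lemma mtrace_adj: "A \<in> carrier_mat n n \<Longrightarrow> mtrace (adj A) = cnj (mtrace A)"
  by (simp add: mtrace_def)

lemma mtrace_diagm: "mtrace (diagm n d) = of_real (\<Sum>i<n. d i)"
  by (simp add: mtrace_def diagm_def)

lemma mtrace_unitary:
  assumes U: "unitary_mat n U" and X: "X \<in> carrier_mat n n"
  shows "mtrace (U * X * adj U) = mtrace X"
proof -
  have Uc: "U \<in> carrier_mat n n" using U by (simp add: unitary_mat_def)
  have "mtrace (U * X * adj U) = mtrace (U * (X * adj U))"
    using Uc X by (simp add: mat_assoc)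
  also have "\<dots> = mtrace ((X * adj U) * U)"
    by (rule mtrace_mult_comm[of _ n n]) (use Uc X in auto)
  also have "(X * adj U) * U = X"
    using U Uc X by (simp add: mat_assoc unitary_mat_def)
  finally show ?thesis .
qed

lemma mtrace_adj_mult: "mtrace (adj A * A) = of_real (fro A)"
proof -
  have "mtrace (adj A * A) = (\<Sum>j<dim_col A. \<Sum>i<dim_row A. adj A $$ (j,i) * A $$ (i,j))"
    by (rule mtrace_mult) auto
  also have "\<dots> = (\<Sum>i<dim_row A. \<Sum>j<dim_col A. adj A $$ (j,i) * A $$ (i,j))"
    by (rule sum.swap)
  also have "\<dots> = of_real (fro A)"
    unfolding fro_def of_real_sum
    by (intro sum.cong refl) (simp add: complex_norm_square mult.commute del: of_real_power)
  finally show ?thesis .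
qed

lemma fro_eq_0:
  assumes "fro A = 0" "A \<in> carrier_mat n m"
  shows "A = 0\<^sub>m n m"
proof (rule eq_matI)
  fix i j assume "i < dim_row (0\<^sub>m n m :: complex mat)" "j < dim_col (0\<^sub>m n m :: complex mat)"
  hence ij: "i < n" "j < m" by auto
  have "\<forall>i<n. (\<Sum>j<m. (cmod (A $$ (i,j)))\<^sup>2) = 0"
    using assms by (simp add: fro_def sum_nonneg_eq_0_iff sum_nonneg)
  hence "\<forall>j<m. (cmod (A $$ (i,j)))\<^sup>2 = 0" using ij by (subst (asm) sum_nonneg_eq_0_iff) auto
  thus "A $$ (i,j) = 0\<^sub>m n m $$ (i,j)" using ij by simp
qed (use assms in auto)

lemma psd_iff_cdot:
  "psd n A \<longleftrightarrow> A \<in> carrier_mat n n \<and> adj A = A \<and> (\<forall>v \<in> carrier_vec n. 0 \<le> Re (cdot v (A *\<^sub>v v)))"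
  unfolding psd_def cdot_def by (auto simp: carrier_matD)

lemma psdD: "psd n A \<Longrightarrow> A \<in> carrier_mat n n" "psd n A \<Longrightarrow> adj A = A"
  by (auto simp: psd_def)

section \<open>Spectral calculus for positive matrices\<close>

lemma psd_adj_mult:
  assumes A: "A \<in> carrier_mat n m"
  shows "psd m (adj A * A)"
  unfolding psd_iff_cdot
proof (intro conjI ballI)
  show "adj (adj A * A) = adj A * A" using A by (simp add: adj_mult)
  fix v :: "complex vec" assume v: "v \<in> carrier_vec m"
  have "cdot ((adj A * A) *\<^sub>v v) v = of_real (vnsq (A *\<^sub>v v))" using vnsq_mult[OF A v] by simp
  moreover have "cdot v ((adj A * A) *\<^sub>v v) = cdot (adj (adj A * A) *\<^sub>v v) v"
    by (rule cdot_adj) (use A v in auto)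
  ultimately show "0 \<le> Re (cdot v ((adj A * A) *\<^sub>v v))"
    using A by (simp add: adj_mult)
qed (use A in auto)

lemma unitary_diagm_mult:
  assumes "unitary_mat n U"
  shows "(U * diagm n a * adj U) * (U * diagm n b * adj U) = U * diagm n (\<lambda>i. a i * b i) * adj U"
proof -
  have Uc: "U \<in> carrier_mat n n" using assms by (simp add: unitary_mat_def)
  show ?thesis
    using unitary_cancel[OF assms, of "diagm n b * adj U"] Uc
    by (simp add: mat_assoc diagm_mult[symmetric])
qed

lemma adj_unitary_diagm:
  assumes "U \<in> carrier_mat n n"
  shows "adj (U * diagm n d * adj U) = U * diagm n d * adj U"
  using assms by (simp add: adj_mult mat_assoc)

lemma psd_unitary_diagm:
  assumes U: "unitary_mat n U" and d: "\<And>i. i < n \<Longrightarrow> 0 \<le> d i"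
  shows "psd n (U * diagm n d * adj U)"
proof -
  have Uc: "U \<in> carrier_mat n n" using U by (simp add: unitary_mat_def)
  let ?R = "U * diagm n (\<lambda>i. sqrt (d i)) * adj U"
  have "psd n (adj ?R * ?R)" by (rule psd_adj_mult) (use Uc in auto)
  also have "adj ?R * ?R = U * diagm n (\<lambda>i. sqrt (d i) * sqrt (d i)) * adj U"
    by (simp add: adj_unitary_diagm[OF Uc] unitary_diagm_mult[OF U])
  also have "diagm n (\<lambda>i. sqrt (d i) * sqrt (d i)) = diagm n d" by (rule diagm_sqrt_mult[OF d])
  finally show ?thesis .
qed

text \<open>Links a diagonal entry in a rotated basis to a quadratic form, which is how positivity
  reaches eigenvalues and diagonal entries.\<close>

lemma unitary_conj_diag_entry:
  assumes "U \<in> carrier_mat n n" "A \<in> carrier_mat n n" "i < n"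
  shows "(adj U * A * U) $$ (i,i) = cdot (col U i) (A *\<^sub>v col U i)"
proof -
  have "(adj U * A * U) $$ (i,i) = (adj U * (A * U)) $$ (i,i)" using assms by (simp add: mat_assoc)
  also have "\<dots> = (\<Sum>l<n. adj U $$ (i,l) * (A * U) $$ (l,i))"
    by (rule index_mult_mat_sum) (use assms in auto)
  also have "\<dots> = cdot (col U i) (A *\<^sub>v col U i)"
    using assms by (simp add: cdot_def)
  finally show ?thesis .
qed

lemma vnsq_unitary_col:
  assumes "unitary_mat n U" "i < n"
  shows "vnsq (col U i) = 1"
proof -
  have U: "U \<in> carrier_mat n n" "adj U * U = 1\<^sub>m n" using assms by (auto simp: unitary_mat_def)
  have "(adj U * 1\<^sub>m n * U) $$ (i,i) = cdot (col U i) (1\<^sub>m n *\<^sub>v col U i)"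
    by (rule unitary_conj_diag_entry) (use U assms in auto)
  hence "cdot (col U i) (col U i) = 1" using U assms by simp
  thus ?thesis by (simp add: cdot_self)
qed

lemma unitary_diagm_inverse:
  assumes "unitary_mat n U"
  shows "adj U * (U * diagm n d * adj U) * U = diagm n d"
proof -
  have Uc: "U \<in> carrier_mat n n" "adj U * U = 1\<^sub>m n" using assms by (auto simp: unitary_mat_def)
  show ?thesis using unitary_cancel[OF assms, of "diagm n d"] Uc
    by (simp add: mat_assoc)
qed

lemma psd_spectral:
  assumes "psd n A"
  shows "\<exists>U d. unitary_mat n U \<and> (\<forall>i<n. 0 \<le> d i) \<and> A = U * diagm n d * adj U"
proof -
  obtain U d where U: "unitary_mat n U" and A: "A = U * diagm n d * adj U"
    using hermitian_spectral psdD[OF assms] by blast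
  have Uc: "U \<in> carrier_mat n n" using U by (simp add: unitary_mat_def)
  have "0 \<le> d i" if i: "i < n" for i
  proof -
    have "complex_of_real (d i) = (adj U * A * U) $$ (i,i)"
      using i unfolding A unitary_diagm_inverse[OF U] by (simp add: diagm_def)
    also have "\<dots> = cdot (col U i) (A *\<^sub>v col U i)"
      by (rule unitary_conj_diag_entry) (use Uc i psdD[OF assms] in auto)
    finally have "d i = Re (cdot (col U i) (A *\<^sub>v col U i))" by (metis Re_complex_of_real)
    thus ?thesis using assms Uc i by (auto simp: psd_iff_cdot)
  qed
  thus ?thesis using U A by blast
qed

text \<open>Taking the trace in the eigenbasis of one factor leaves only the diagonal entries of the
  other, although the two factors need not commute.\<close>

lemma mtrace_diagm_conj:
  assumes U: "unitary_mat n U" and P: "P \<in> carrier_mat n n"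
  shows "mtrace (U * diagm n d * adj U * P) = (\<Sum>i<n. of_real (d i) * (adj U * P * U) $$ (i,i))"
proof -
  have Uc: "U \<in> carrier_mat n n" using U by (simp add: unitary_mat_def)
  have "mtrace (U * diagm n d * adj U * P) = mtrace (U * (diagm n d * (adj U * P)))"
    using Uc P by (simp add: mat_assoc)
  also have "\<dots> = mtrace (diagm n d * (adj U * P) * U)"
    by (rule mtrace_mult_comm[of _ n n]) (use Uc P in auto)
  also have "diagm n d * (adj U * P) * U = diagm n d * (adj U * P * U)"
    using Uc P by (simp add: mat_assoc)
  also have "mtrace \<dots> = (\<Sum>i<n. \<Sum>l<n. diagm n d $$ (i,l) * (adj U * P * U) $$ (l,i))"
    by (rule mtrace_mult) (use Uc P in auto)
  also have "\<dots> = (\<Sum>i<n. \<Sum>l<n. if l = i then of_real (d i) * (adj U * P * U) $$ (i,i) else 0)"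
    by (intro sum.cong refl) (auto simp: diagm_def)
  finally show ?thesis by simp
qed

text \<open>The Powers--Stormer argument: with \<open>S = P - Q\<close> diagonal, \<open>C = sgn S\<close> satisfies
  \<open>tr (C (P\<^sup>2 - Q\<^sup>2)) = tr (|S| (P + Q)) \<ge> tr (|S| |S|)\<close>.\<close>

lemma powers_stormer:
  assumes P: "psd n P" and Q: "psd n Q"
  shows "\<exists>C \<in> carrier_mat n n. contraction C \<and> fro (P - Q) \<le> Re (mtrace (C * (P * P - Q * Q)))"
proof -
  note Pc = psdD[OF P] and Qc = psdD[OF Q]
  define S where "S = P - Q"
  have S: "S \<in> carrier_mat n n" "adj S = S"
    using Pc Qc by (auto simp: S_def adj_minus[of _ n n])
  obtain U s where U: "unitary_mat n U" and SU: "S = U * diagm n s * adj U"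
    using hermitian_spectral[OF S] by blast
  have Uc: "U \<in> carrier_mat n n" using U by (simp add: unitary_mat_def)
  define C where "C = U * diagm n (\<lambda>i. sgn (s i)) * adj U"
  define T where "T = U * diagm n (\<lambda>i. \<bar>s i\<bar>) * adj U"
  have C: "C \<in> carrier_mat n n" and T: "T \<in> carrier_mat n n" using Uc by (auto simp: C_def T_def)
  have CS: "C * S = T" "S * C = T"
    unfolding C_def SU T_def unitary_diagm_mult[OF U] by (simp_all add: abs_sgn mult.commute)
  have contr: "contraction C" unfolding C_def
    by (intro contraction_mult[of _ n n _ n] contraction_diagm unitary_contraction[of n] U unitary_adj)
       (use Uc in \<open>auto simp: abs_sgn_eq\<close>)
  \<comment> \<open>Without commutation the difference of squares is split by inserting
    \<open>P * Q\<close>. Each summand has \<open>S\<close> on an outer side, so cyclicity of the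
    trace can bring it next to its sign \<open>C\<close>.\<close>
  have "P * P - Q * Q = P * S + S * Q"
  proof -
    have "P * S = P * P - P * Q" "S * Q = P * Q - Q * Q"
      unfolding S_def using Pc Qc by (simp_all add: mult_minus_distrib_mat minus_mult_distrib_mat)
    thus ?thesis using Pc Qc by (intro eq_matI) auto
  qed
  hence "C * (P * P - Q * Q) = C * (P * S) + C * (S * Q)"
    using C Pc Qc S by (simp add: mult_add_distrib_mat[of _ n n _ n])
  hence "mtrace (C * (P * P - Q * Q)) = mtrace (C * (P * S)) + mtrace (C * (S * Q))"
    using C Pc Qc S by (simp add: mtrace_add[of _ n])
  also have "mtrace (C * (P * S)) = mtrace ((C * P) * S)" using C Pc S by (simp add: mat_assoc)
  also have "\<dots> = mtrace (S * (C * P))" by (rule mtrace_mult_comm[of _ n n]) (use C Pc S in auto)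
  also have "S * (C * P) = T * P" unfolding CS(2)[symmetric] using C Pc S by (simp add: mat_assoc)
  also have "C * (S * Q) = T * Q" unfolding CS(1)[symmetric] using C Qc S by (simp add: mat_assoc)
  finally have tr: "mtrace (C * (P * P - Q * Q)) = mtrace (T * P) + mtrace (T * Q)" .
  define p where "p i = Re ((adj U * P * U) $$ (i,i))" for i
  define q where "q i = Re ((adj U * Q * U) $$ (i,i))" for i
  have pq0: "0 \<le> p i" "0 \<le> q i" if "i < n" for i
    unfolding p_def q_def unitary_conj_diag_entry[OF Uc Pc(1) that] unitary_conj_diag_entry[OF Uc Qc(1) that]
    using that P Q Uc by (auto simp: psd_iff_cdot)
  have pq: "p i - q i = s i" if i: "i < n" for i
  proof -
    have "adj U * S * U = adj U * P * U - adj U * Q * U"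
      unfolding S_def mult_minus_distrib_mat[OF adj_carrier[OF Uc] Pc(1) Qc(1)]
      by (rule minus_mult_distrib_mat) (use Uc Pc Qc in auto)
    hence "(adj U * S * U) $$ (i,i) = (adj U * P * U) $$ (i,i) - (adj U * Q * U) $$ (i,i)"
      using i Uc Pc Qc by simp
    moreover have "(adj U * S * U) $$ (i,i) = of_real (s i)"
      using i unfolding SU unitary_diagm_inverse[OF U] by (simp add: diagm_def)
    ultimately show ?thesis unfolding p_def q_def by (metis Re_complex_of_real minus_complex.simps(1))
  qed
  have "Re (mtrace (C * (P * P - Q * Q))) = (\<Sum>i<n. \<bar>s i\<bar> * (p i + q i))"
    unfolding tr unfolding T_def mtrace_diagm_conj[OF U Pc(1)] mtrace_diagm_conj[OF U Qc(1)]
    by (simp add: p_def q_def sum.distrib distrib_left)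
  moreover have "fro S = (\<Sum>i<n. s i * s i)"
  proof -
    have "complex_of_real (fro S) = mtrace (S * S)" using mtrace_adj_mult[of S] S by simp
    also have "\<dots> = mtrace (diagm n (\<lambda>i. s i * s i))"
      unfolding SU unitary_diagm_mult[OF U] by (rule mtrace_unitary[OF U]) simp
    finally show ?thesis unfolding mtrace_diagm of_real_eq_iff .
  qed
  \<comment> \<open>Both \<open>p i\<close> and \<open>q i\<close> are nonnegative, so the absolute
    value of their difference \<open>s i\<close> is at most their sum.\<close>
  moreover have "s i * s i \<le> \<bar>s i\<bar> * (p i + q i)" if "i < n" for i
  proof -
    have "\<bar>s i\<bar> * \<bar>s i\<bar> \<le> \<bar>s i\<bar> * (p i + q i)"
      using pq0[OF that] pq[OF that] by (intro mult_left_mono) auto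
    thus ?thesis by simp
  qed
  ultimately have "fro S \<le> Re (mtrace (C * (P * P - Q * Q)))" by (auto intro: sum_mono)
  thus ?thesis using C contr unfolding S_def by blast
qed

text \<open>Two positive roots of the same matrix have equal squares, so the Powers-Stormer bound
  forces their Frobenius distance to vanish. This makes the definite description in
  \<open>msqrt\<close> usable.\<close>

lemma msqrt_unique:
  assumes B: "psd n B" and "B * B = A"
  shows "msqrt A = B"
  unfolding msqrt_def
proof (rule the_equality)
  have n: "dim_row A = n" using assms psdD[OF B] by auto
  show "psd (dim_row A) B \<and> B * B = A" using assms n by simp
  fix D assume "psd (dim_row A) D \<and> D * D = A"
  hence D: "psd n D" "D * D = A" using n by auto
  obtain C where C: "C \<in> carrier_mat n n" "fro (D - B) \<le> Re (mtrace (C * (D * D - B * B)))"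
    using powers_stormer[OF D(1) B] by blast
  have "A \<in> carrier_mat n n" using assms psdD[OF B] by auto
  hence "C * (D * D - B * B) = 0\<^sub>m n n" using C(1) D(2) assms(2) by simp
  hence "fro (D - B) \<le> 0" using C(2) by (simp add: mtrace_def)
  hence "fro (D - B) = 0" using fro_nonneg[of "D - B"] by linarith
  hence 0: "D - B = 0\<^sub>m n n" by (rule fro_eq_0) (use psdD[OF B] psdD[OF D(1)] in auto)
  show "D = B"
  proof (rule eq_matI)
    fix i j assume ij: "i < dim_row B" "j < dim_col B"
    thus "D $$ (i,j) = B $$ (i,j)"
      using arg_cong[OF 0, of "\<lambda>M. M $$ (i,j)"] psdD[OF B] psdD[OF D(1)] by auto
  qed (use psdD[OF B] psdD[OF D(1)] in auto)
qed

lemma msqrt_unitary_diagm: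
  assumes U: "unitary_mat n U" and d: "\<And>i. i < n \<Longrightarrow> 0 \<le> d i"
  shows "msqrt (U * diagm n d * adj U) = U * diagm n (\<lambda>i. sqrt (d i)) * adj U"
proof (rule msqrt_unique)
  show "psd n (U * diagm n (\<lambda>i. sqrt (d i)) * adj U)"
    by (rule psd_unitary_diagm[OF U]) (use d in auto)
  have "diagm n (\<lambda>i. sqrt (d i) * sqrt (d i)) = diagm n d" by (rule diagm_sqrt_mult[OF d])
  thus "U * diagm n (\<lambda>i. sqrt (d i)) * adj U * (U * diagm n (\<lambda>i. sqrt (d i)) * adj U) = U * diagm n d * adj U"
    by (simp add: unitary_diagm_mult[OF U])
qed

lemma msqrt_psd:
  assumes "psd n A"
  shows "psd n (msqrt A)" "msqrt A * msqrt A = A"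
proof -
  obtain U d where U: "unitary_mat n U" and d: "\<forall>i<n. 0 \<le> d i" and A: "A = U * diagm n d * adj U"
    using psd_spectral[OF assms] by blast
  have s: "msqrt A = U * diagm n (\<lambda>i. sqrt (d i)) * adj U"
    unfolding A by (rule msqrt_unitary_diagm[OF U]) (use d in auto)
  show "psd n (msqrt A)" unfolding s by (rule psd_unitary_diagm[OF U]) (use d in auto)
  have "diagm n (\<lambda>i. sqrt (d i) * sqrt (d i)) = diagm n d" by (rule diagm_sqrt_mult) (use d in auto)
  thus "msqrt A * msqrt A = A" unfolding s unitary_diagm_mult[OF U] using A by metis
qed

text \<open>One half of the duality between trace norm and operator norm. In an eigenbasis of
  \<open>adj X * X\<close> the image of the basis vector with eigenvalue \<open>d i\<close> under
  \<open>X\<close> has squared norm \<open>d i\<close>, so Cauchy-Schwarz bounds each diagonal term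
  of \<open>C * X\<close> by the singular value \<open>sqrt (d i)\<close>.\<close>

lemma cmod_mtrace_le_trace_norm:
  assumes C: "C \<in> carrier_mat n m" and X: "X \<in> carrier_mat m n" and "contraction C"
  shows "cmod (mtrace (C * X)) \<le> trace_norm X"
proof -
  obtain U d where U: "unitary_mat n U" and d: "\<forall>i<n. 0 \<le> d i" and XX: "adj X * X = U * diagm n d * adj U"
    using psd_spectral[OF psd_adj_mult[OF X]] by blast
  have Uc: "U \<in> carrier_mat n n" using U by (simp add: unitary_mat_def)
  have "mtrace (msqrt (adj X * X)) = mtrace (diagm n (\<lambda>i. sqrt (d i)))"
    unfolding XX by (subst msqrt_unitary_diagm[OF U]) (use d in \<open>auto simp: mtrace_unitary[OF U]\<close>)
  hence tn: "trace_norm X = (\<Sum>i<n. sqrt (d i))" by (simp add: trace_norm_def mtrace_diagm)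
  have "mtrace (C * X) = mtrace (adj U * (C * X) * adj (adj U))"
    by (rule mtrace_unitary[OF unitary_adj[OF U], symmetric]) (use C X in auto)
  hence "mtrace (C * X) = (\<Sum>i<n. (adj U * (C * X) * U) $$ (i,i))" using Uc by (simp add: mtrace_def)
  also have "\<dots> = (\<Sum>i<n. cdot (col U i) ((C * X) *\<^sub>v col U i))"
    by (intro sum.cong refl unitary_conj_diag_entry) (use Uc C X in auto)
  finally have "cmod (mtrace (C * X)) \<le> (\<Sum>i<n. cmod (cdot (col U i) ((C * X) *\<^sub>v col U i)))"
    by (simp add: norm_sum)
  also have "\<dots> \<le> (\<Sum>i<n. sqrt (d i))"
  proof (rule sum_mono)
    fix i assume "i \<in> {..<n}" hence i: "i < n" by simp
    have u: "col U i \<in> carrier_vec n" using Uc i by auto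
    have "(cmod (cdot (col U i) ((C * X) *\<^sub>v col U i)))\<^sup>2 \<le> vnsq (col U i) * vnsq ((C * X) *\<^sub>v col U i)"
      by (rule cdot_Cauchy_Schwarz) (use C X u in auto)
    also have "\<dots> = vnsq (C *\<^sub>v (X *\<^sub>v col U i))"
      using C X u by (simp add: vnsq_unitary_col[OF U i] assoc_mult_mat_vec)
    also have "\<dots> \<le> vnsq (X *\<^sub>v col U i)" by (rule contractionD[OF assms(3) C]) (use X u in auto)
    also have "\<dots> = d i"
    proof -
      have "complex_of_real (vnsq (X *\<^sub>v col U i)) = cdot ((adj X * X) *\<^sub>v col U i) (col U i)"
        by (rule vnsq_mult[OF X u])
      also have "\<dots> = cdot (col U i) ((adj X * X) *\<^sub>v col U i)"
        using cdot_adj[OF mult_carrier_mat[OF adj_carrier[OF X] X] u u] X by (simp add: adj_mult)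
      also have "\<dots> = (adj U * (adj X * X) * U) $$ (i,i)"
        by (rule unitary_conj_diag_entry[symmetric]) (use Uc X i in auto)
      finally show ?thesis using i unfolding XX unitary_diagm_inverse[OF U] by (simp add: diagm_def)
    qed
    finally show "cmod (cdot (col U i) ((C * X) *\<^sub>v col U i)) \<le> sqrt (d i)" by (rule real_le_rsqrt)
  qed
  finally show ?thesis by (simp add: tn)
qed

text \<open>The adjoint of the polar isometry of \<open>A\<close>, built as the pseudo-inverse of
  the root of \<open>adj A * A\<close> followed on the right by \<open>adj A\<close>. Using a
  pseudo-inverse covers singular and rectangular \<open>A\<close>.\<close>

lemma polar_contraction:
  assumes A: "A \<in> carrier_mat n m"
  shows "\<exists>V \<in> carrier_mat m n. contraction V \<and> V * A = msqrt (adj A * A)"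
proof -
  obtain U d where U: "unitary_mat m U" and d: "\<forall>i<m. 0 \<le> d i" and AA: "adj A * A = U * diagm m d * adj U"
    using psd_spectral[OF psd_adj_mult[OF A]] by blast
  have Uc: "U \<in> carrier_mat m m" "adj U * U = 1\<^sub>m m" using U by (auto simp: unitary_mat_def)
  \<comment> \<open>Inverse singular values, set to zero on the kernel; \<open>r i * d i\<close> is
    then \<open>sqrt (d i)\<close> in either case.\<close>
  define r where "r i = (if d i = 0 then 0 else 1 / sqrt (d i))" for i
  define E where "E = U * diagm m r * adj U"
  define V where "V = E * adj A"
  have E: "E \<in> carrier_mat m m" "adj E = E" using Uc by (auto simp: E_def adj_unitary_diagm)
  have V: "V \<in> carrier_mat m n" using E A by (auto simp: V_def)
  have "V * A = E * (adj A * A)" using E A by (simp add: V_def mat_assoc)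
  also have "\<dots> = U * diagm m (\<lambda>i. r i * d i) * adj U" unfolding E_def AA unitary_diagm_mult[OF U] ..
  also have "diagm m (\<lambda>i. r i * d i) = diagm m (\<lambda>i. sqrt (d i))"
    by (rule eq_matI) (use d in \<open>auto simp: diagm_def r_def real_div_sqrt simp flip: of_real_mult of_real_divide\<close>)
  also have "U * diagm m (\<lambda>i. sqrt (d i)) * adj U = msqrt (adj A * A)"
    unfolding AA by (rule msqrt_unitary_diagm[OF U, symmetric]) (use d in auto)
  finally have VA: "V * A = msqrt (adj A * A)" .
  let ?c = "\<lambda>i. r i * d i * r i"
  have "adj (adj V) * adj V = U * diagm m ?c * adj U"
  proof -
    have "adj (adj V) * adj V = (E * (adj A * A)) * E"
      using E A by (simp add: V_def mat_assoc adj_mult)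
    also have "\<dots> = U * diagm m ?c * adj U" unfolding AA unfolding E_def unitary_diagm_mult[OF U] ..
    finally show ?thesis .
  qed
  moreover have c: "?c i = (if d i = 0 then 0 else 1)" if "i < m" for i
    using d that by (auto simp: r_def)
  \<comment> \<open>The numbers \<open>?c i\<close> are indicators of nonzero eigenvalues, so
    \<open>V * adj V\<close> is a projection. Written as its own square it shows that
    \<open>adj V\<close> has the same effect on norms as that projection.\<close>
  have "diagm m ?c = diagm m (\<lambda>i. ?c i * ?c i)"
    by (rule eq_matI) (auto simp: diagm_def c simp flip: of_real_mult)
  ultimately have P: "adj (adj V) * adj V = (U * diagm m ?c * adj U) * (U * diagm m ?c * adj U)"
    unfolding unitary_diagm_mult[OF U] by metis
  have "contraction (adj V)"
    unfolding contraction_def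
  proof
    fix v :: "complex vec" assume "v \<in> carrier_vec (dim_col (adj V))"
    hence v: "v \<in> carrier_vec m" using V by simp
    have X: "U * diagm m ?c * adj U \<in> carrier_mat m m" using Uc by auto
    have cc: "contraction (U * diagm m ?c * adj U)"
      by (intro contraction_mult[of _ m m _ m] contraction_diagm unitary_contraction[of m] U unitary_adj)
         (use Uc c in \<open>auto simp: abs_le_iff\<close>)
    have "complex_of_real (vnsq (adj V *\<^sub>v v)) = cdot ((adj (adj V) * adj V) *\<^sub>v v) v"
      by (rule vnsq_mult[of _ n m]) (use V v in auto)
    also have "\<dots> = complex_of_real (vnsq ((U * diagm m ?c * adj U) *\<^sub>v v))"
      using vnsq_mult[OF X v] unfolding P adj_unitary_diagm[OF Uc(1)] by simp
    finally show "vnsq (adj V *\<^sub>v v) \<le> vnsq v" using contractionD[OF cc X v] by simp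
  qed
  from contraction_adj[OF adj_carrier[OF V] this] have "contraction V" by simp
  thus ?thesis using V VA by blast
qed

lemma mtrace_psd:
  assumes "psd n A"
  shows "mtrace A = of_real (Re (mtrace A))" "0 \<le> Re (mtrace A)"
proof -
  obtain U d where U: "unitary_mat n U" and d: "\<forall>i<n. 0 \<le> d i" and A: "A = U * diagm n d * adj U"
    using psd_spectral[OF assms] by blast
  have "mtrace A = of_real (\<Sum>i<n. d i)" unfolding A by (simp add: mtrace_unitary[OF U] mtrace_diagm)
  thus "mtrace A = of_real (Re (mtrace A))" "0 \<le> Re (mtrace A)" using d by (auto intro: sum_nonneg)
qed

text \<open>The other half of the duality: the polar contraction attains the trace norm, and the
  trace it produces is real because it is that of a positive matrix.\<close>

lemma trace_norm_attained:
  assumes A: "A \<in> carrier_mat n m"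
  shows "\<exists>V \<in> carrier_mat m n. contraction V \<and> mtrace (V * A) = of_real (trace_norm A)"
  using polar_contraction[OF A] mtrace_psd(1)[OF msqrt_psd(1)[OF psd_adj_mult[OF A]]]
  by (auto simp: trace_norm_def)

subsection \<open>Overlaps and pure-state fidelity\<close>

text \<open>The scalar \<open>s\<close> solves \<open>2 * s - s\<^sup>2 * W = 1\<close>, where
  \<open>W\<close> is the squared norm of \<open>w\<close>, so subtracting \<open>s\<close> times
  the rank-one part of \<open>w\<close> acts as a square root of the identity minus that part. Among
  the two roots this is the one that remains defined at \<open>W = 0\<close>, in rationalised
  form.\<close>

lemma defect_norm:
  fixes u w :: "'i \<Rightarrow> complex"
  assumes w: "(\<Sum>i\<in>I. (cmod (w i))\<^sup>2) \<le> 1"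
  defines "s \<equiv> 1 / (1 + sqrt (1 - (\<Sum>i\<in>I. (cmod (w i))\<^sup>2)))"
  shows "(\<Sum>i\<in>I. (cmod (u i - of_real s * cnj (w i) * (\<Sum>j\<in>I. w j * u j)))\<^sup>2)
    = (\<Sum>i\<in>I. (cmod (u i))\<^sup>2) - (cmod (\<Sum>j\<in>I. w j * u j))\<^sup>2"
proof -
  define a where "a = (\<Sum>j\<in>I. w j * u j)"
  define W where "W = (\<Sum>i\<in>I. (cmod (w i))\<^sup>2)"
  have s: "2 * s - s\<^sup>2 * W = 1"
  proof -
    define q where "q = sqrt (1 - W)"
    have q: "q \<ge> 0" "W = 1 - q\<^sup>2" using w by (auto simp: q_def W_def)
    hence q1: "1 + q \<noteq> 0" by simp
    have "1 - q\<^sup>2 = (1 + q) * (1 - q)" by (simp add: power2_eq_square algebra_simps)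
    hence "(1 / (1 + q))\<^sup>2 * (1 - q\<^sup>2) = (1 - q) / (1 + q)" using q1 by (simp add: power2_eq_square)
    hence "2 / (1 + q) - (1 / (1 + q))\<^sup>2 * (1 - q\<^sup>2) = 1"
      using q1 by (simp add: diff_divide_distrib[symmetric])
    thus ?thesis using q by (simp add: s_def W_def[symmetric] q_def[symmetric])
  qed
  have "complex_of_real (\<Sum>i\<in>I. (cmod (u i - of_real s * cnj (w i) * a))\<^sup>2)
      = (\<Sum>i\<in>I. (u i - of_real s * cnj (w i) * a) * cnj (u i - of_real s * cnj (w i) * a))"
    by (simp add: complex_norm_square del: of_real_power)
  also have "\<dots> = (\<Sum>i\<in>I. u i * cnj (u i) - of_real s * cnj a * (w i * u i)
      - of_real s * a * cnj (w i * u i) + of_real (s\<^sup>2) * (a * cnj a) * (w i * cnj (w i)))"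
    by (intro sum.cong refl) (simp add: algebra_simps power2_eq_square)
  also have "\<dots> = (\<Sum>i\<in>I. u i * cnj (u i)) - of_real s * cnj a * a - of_real s * a * cnj a
      + of_real (s\<^sup>2) * (a * cnj a) * (\<Sum>i\<in>I. w i * cnj (w i))"
    by (simp only: sum.distrib sum_subtractf sum_distrib_left[symmetric] cnj_sum[symmetric] a_def[symmetric])
  also have "\<dots> = of_real ((\<Sum>i\<in>I. (cmod (u i))\<^sup>2) - (2 * s - s\<^sup>2 * W) * (cmod a)\<^sup>2)"
    by (simp add: W_def complex_norm_square del: of_real_power)
       (simp add: algebra_simps)
  finally have "(\<Sum>i\<in>I. (cmod (u i - of_real s * cnj (w i) * a))\<^sup>2)
      = (\<Sum>i\<in>I. (cmod (u i))\<^sup>2) - (2 * s - s\<^sup>2 * W) * (cmod a)\<^sup>2"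
    by (simp only: of_real_eq_iff)
  thus ?thesis unfolding s by (simp add: a_def)
qed

text \<open>The purified distance \<open>sqrt (\<parallel>u\<parallel>\<^sup>2 - |\<langle>w,u\<rangle>|\<^sup>2)\<close> to a fixed \<open>w\<close> is the norm of a linear image
  of \<open>u\<close>, hence obeys the triangle inequality; this is why the two error terms add without loss.\<close>

lemma overlap_perturbation:
  fixes u v w :: "'i \<Rightarrow> complex"
  assumes w: "(\<Sum>i\<in>I. (cmod (w i))\<^sup>2) \<le> 1" and u: "(\<Sum>i\<in>I. (cmod (u i))\<^sup>2) = 1"
    and v: "(\<Sum>i\<in>I. (cmod (v i))\<^sup>2) \<le> 1" and uv: "(\<Sum>i\<in>I. (cmod (u i - v i))\<^sup>2) \<le> \<eta>\<^sup>2"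
    and "0 \<le> \<eta>" "0 \<le> \<epsilon>" and ov: "sqrt (1 - \<epsilon>\<^sup>2) \<le> cmod (\<Sum>i\<in>I. w i * v i)"
  shows "1 - (\<epsilon> + \<eta>)\<^sup>2 \<le> (cmod (\<Sum>i\<in>I. w i * u i))\<^sup>2"
proof (cases "\<epsilon> \<le> 1")
  \<comment> \<open>Here \<open>sqrt (1 - \<epsilon>\<^sup>2)\<close> is negative and the overlap
    hypothesis carries no information, but the left side of the goal is nonpositive.\<close>
  case False
  hence "1 \<le> (\<epsilon> + \<eta>)\<^sup>2" using assms by (intro one_le_power) auto
  thus ?thesis using zero_le_power2[of "cmod (\<Sum>i\<in>I. w i * u i)"] by linarith
next
  case True
  define s where "s = 1 / (1 + sqrt (1 - (\<Sum>i\<in>I. (cmod (w i))\<^sup>2)))"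
  define p where "p u i = u i - of_real s * cnj (w i) * (\<Sum>j\<in>I. w j * u j)" for u :: "'i \<Rightarrow> complex" and i
  have L: "L2_set (\<lambda>i. cmod (p u i)) I = sqrt ((\<Sum>i\<in>I. (cmod (u i))\<^sup>2) - (cmod (\<Sum>j\<in>I. w j * u j))\<^sup>2)" for u
    unfolding L2_set_def p_def s_def defect_norm[OF w] ..
  have e2: "\<epsilon>\<^sup>2 \<le> 1" using True assms by (simp add: power_le_one)
  have add: "p u i = p (\<lambda>i. u i - v i) i + p v i" for i
    by (simp add: p_def algebra_simps sum_subtractf)
  have "L2_set (\<lambda>i. cmod (p u i)) I \<le> L2_set (\<lambda>i. cmod (p (\<lambda>i. u i - v i) i) + cmod (p v i)) I"
    by (rule L2_set_mono) (use add norm_triangle_ineq in auto)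
  also have "\<dots> \<le> L2_set (\<lambda>i. cmod (p (\<lambda>i. u i - v i) i)) I + L2_set (\<lambda>i. cmod (p v i)) I"
    by (rule L2_set_triangle_ineq)
  also have "L2_set (\<lambda>i. cmod (p (\<lambda>i. u i - v i) i)) I \<le> \<eta>"
    unfolding L using uv \<open>0 \<le> \<eta>\<close> by (intro real_le_lsqrt) (auto intro: order_trans[rotated])
  also have "L2_set (\<lambda>i. cmod (p v i)) I \<le> \<epsilon>"
  proof -
    have "1 - \<epsilon>\<^sup>2 = (sqrt (1 - \<epsilon>\<^sup>2))\<^sup>2" using e2 by simp
    also have "\<dots> \<le> (cmod (\<Sum>i\<in>I. w i * v i))\<^sup>2" by (rule power_mono[OF ov]) (use e2 in simp)
    finally show ?thesis unfolding L using v \<open>0 \<le> \<epsilon>\<close> by (intro real_le_lsqrt) auto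
  qed
  finally have "sqrt (1 - (cmod (\<Sum>j\<in>I. w j * u j))\<^sup>2) \<le> \<eta> + \<epsilon>" unfolding L u by simp
  hence "1 - (cmod (\<Sum>j\<in>I. w j * u j))\<^sup>2 \<le> (\<eta> + \<epsilon>)\<^sup>2" by (rule sqrt_le_D)
  thus ?thesis by (simp add: add.commute)
qed

lemma hermitian_index:
  "adj A = A \<Longrightarrow> A \<in> carrier_mat n n \<Longrightarrow> i < n \<Longrightarrow> j < n \<Longrightarrow> cnj (A $$ (j,i)) = A $$ (i,j)"
  by (metis adj_index carrier_matD)

lemma psd_smult:
  assumes "psd n A" "0 \<le> c"
  shows "psd n (complex_of_real c \<cdot>\<^sub>m A)"
  unfolding psd_iff_cdot
proof (intro conjI ballI)
  show "complex_of_real c \<cdot>\<^sub>m A \<in> carrier_mat n n" using psdD[OF assms(1)] by auto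
  show "adj (complex_of_real c \<cdot>\<^sub>m A) = complex_of_real c \<cdot>\<^sub>m A"
  proof (rule eq_matI)
    fix i j assume ij: "i < dim_row (complex_of_real c \<cdot>\<^sub>m A)" "j < dim_col (complex_of_real c \<cdot>\<^sub>m A)"
    thus "adj (complex_of_real c \<cdot>\<^sub>m A) $$ (i,j) = (complex_of_real c \<cdot>\<^sub>m A) $$ (i,j)"
      using psdD[OF assms(1)] hermitian_index[of A n i j] by simp
  qed (use psdD[OF assms(1)] in auto)
  fix v :: "complex vec" assume v: "v \<in> carrier_vec n"
  have "cdot v ((complex_of_real c \<cdot>\<^sub>m A) *\<^sub>v v) = of_real c * cdot v (A *\<^sub>v v)"
    using psdD(1)[OF assms(1)] v by (simp add: cdot_def sum_distrib_left mult.left_commute)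
  thus "0 \<le> Re (cdot v ((complex_of_real c \<cdot>\<^sub>m A) *\<^sub>v v))"
    using assms v by (simp add: psd_iff_cdot)
qed

text \<open>The rank-one projection \<open>p\<close> is its own square root, and the Gram matrix of
  \<open>msqrt \<rho> * p\<close> is \<open>p * \<rho> * p\<close>, a multiple \<open>c\<close> of
  \<open>p\<close>. The root of that matrix is \<open>sqrt c\<close> times \<open>p\<close>, whose
  trace is \<open>sqrt c\<close>.\<close>

lemma fidelity_pure:
  assumes \<rho>: "psd n \<rho>" and \<phi>: "\<phi> \<in> carrier_vec n" "vnsq \<phi> = 1"
  shows "fidelity \<rho> (ketbra \<phi> \<phi>) = sqrt (Re (cdot \<phi> (\<rho> *\<^sub>v \<phi>)))"
proof -
  define K where "K = mat 1 n (\<lambda>(i,j). cnj (\<phi> $ j))"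
  define p where "p = ketbra \<phi> \<phi>"
  define c where "c = Re (cdot \<phi> (\<rho> *\<^sub>v \<phi>))"
  have K: "K \<in> carrier_mat 1 n" by (simp add: K_def)
  note \<rho>c = psdD[OF \<rho>]
  have c0: "0 \<le> c" using \<rho> \<phi> by (simp add: c_def psd_iff_cdot)
  have pK: "p = adj K * K"
    by (rule eq_matI) (use \<phi> in \<open>auto simp: p_def ketbra_def K_def scalar_prod_def\<close>)
  have p: "psd n p" unfolding pK by (rule psd_adj_mult[OF K])
  have KK: "K * adj K = 1\<^sub>m 1"
  proof -
    have "(\<Sum>j<n. cnj (\<phi> $ j) * \<phi> $ j) = 1" using cdot_self[of \<phi>] \<phi> by (simp add: cdot_def)
    thus ?thesis by (intro eq_matI) (auto simp: K_def scalar_prod_def atLeast0LessThan)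
  qed
  have "complex_of_real c = cdot \<phi> (\<rho> *\<^sub>v \<phi>)"
  proof -
    have "cdot \<phi> (\<rho> *\<^sub>v \<phi>) = cdot (\<rho> *\<^sub>v \<phi>) \<phi>"
      using cdot_adj[OF \<rho>c(1) \<phi>(1) \<phi>(1)] \<rho>c(2) by simp
    also have "\<dots> = cnj (cdot \<phi> (\<rho> *\<^sub>v \<phi>))"
      using \<phi> \<rho>c(1) by (simp add: cdot_def mult.commute)
    finally show ?thesis unfolding c_def by (metis Reals_cnj_iff of_real_Re)
  qed
  also have "\<dots> = (K * \<rho> * adj K) $$ (0,0)"
  proof -
    have "(K * \<rho> * adj K) $$ (0,0) = (K * (\<rho> * adj K)) $$ (0,0)" using K \<rho>c by (simp add: mat_assoc)
    also have "\<dots> = (\<Sum>l<n. K $$ (0,l) * (\<rho> * adj K) $$ (l,0))"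
      by (rule index_mult_mat_sum[of _ 1 _ _ 1]) (use K \<rho>c in auto)
    also have "\<dots> = (\<Sum>l<n. cnj (\<phi> $ l) * (\<rho> *\<^sub>v \<phi>) $ l)"
    proof (intro sum.cong refl)
      fix l assume "l \<in> {..<n}"
      have "col (adj K) 0 = \<phi>" by (rule eq_vecI) (use \<phi> in \<open>auto simp: K_def\<close>)
      thus "K $$ (0,l) * (\<rho> * adj K) $$ (l,0) = cnj (\<phi> $ l) * (\<rho> *\<^sub>v \<phi>) $ l"
        using \<open>l \<in> {..<n}\<close> \<rho>c K by (simp add: K_def)
    qed
    finally show ?thesis using \<rho>c by (simp add: cdot_def)
  qed
  finally have K\<rho>K: "K * \<rho> * adj K = complex_of_real c \<cdot>\<^sub>m 1\<^sub>m 1"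
    using K by (intro eq_matI) (auto simp del: index_mult_mat(1))
  have pp: "p * p = p"
  proof -
    have "p * p = adj K * (K * adj K) * K" unfolding pK using K by (simp add: mat_assoc)
    thus ?thesis unfolding KK pK using K by simp
  qed
  have sp: "msqrt p = p" by (rule msqrt_unique[OF p pp])
  let ?s = "msqrt \<rho>"
  note s = msqrt_psd[OF \<rho>]
  have "adj (?s * p) * (?s * p) = p * (?s * ?s) * p"
    using psdD[OF s(1)] psdD[OF p] by (simp add: adj_mult mat_assoc)
  also have "\<dots> = adj K * (K * \<rho> * adj K) * K"
    unfolding s(2) pK using K \<rho>c by (simp add: mat_assoc)
  also have "\<dots> = complex_of_real c \<cdot>\<^sub>m p"
  proof -
    have "adj K * (complex_of_real c \<cdot>\<^sub>m 1\<^sub>m 1) = complex_of_real c \<cdot>\<^sub>m adj K"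
      using mult_smult_distrib[OF adj_carrier[OF K] one_carrier_mat, of "complex_of_real c"] K by simp
    thus ?thesis unfolding K\<rho>K pK using mult_smult_assoc_mat[OF adj_carrier[OF K] K] by simp
  qed
  finally have A: "adj (?s * p) * (?s * p) = complex_of_real c \<cdot>\<^sub>m p" .
  have "msqrt (complex_of_real c \<cdot>\<^sub>m p) = complex_of_real (sqrt c) \<cdot>\<^sub>m p"
  proof (rule msqrt_unique)
    show "psd n (complex_of_real (sqrt c) \<cdot>\<^sub>m p)" by (rule psd_smult[OF p]) (use c0 in simp)
    have "complex_of_real (sqrt c) \<cdot>\<^sub>m p * (complex_of_real (sqrt c) \<cdot>\<^sub>m p)
        = (complex_of_real (sqrt c) * complex_of_real (sqrt c)) \<cdot>\<^sub>m (p * p)"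
      using psdD[OF p] by (intro eq_matI) (auto simp: mult_smult_distrib[of _ n n] mult_smult_assoc_mat[of _ n n])
    also have "complex_of_real (sqrt c) * complex_of_real (sqrt c) = complex_of_real c"
      using c0 by (metis of_real_mult real_sqrt_mult_self abs_of_nonneg)
    finally show "complex_of_real (sqrt c) \<cdot>\<^sub>m p * (complex_of_real (sqrt c) \<cdot>\<^sub>m p) = complex_of_real c \<cdot>\<^sub>m p"
      unfolding pp .
  qed
  moreover have "mtrace p = 1"
  proof -
    have "mtrace p = mtrace (K * adj K)" unfolding pK by (rule mtrace_mult_comm[of _ n 1]) (use K in auto)
    thus ?thesis unfolding KK by (simp add: mtrace_def)
  qed
  moreover have "mtrace (a \<cdot>\<^sub>m p) = a * mtrace p" for a
    using psdD[OF p] by (simp add: mtrace_def sum_distrib_left)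
  ultimately show ?thesis
    unfolding fidelity_def p_def[symmetric] sp trace_norm_def A by (simp add: c_def)
qed

subsection \<open>Kraus families and recovery channels\<close>

definition kapply :: "nat \<Rightarrow> complex mat list \<Rightarrow> complex mat \<Rightarrow> complex mat" where
  "kapply n Ks \<rho> = foldr (\<lambda>K acc. K * \<rho> * adj K + acc) Ks (0\<^sub>m n n)"

definition ksum :: "nat \<Rightarrow> complex mat list \<Rightarrow> complex mat" where
  "ksum m Ks = foldr (\<lambda>K acc. adj K * K + acc) Ks (0\<^sub>m m m)"

definition kprod :: "complex mat list \<Rightarrow> complex mat list \<Rightarrow> complex mat list" where
  "kprod Ks Ms = concat (map (\<lambda>K. map ((*) K) Ms) Ks)"

lemma is_channel_iff:
  "is_channel m n \<Phi> \<longleftrightarrow> (\<exists>Ks. set Ks \<subseteq> carrier_mat n m \<and> ksum m Ks = 1\<^sub>m m \<and>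
     (\<forall>\<rho> \<in> carrier_mat m m. \<Phi> \<rho> = kapply n Ks \<rho>))"
  unfolding is_channel_def ksum_def kapply_def by (auto simp: subset_iff)

lemma kapply_simps [simp]: "kapply n [] \<rho> = 0\<^sub>m n n" "kapply n (K # Ks) \<rho> = K * \<rho> * adj K + kapply n Ks \<rho>"
  by (simp_all add: kapply_def)

lemma ksum_simps [simp]: "ksum m [] = 0\<^sub>m m m" "ksum m (K # Ks) = adj K * K + ksum m Ks"
  by (simp_all add: ksum_def)

lemma kapply_carrier:
  "set Ks \<subseteq> carrier_mat n m \<Longrightarrow> kapply n Ks \<rho> \<in> carrier_mat n n"
  by (induction Ks) auto

lemma ksum_carrier:
  "set Ks \<subseteq> carrier_mat n m \<Longrightarrow> ksum m Ks \<in> carrier_mat m m"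
  by (induction Ks) auto

lemma adj_ksum: "set Ks \<subseteq> carrier_mat n m \<Longrightarrow> adj (ksum m Ks) = ksum m Ks"
proof (induction Ks)
  case Nil
  show ?case by (rule eq_matI) auto
next
  case (Cons K Ks)
  hence "adj (adj K * K + ksum m Ks) = adj (adj K * K) + adj (ksum m Ks)"
    using ksum_carrier[of Ks n m] by (intro adj_add[of _ m m]) auto
  thus ?case using Cons by (simp add: adj_mult)
qed

lemma kapply_index:
  assumes "set Ks \<subseteq> carrier_mat n m" "i < n" "j < n"
  shows "kapply n Ks \<rho> $$ (i,j) = (\<Sum>K\<leftarrow>Ks. (K * \<rho> * adj K) $$ (i,j))"
  using assms(1)
proof (induction Ks)
  case (Cons K Ks)
  have "kapply n Ks \<rho> \<in> carrier_mat n n" using Cons.prems kapply_carrier[of Ks n m \<rho>] by auto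
  thus ?case using Cons assms(2,3) by (simp del: index_mult_mat(1))
qed (use assms in simp)

lemma cdot_add:
  assumes "u \<in> carrier_vec n" "v \<in> carrier_vec n"
  shows "cdot w (u + v) = cdot w u + cdot w v"
  using assms by (simp add: cdot_def sum.distrib distrib_left)

lemma cdot_ksum:
  assumes "set Ks \<subseteq> carrier_mat n m" and v: "v \<in> carrier_vec m"
  shows "cdot v (ksum m Ks *\<^sub>v v) = of_real (\<Sum>K\<leftarrow>Ks. vnsq (K *\<^sub>v v))"
  using assms(1)
proof (induction Ks)
  case Nil
  have "0\<^sub>m m m *\<^sub>v v = (0\<^sub>v m :: complex vec)" using v by (intro eq_vecI) auto
  thus ?case using v by (simp add: cdot_def)
next
  case (Cons K Ks)
  have K: "K \<in> carrier_mat n m" and S: "ksum m Ks \<in> carrier_mat m m"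
    using Cons.prems ksum_carrier[of Ks n m] by auto
  have KK: "adj K * K \<in> carrier_mat m m" using K by auto
  have "cdot v (ksum m (K # Ks) *\<^sub>v v) = cdot v ((adj K * K) *\<^sub>v v) + cdot v (ksum m Ks *\<^sub>v v)"
    using KK S v by (simp add: add_mult_distrib_mat_vec[OF KK S v] cdot_add[of _ m])
  also have "cdot v ((adj K * K) *\<^sub>v v) = cdot ((adj K * K) *\<^sub>v v) v"
    using cdot_adj[OF KK v v] by (simp add: adj_mult)
  also have "\<dots> = of_real (vnsq (K *\<^sub>v v))" using vnsq_mult[OF K v] by simp
  finally show ?case using Cons by simp
qed

text \<open>Trace preservation as conservation of squared norms; its inequality version is what a
  partial recovery satisfies.\<close>

lemma ksum_one_vnsq:
  assumes "set Ks \<subseteq> carrier_mat n m" "ksum m Ks = 1\<^sub>m m" "v \<in> carrier_vec m"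
  shows "(\<Sum>K\<leftarrow>Ks. vnsq (K *\<^sub>v v)) = vnsq v"
  using cdot_ksum[OF assms(1,3)] assms by (simp add: cdot_self)

lemma kapply_append:
  assumes "set Ks \<subseteq> carrier_mat n m" "set Ls \<subseteq> carrier_mat n m"
  shows "kapply n (Ks @ Ls) \<rho> = kapply n Ks \<rho> + kapply n Ls \<rho>"
  using assms(1)
proof (induction Ks)
  case Nil
  show ?case using kapply_carrier[OF assms(2)] by simp
next
  case (Cons K Ks)
  hence K: "K * \<rho> * adj K \<in> carrier_mat n n" by auto
  have "kapply n Ks \<rho> \<in> carrier_mat n n" using Cons.prems kapply_carrier[of Ks n m \<rho>] by auto
  from assoc_add_mat[OF K this kapply_carrier[OF assms(2), of \<rho>]] show ?case using Cons by simp
qed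

lemma ksum_append:
  assumes "set Ks \<subseteq> carrier_mat n m" "set Ls \<subseteq> carrier_mat n m"
  shows "ksum m (Ks @ Ls) = ksum m Ks + ksum m Ls"
  using assms(1)
proof (induction Ks)
  case Nil
  show ?case using ksum_carrier[OF assms(2)] by simp
next
  case (Cons K Ks)
  hence K: "adj K * K \<in> carrier_mat m m" by auto
  have "ksum m Ks \<in> carrier_mat m m" using Cons.prems ksum_carrier[of Ks n m] by auto
  from assoc_add_mat[OF K this ksum_carrier[OF assms(2)]] show ?case using Cons by simp
qed

lemma kapply_map:
  assumes K: "K \<in> carrier_mat k n" and "set Ms \<subseteq> carrier_mat n m" and \<rho>: "\<rho> \<in> carrier_mat m m"
  shows "K * kapply n Ms \<rho> * adj K = kapply k (map ((*) K) Ms) \<rho>"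
  using assms(2)
proof (induction Ms)
  case Nil
  show ?case using K by simp
next
  case (Cons A Ms)
  have A: "A \<in> carrier_mat n m" and S: "kapply n Ms \<rho> \<in> carrier_mat n n"
    using Cons.prems kapply_carrier[of Ms n m \<rho>] by auto
  have A2: "A * \<rho> * adj A \<in> carrier_mat n n" using A by auto
  have "K * (A * \<rho> * adj A + kapply n Ms \<rho>) * adj K
      = K * (A * \<rho> * adj A) * adj K + K * kapply n Ms \<rho> * adj K"
    unfolding mult_add_distrib_mat[OF K A2 S]
    by (rule add_mult_distrib_mat[OF mult_carrier_mat[OF K A2] mult_carrier_mat[OF K S] adj_carrier[OF K]])
  also have "K * (A * \<rho> * adj A) * adj K = (K * A) * \<rho> * adj (K * A)"
    using K A \<rho> by (simp add: mat_assoc adj_mult)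
  finally show ?case using Cons by simp
qed

lemma kprod_carrier:
  "set Ks \<subseteq> carrier_mat k n \<Longrightarrow> set Ms \<subseteq> carrier_mat n m \<Longrightarrow> set (kprod Ks Ms) \<subseteq> carrier_mat k m"
  by (auto simp: kprod_def intro!: mult_carrier_mat[of _ k n])

lemma kapply_kprod:
  assumes "set Ks \<subseteq> carrier_mat k n" and Ms: "set Ms \<subseteq> carrier_mat n m" and \<rho>: "\<rho> \<in> carrier_mat m m"
  shows "kapply k Ks (kapply n Ms \<rho>) = kapply k (kprod Ks Ms) \<rho>"
  using assms(1)
proof (induction Ks)
  case (Cons K Ks)
  have K: "K \<in> carrier_mat k n" and Ks: "set Ks \<subseteq> carrier_mat k n" using Cons.prems by auto
  have "set (map ((*) K) Ms) \<subseteq> carrier_mat k m" "set (kprod Ks Ms) \<subseteq> carrier_mat k m"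
    using K Ms kprod_carrier[OF Ks Ms] by auto
  from kapply_append[OF this] show ?case
    using Cons.IH[OF Ks] kapply_map[OF K Ms \<rho>] by (simp add: kprod_def)
qed (simp add: kprod_def)

lemma sum_list_kprod:
  fixes f :: "complex mat \<Rightarrow> 'a::comm_monoid_add"
  shows "(\<Sum>L\<leftarrow>kprod Ks Ms. f L) = (\<Sum>K\<leftarrow>Ks. \<Sum>A\<leftarrow>Ms. f (K * A))"
  by (induction Ks) (simp_all add: kprod_def o_def)

lemma sum_list_swap:
  fixes f :: "'a \<Rightarrow> 'b \<Rightarrow> 'c::comm_monoid_add"
  shows "(\<Sum>x\<leftarrow>xs. \<Sum>y\<leftarrow>ys. f x y) = (\<Sum>y\<leftarrow>ys. \<Sum>x\<leftarrow>xs. f x y)"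
  by (induction xs) (simp_all add: sum_list_addf)

lemma vnsq_kprod:
  assumes Ks: "set Ks \<subseteq> carrier_mat k n" "ksum n Ks = 1\<^sub>m n"
    and Ms: "set Ms \<subseteq> carrier_mat n m" "\<And>v. v \<in> carrier_vec m \<Longrightarrow> (\<Sum>A\<leftarrow>Ms. vnsq (A *\<^sub>v v)) = vnsq v"
    and v: "v \<in> carrier_vec m"
  shows "(\<Sum>L\<leftarrow>kprod Ks Ms. vnsq (L *\<^sub>v v)) = vnsq v"
proof -
  have "(\<Sum>L\<leftarrow>kprod Ks Ms. vnsq (L *\<^sub>v v)) = (\<Sum>A\<leftarrow>Ms. \<Sum>K\<leftarrow>Ks. vnsq ((K * A) *\<^sub>v v))"
    unfolding sum_list_kprod by (rule sum_list_swap)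
  also have "\<dots> = (\<Sum>A\<leftarrow>Ms. vnsq (A *\<^sub>v v))"
  proof (rule arg_cong[where f = sum_list], rule map_cong[OF refl])
    fix A assume "A \<in> set Ms"
    hence A: "A \<in> carrier_mat n m" using Ms by auto
    have "(\<Sum>K\<leftarrow>Ks. vnsq ((K * A) *\<^sub>v v)) = (\<Sum>K\<leftarrow>Ks. vnsq (K *\<^sub>v (A *\<^sub>v v)))"
      by (rule arg_cong[where f = sum_list], rule map_cong[OF refl])
         (use Ks A v in \<open>auto simp: assoc_mult_mat_vec subset_iff\<close>)
    also have "\<dots> = vnsq (A *\<^sub>v v)" by (rule ksum_one_vnsq[OF Ks]) (use A v in auto)
    finally show "(\<Sum>K\<leftarrow>Ks. vnsq ((K * A) *\<^sub>v v)) = vnsq (A *\<^sub>v v)" .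
  qed
  also have "\<dots> = vnsq v" by (rule Ms(2)[OF v])
  finally show ?thesis .
qed

lemma ksum_map_index:
  assumes "\<And>b. b < k \<Longrightarrow> E b \<in> carrier_mat n m" "i < m" "j < m"
  shows "ksum m (map E [0..<k]) $$ (i,j) = (\<Sum>b<k. \<Sum>l<n. cnj (E b $$ (l,i)) * E b $$ (l,j))"
proof -
  have "ksum m (map E bs) $$ (i,j) = (\<Sum>b\<leftarrow>bs. \<Sum>l<n. cnj (E b $$ (l,i)) * E b $$ (l,j))"
    if "set bs \<subseteq> {..<k}" for bs
    using that
  proof (induction bs)
    case (Cons b bs)
    have "ksum m (map E bs) \<in> carrier_mat m m" 
      by (rule ksum_carrier[of _ n]) (use Cons.prems assms in auto)
    moreover have "(adj (E b) * E b) $$ (i,j) = (\<Sum>l<n. adj (E b) $$ (i,l) * E b $$ (l,j))"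
      by (rule index_mult_mat_sum) (use Cons.prems assms in auto)
    moreover have "E b \<in> carrier_mat n m" using Cons.prems assms by auto
    ultimately show ?case using Cons assms by (simp del: index_mult_mat(1))
  qed (use assms in simp)
  from this[of "[0..<k]"] show ?thesis by (simp add: interv_sum_list_conv_sum_set_nat atLeast0LessThan lessThan_def)
qed

text \<open>The defect \<open>D\<close> of the family is positive. The added operators measure this
  defect and prepare the first basis state of the output: each sends one row of
  \<open>msqrt D\<close> to output row zero. An output of positive dimension is needed to have such
  a row.\<close>

lemma kraus_completion:
  assumes Ks: "set Ks \<subseteq> carrier_mat n m" and n: "0 < n"
    and sub: "\<And>v. v \<in> carrier_vec m \<Longrightarrow> (\<Sum>K\<leftarrow>Ks. vnsq (K *\<^sub>v v)) \<le> vnsq v"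
  shows "\<exists>Es. set Es \<subseteq> carrier_mat n m \<and> ksum m (Ks @ Es) = 1\<^sub>m m"
proof -
  define D where "D = 1\<^sub>m m - ksum m Ks"
  note S = ksum_carrier[OF Ks]
  have D: "D \<in> carrier_mat m m" using S by (auto simp: D_def)
  have "psd m D"
    unfolding psd_iff_cdot
  proof (intro conjI ballI D)
    show "adj D = D" unfolding D_def using S by (simp add: adj_minus[of _ m m] adj_ksum[OF Ks])
    fix v :: "complex vec" assume v: "v \<in> carrier_vec m"
    have "v = D *\<^sub>v v + ksum m Ks *\<^sub>v v"
    proof -
      have "(D + ksum m Ks) *\<^sub>v v = D *\<^sub>v v + ksum m Ks *\<^sub>v v" by (rule add_mult_distrib_mat_vec[OF D S v])
      moreover have "D + ksum m Ks = 1\<^sub>m m" unfolding D_def using S by (intro eq_matI) auto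
      ultimately show ?thesis using v by simp
    qed
    hence "cdot v v = cdot v (D *\<^sub>v v) + cdot v (ksum m Ks *\<^sub>v v)"
      using cdot_add[of "D *\<^sub>v v" m "ksum m Ks *\<^sub>v v" v] D S v by (metis mult_mat_vec_carrier)
    hence "Re (cdot v (D *\<^sub>v v)) = vnsq v - (\<Sum>K\<leftarrow>Ks. vnsq (K *\<^sub>v v))"
      unfolding cdot_ksum[OF Ks v] cdot_self by (simp add: complex_eq_iff)
    thus "0 \<le> Re (cdot v (D *\<^sub>v v))" using sub[OF v] by simp
  qed
  note s = msqrt_psd[OF this]
  define E where "E b = mat n m (\<lambda>(i,j). if i = 0 then msqrt D $$ (b,j) else 0)" for b
  define Es where "Es = map E [0..<m]"
  have Es: "set Es \<subseteq> carrier_mat n m" by (auto simp: Es_def E_def)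
  have "ksum m Es = D"
  proof (rule eq_matI)
    fix i j assume "i < dim_row D" "j < dim_col D"
    hence ij: "i < m" "j < m" using D by auto
    have "ksum m Es $$ (i,j) = (\<Sum>b<m. \<Sum>l<n. cnj (E b $$ (l,i)) * E b $$ (l,j))"
      unfolding Es_def by (rule ksum_map_index) (use ij in \<open>auto simp: E_def\<close>)
    also have "\<dots> = (\<Sum>b<m. \<Sum>l<n. if l = 0 then cnj (msqrt D $$ (b,i)) * msqrt D $$ (b,j) else 0)"
      by (intro sum.cong refl) (use ij in \<open>auto simp: E_def\<close>)
    also have "\<dots> = (\<Sum>b<m. msqrt D $$ (i,b) * msqrt D $$ (b,j))"
      using n ij psdD[OF s(1)] by (simp add: hermitian_index[of "msqrt D" m])
    also have "\<dots> = (msqrt D * msqrt D) $$ (i,j)"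
      by (rule index_mult_mat_sum[symmetric]) (use psdD[OF s(1)] ij in auto)
    finally show "ksum m Es $$ (i,j) = D $$ (i,j)" unfolding s(2) .
  qed (use ksum_carrier[OF Es] D in auto)
  moreover have "ksum m Ks + D = 1\<^sub>m m" unfolding D_def using S by (intro eq_matI) auto
  ultimately show ?thesis using Es ksum_append[OF Ks Es] by auto
qed

lemma psd_sum_ketbra:
  assumes us: "set us \<subseteq> carrier_vec N" and X: "X \<in> carrier_mat N N"
    and Xij: "\<And>i j. i < N \<Longrightarrow> j < N \<Longrightarrow> X $$ (i,j) = (\<Sum>u\<leftarrow>us. u $ i * cnj (u $ j))"
  shows "psd N X" and "\<And>v. v \<in> carrier_vec N \<Longrightarrow> cdot v (X *\<^sub>v v) = of_real (\<Sum>u\<leftarrow>us. (cmod (cdot v u))\<^sup>2)"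
proof -
  show q: "cdot v (X *\<^sub>v v) = of_real (\<Sum>u\<leftarrow>us. (cmod (cdot v u))\<^sup>2)" if v: "v \<in> carrier_vec N" for v
  proof -
    have "cdot v (X *\<^sub>v v) = (\<Sum>i<N. cnj (v $ i) * (\<Sum>j<N. X $$ (i,j) * v $ j))"
      using X by (auto simp: cdot_def index_mult_mat_vec_sum[OF X v] simp del: index_mult_mat_vec intro!: sum.cong)
    also have "\<dots> = (\<Sum>i<N. \<Sum>j<N. cnj (v $ i) * ((\<Sum>u\<leftarrow>us. u $ i * cnj (u $ j)) * v $ j))"
      by (simp add: Xij sum_distrib_left)
    also have "\<dots> = of_real (\<Sum>u\<leftarrow>us. (cmod (cdot v u))\<^sup>2)"
      using us
    proof (induction us)
      case (Cons u us)
      have u: "u \<in> carrier_vec N" using Cons.prems by auto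
      have "(\<Sum>i<N. \<Sum>j<N. cnj (v $ i) * ((u $ i * cnj (u $ j)) * v $ j))
          = (\<Sum>i<N. cnj (v $ i) * u $ i) * (\<Sum>j<N. cnj (u $ j) * v $ j)"
        by (simp add: sum_product mult.assoc)
      also have "\<dots> = cdot v u * cnj (cdot v u)" using u v by (simp add: cdot_def mult.commute)
      also have "\<dots> = of_real ((cmod (cdot v u))\<^sup>2)" by (rule complex_norm_square[symmetric])
      finally show ?case using Cons by (simp add: distrib_left distrib_right sum.distrib)
    qed simp
    finally show ?thesis .
  qed
  have "adj X = X"
  proof (rule eq_matI)
    fix i j assume "i < dim_row X" "j < dim_col X"
    hence ij: "i < N" "j < N" using X by auto
    have "cnj (\<Sum>u\<leftarrow>us. u $ j * cnj (u $ i)) = (\<Sum>u\<leftarrow>us. u $ i * cnj (u $ j))"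
      by (induction us) auto
    thus "adj X $$ (i,j) = X $$ (i,j)" using ij X by (simp add: Xij)
  qed (use X in auto)
  thus "psd N X" using X by (auto simp: psd_iff_cdot q intro!: sum_list_nonneg)
qed

section \<open>Entanglement fidelity of Kraus families\<close>

text \<open>The vector \<open>(K \<otimes> 1\<^sub>r) \<phi>\<close>.\<close>

definition ampl_vec :: "nat \<Rightarrow> nat \<Rightarrow> complex vec \<Rightarrow> complex mat \<Rightarrow> complex vec" where
  "ampl_vec d r \<phi> K = vec (d * r) (\<lambda>i. \<Sum>a<d. K $$ (i div r, a) * \<phi> $ (a * r + i mod r))"

lemma pair_index_bound:
  fixes a d r j :: nat
  assumes "a < d" "j < r"
  shows "a * r + j < d * r"
proof -
  have "a * r + j < Suc a * r" using assms by simp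
  also have "\<dots> \<le> d * r" using assms by (intro mult_le_mono1) simp
  finally show ?thesis .
qed

text \<open>The output state is the sum of the rank-one operators of the vectors
  \<open>ampl_vec d r \<phi> K\<close>, and the state it is compared with is pure. The squared
  fidelity is therefore a sum of squared overlaps.\<close>

lemma fid_phi_kraus:
  assumes Ls: "set Ls \<subseteq> carrier_mat d d" and r: "0 < r" and \<phi>: "unit_vec_c (d * r) \<phi>"
    and \<Phi>: "\<And>\<rho>. \<rho> \<in> carrier_mat d d \<Longrightarrow> \<Phi> \<rho> = kapply d Ls \<rho>"
  shows "fid_phi d d r \<phi> \<Phi> id = sqrt (\<Sum>K\<leftarrow>Ls. (cmod (cdot \<phi> (ampl_vec d r \<phi> K)))\<^sup>2)"
proof -
  have \<phi>c: "\<phi> \<in> carrier_vec (d * r)" "vnsq \<phi> = 1" using \<phi> by (auto simp: unit_vec_c_def vnsq_def)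
  define X where "X = tensor_id \<Phi> d d r (ketbra \<phi> \<phi>)"
  have X: "X \<in> carrier_mat (d * r) (d * r)" by (simp add: X_def tensor_id_def)
  have id: "tensor_id id d d r (ketbra \<phi> \<phi>) = ketbra \<phi> \<phi>"
    by (rule eq_matI) (use \<phi>c r in \<open>auto simp: tensor_id_def ketbra_def less_mult_imp_div_less\<close>)
  have Xij: "X $$ (i,j) = (\<Sum>u\<leftarrow>map (ampl_vec d r \<phi>) Ls. u $ i * cnj (u $ j))"
    if ij: "i < d * r" "j < d * r" for i j
  proof -
    define \<rho> where "\<rho> = mat d d (\<lambda>(l,l'). ketbra \<phi> \<phi> $$ (l * r + i mod r, l' * r + j mod r))"
    have \<rho>: "\<rho> \<in> carrier_mat d d" by (simp add: \<rho>_def)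
    have idx: "i div r < d" "j div r < d" using ij by (auto simp: less_mult_imp_div_less)
    have \<rho>i: "\<rho> $$ (l,l') = \<phi> $ (l * r + i mod r) * cnj (\<phi> $ (l' * r + j mod r))" if "l < d" "l' < d" for l l'
      using that \<phi>c r by (simp add: \<rho>_def ketbra_def pair_index_bound)
    have "X $$ (i,j) = kapply d Ls \<rho> $$ (i div r, j div r)"
      using ij \<Phi>[OF \<rho>] by (simp add: X_def tensor_id_def \<rho>_def)
    also have "\<dots> = (\<Sum>K\<leftarrow>Ls. (K * \<rho> * adj K) $$ (i div r, j div r))"
      by (rule kapply_index[OF Ls idx])
    also have "\<dots> = (\<Sum>K\<leftarrow>Ls. ampl_vec d r \<phi> K $ i * cnj (ampl_vec d r \<phi> K $ j))"
    proof (rule arg_cong[where f = sum_list], rule map_cong[OF refl])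
      fix K assume "K \<in> set Ls"
      hence K: "K \<in> carrier_mat d d" using Ls by auto
      have "(K * \<rho> * adj K) $$ (i div r, j div r) = (\<Sum>l'<d. (K * \<rho>) $$ (i div r,l') * adj K $$ (l',j div r))"
        by (rule index_mult_mat_sum) (use K \<rho> idx in auto)
      also have "\<dots> = (\<Sum>l'<d. (\<Sum>l<d. K $$ (i div r,l) * \<rho> $$ (l,l')) * cnj (K $$ (j div r,l')))"
        using K \<rho> idx by (intro sum.cong refl) (simp add: index_mult_mat_sum[OF K \<rho>] del: index_mult_mat(1))
      also have "\<dots> = (\<Sum>l'<d. (\<Sum>l<d. K $$ (i div r,l) * \<phi> $ (l * r + i mod r))
          * cnj (K $$ (j div r,l') * \<phi> $ (l' * r + j mod r)))"
        by (intro sum.cong refl) (simp add: \<rho>i sum_distrib_right sum_distrib_left mult_ac)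
      also have "\<dots> = ampl_vec d r \<phi> K $ i * cnj (ampl_vec d r \<phi> K $ j)"
        using ij by (simp add: ampl_vec_def sum_distrib_left)
      finally show "(K * \<rho> * adj K) $$ (i div r, j div r) = ampl_vec d r \<phi> K $ i * cnj (ampl_vec d r \<phi> K $ j)" .
    qed
    finally show ?thesis by (simp add: o_def)
  qed
  have us: "set (map (ampl_vec d r \<phi>) Ls) \<subseteq> carrier_vec (d * r)" by (auto simp: ampl_vec_def)
  have p: "psd (d * r) X" by (rule psd_sum_ketbra(1)[OF us X Xij])
  have q: "cdot \<phi> (X *\<^sub>v \<phi>) = of_real (\<Sum>u\<leftarrow>map (ampl_vec d r \<phi>) Ls. (cmod (cdot \<phi> u))\<^sup>2)"
    by (rule psd_sum_ketbra(2)[OF us X Xij \<phi>c(1)])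
  have "fid_phi d d r \<phi> \<Phi> id = fidelity X (ketbra \<phi> \<phi>)"
    unfolding fid_phi_def id X_def ..
  also have "\<dots> = sqrt (Re (cdot \<phi> (X *\<^sub>v \<phi>)))" by (rule fidelity_pure[OF p \<phi>c])
  finally show ?thesis unfolding q by (simp add: o_def)
qed

text \<open>A trace-nonincreasing recovery that attains squared fidelity
  \<open>1 - \<delta>\<^sup>2\<close> for every pure input and every reference dimension. Stating it
  for lists of Kraus operators lets recoveries for different record values be concatenated.\<close>

definition recovers :: "nat \<Rightarrow> nat \<Rightarrow> real \<Rightarrow> complex mat list \<Rightarrow> complex mat list \<Rightarrow> bool" where
  "recovers d n \<delta> Ks Ms \<longleftrightarrow> set Ks \<subseteq> carrier_mat d n \<and>
     (\<forall>v \<in> carrier_vec n. (\<Sum>K\<leftarrow>Ks. vnsq (K *\<^sub>v v)) \<le> vnsq v) \<and>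
     (\<forall>r \<phi>. 0 < r \<longrightarrow> unit_vec_c (d * r) \<phi> \<longrightarrow>
       1 - \<delta>\<^sup>2 \<le> (\<Sum>K\<leftarrow>Ks. \<Sum>A\<leftarrow>Ms. (cmod (cdot \<phi> (ampl_vec d r \<phi> (K * A))))\<^sup>2))"

text \<open>The completed recovery is one candidate in the supremum, and the operators added by the
  completion contribute only nonnegative terms. The remaining work makes the real \<open>SUP\<close>
  and \<open>INF\<close> meaningful: the test states form a nonempty set, the fidelities are bounded
  below, and the worst-case values are bounded above.\<close>

lemma eps_worst_le:
  assumes d: "0 < d" and Ms: "set Ms \<subseteq> carrier_mat n d"
      "\<And>v. v \<in> carrier_vec d \<Longrightarrow> (\<Sum>A\<leftarrow>Ms. vnsq (A *\<^sub>v v)) = vnsq v"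
    and M: "\<And>\<rho>. \<rho> \<in> carrier_mat d d \<Longrightarrow> M \<rho> = kapply n Ms \<rho>"
    and \<delta>: "0 \<le> \<delta>" and rec: "recovers d n \<delta> Ks Ms"
  shows "eps_worst d n M \<le> \<delta>"
proof (cases "1 \<le> \<delta>")
  \<comment> \<open>Here \<open>sqrt (1 - \<delta>\<^sup>2)\<close> need not be a real root of a
    nonnegative number, but the error never exceeds one by its very form.\<close>
  case True
  have "eps_worst d n M \<le> 1" by (simp add: eps_worst_def)
  thus ?thesis using True by simp
next
  case False
  hence \<delta>2: "\<delta>\<^sup>2 \<le> 1" using \<delta> by (simp add: power_le_one)
  have Ks: "set Ks \<subseteq> carrier_mat d n"
    and sub: "\<And>v. v \<in> carrier_vec n \<Longrightarrow> (\<Sum>K\<leftarrow>Ks. vnsq (K *\<^sub>v v)) \<le> vnsq v"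
    and ov: "\<And>r \<phi>. 0 < r \<Longrightarrow> unit_vec_c (d * r) \<phi> \<Longrightarrow>
       1 - \<delta>\<^sup>2 \<le> (\<Sum>K\<leftarrow>Ks. \<Sum>A\<leftarrow>Ms. (cmod (cdot \<phi> (ampl_vec d r \<phi> (K * A))))\<^sup>2)"
    using rec by (auto simp: recovers_def)
  define P :: "(nat \<times> complex vec) set" where "P = {(r, \<phi>). 0 < r \<and> unit_vec_c (d*r) \<phi>}"
  \<comment> \<open>A product test state with trivial reference. It witnesses that the infimum
    ranges over a nonempty set and later caps it.\<close>
  define \<phi>0 where "\<phi>0 = (unit_vec d 0 :: complex vec)"
  have \<phi>0: "unit_vec_c (d * 1) \<phi>0"
  proof -
    have "(\<Sum>i<d. (cmod (\<phi>0 $ i))\<^sup>2) = (\<Sum>i<d. if i = 0 then 1 else 0)"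
      by (intro sum.cong refl) (simp add: \<phi>0_def)
    thus ?thesis using d by (simp add: unit_vec_c_def \<phi>0_def)
  qed
  have P0: "(1, \<phi>0) \<in> P" using \<phi>0 by (simp add: P_def)
  define g where "g R = (INF p \<in> P. fid_phi d d (fst p) (snd p) (R \<circ> M) id)" for R :: "complex mat \<Rightarrow> complex mat"
  have fid: "fid_phi d d r \<phi> (R \<circ> M) id = sqrt (\<Sum>K\<leftarrow>Rs. \<Sum>A\<leftarrow>Ms. (cmod (cdot \<phi> (ampl_vec d r \<phi> (K * A))))\<^sup>2)"
    if Rs: "set Rs \<subseteq> carrier_mat d n" "\<And>\<rho>. \<rho> \<in> carrier_mat n n \<Longrightarrow> R \<rho> = kapply d Rs \<rho>"
      and "0 < r" "unit_vec_c (d * r) \<phi>" for R Rs r \<phi>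
  proof -
    have "fid_phi d d r \<phi> (R \<circ> M) id = sqrt (\<Sum>K\<leftarrow>kprod Rs Ms. (cmod (cdot \<phi> (ampl_vec d r \<phi> K)))\<^sup>2)"
    proof (rule fid_phi_kraus)
      fix \<rho> :: "complex mat" assume \<rho>: "\<rho> \<in> carrier_mat d d"
      have "kapply n Ms \<rho> \<in> carrier_mat n n" by (rule kapply_carrier[OF Ms(1)])
      thus "(R \<circ> M) \<rho> = kapply d (kprod Rs Ms) \<rho>"
        by (simp add: M[OF \<rho>] Rs(2) kapply_kprod[OF Rs(1) Ms(1) \<rho>])
    qed (use that kprod_carrier[OF Rs(1) Ms(1)] in auto)
    thus ?thesis unfolding sum_list_kprod .
  qed
  \<comment> \<open>Evaluating at \<open>\<phi>0\<close>, Cauchy-Schwarz bounds the squared fidelity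
    by the total squared norm of the Kraus outputs, which is one since both channels preserve the
    trace.\<close>
  have bound: "g R \<le> 1" if "is_channel n d R" for R
  proof -
    obtain Rs where Rs: "set Rs \<subseteq> carrier_mat d n" "ksum n Rs = 1\<^sub>m n"
        "\<And>\<rho>. \<rho> \<in> carrier_mat n n \<Longrightarrow> R \<rho> = kapply d Rs \<rho>"
      using \<open>is_channel n d R\<close> unfolding is_channel_iff by auto
    have \<phi>c: "\<phi>0 \<in> carrier_vec d" "vnsq \<phi>0 = 1" using \<phi>0 by (auto simp: unit_vec_c_def vnsq_def)
    have "g R \<le> fid_phi d d 1 \<phi>0 (R \<circ> M) id"
      unfolding g_def
    proof (rule cINF_lower2[OF _ P0])
      show "bdd_below ((\<lambda>p. fid_phi d d (fst p) (snd p) (R \<circ> M) id) ` P)"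
      proof (rule bdd_belowI2[where m = 0])
        fix p assume "p \<in> P"
        thus "0 \<le> fid_phi d d (fst p) (snd p) (R \<circ> M) id"
          using fid[OF Rs(1,3), of "fst p" "snd p"] by (auto simp: P_def intro!: sum_list_nonneg)
      qed
    qed simp
    also have "\<dots> = sqrt (\<Sum>K\<leftarrow>Rs. \<Sum>A\<leftarrow>Ms. (cmod (cdot \<phi>0 (ampl_vec d 1 \<phi>0 (K * A))))\<^sup>2)"
      using fid[OF Rs(1,3) _ \<phi>0] by simp
    also have "\<dots> = sqrt (\<Sum>L\<leftarrow>kprod Rs Ms. (cmod (cdot \<phi>0 (ampl_vec d 1 \<phi>0 L)))\<^sup>2)"
      unfolding sum_list_kprod ..
    also have "\<dots> \<le> sqrt (\<Sum>L\<leftarrow>kprod Rs Ms. vnsq (L *\<^sub>v \<phi>0))"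
    proof (intro real_sqrt_le_mono sum_list_mono)
      fix L assume "L \<in> set (kprod Rs Ms)"
      hence L: "L \<in> carrier_mat d d" using kprod_carrier[OF Rs(1) Ms(1)] by auto
      have "ampl_vec d 1 \<phi>0 L = L *\<^sub>v \<phi>0"
        by (rule eq_vecI) (use L \<phi>c in \<open>auto simp: ampl_vec_def index_mult_mat_vec_sum[OF L \<phi>c(1)] simp del: index_mult_mat_vec\<close>)
      thus "(cmod (cdot \<phi>0 (ampl_vec d 1 \<phi>0 L)))\<^sup>2 \<le> vnsq (L *\<^sub>v \<phi>0)"
        using cdot_Cauchy_Schwarz[of \<phi>0 d "L *\<^sub>v \<phi>0"] L \<phi>c by simp
    qed
    also have "(\<Sum>L\<leftarrow>kprod Rs Ms. vnsq (L *\<^sub>v \<phi>0)) = vnsq \<phi>0"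
      by (rule vnsq_kprod[OF Rs(1,2) Ms(1)]) (use Ms(2) \<phi>c in auto)
    also have "sqrt (vnsq \<phi>0) = 1" using \<phi>c by simp
    finally show ?thesis .
  qed
  obtain Es where Es: "set Es \<subseteq> carrier_mat d n" "ksum n (Ks @ Es) = 1\<^sub>m n"
    using kraus_completion[OF Ks d sub] by blast
  define R where "R = kapply d (Ks @ Es)"
  have KE: "set (Ks @ Es) \<subseteq> carrier_mat d n" using Ks Es by auto
  have R: "is_channel n d R" unfolding is_channel_iff R_def using KE Es by blast
  have "sqrt (1 - \<delta>\<^sup>2) \<le> g R"
    unfolding g_def
  proof (rule cINF_greatest)
    fix p assume "p \<in> P"
    then obtain r \<phi> where p: "p = (r, \<phi>)" "0 < r" "unit_vec_c (d * r) \<phi>" by (auto simp: P_def)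
    have "1 - \<delta>\<^sup>2 \<le> (\<Sum>K\<leftarrow>Ks @ Es. \<Sum>A\<leftarrow>Ms. (cmod (cdot \<phi> (ampl_vec d r \<phi> (K * A))))\<^sup>2)"
      using ov[OF p(2,3)] by (auto intro!: add_increasing2 sum_list_nonneg)
    hence "sqrt (1 - \<delta>\<^sup>2) \<le> sqrt (\<Sum>K\<leftarrow>Ks @ Es. \<Sum>A\<leftarrow>Ms. (cmod (cdot \<phi> (ampl_vec d r \<phi> (K * A))))\<^sup>2)"
      by (rule real_sqrt_le_mono)
    also have "\<dots> = fid_phi d d r \<phi> (R \<circ> M) id"
      by (rule fid[symmetric]) (use KE p in \<open>auto simp: R_def\<close>)
    finally show "sqrt (1 - \<delta>\<^sup>2) \<le> fid_phi d d (fst p) (snd p) (R \<circ> M) id" by (simp add: p)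
  qed (use P0 in auto)
  also have "g R \<le> (SUP R \<in> {R. is_channel n d R}. g R)"
    by (rule cSUP_upper) (use R bound in \<open>auto intro: bdd_aboveI2[where M = 1]\<close>)
  also have "\<dots> = f_worst d n M" unfolding f_worst_def g_def P_def ..
  finally have "(sqrt (1 - \<delta>\<^sup>2))\<^sup>2 \<le> (f_worst d n M)\<^sup>2" by (rule power_mono) (use \<delta>2 in simp)
  hence "1 - (f_worst d n M)\<^sup>2 \<le> \<delta>\<^sup>2" using \<delta>2 by simp
  thus ?thesis unfolding eps_worst_def by (rule real_le_lsqrt[rotated]) (use \<delta> in simp)
qed

subsection \<open>Block matrices\<close>

lemma sum_pair: "(\<Sum>k<d*E. f k) = (\<Sum>x<d. \<Sum>e<E. f (x*E+e))" for d E :: nat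
proof -
  have "(\<Sum>k<d*E. f k) = (\<Sum>x<d. sum f {x*E..<x*E+E})" by (rule sum.nat_group[symmetric])
  also have "\<dots> = (\<Sum>x<d. \<Sum>e<E. f (x*E+e))"
  proof (rule sum.cong[OF refl])
    fix x
    show "sum f {x*E..<x*E+E} = (\<Sum>e<E. f (x*E+e))"
      using sum.shift_bounds_nat_ivl[of f 0 "x*E" E] by (simp add: atLeast0LessThan add.commute)
  qed
  finally show ?thesis .
qed

lemma Cauchy_Schwarz_sum:
  fixes f g :: "'i \<Rightarrow> complex"
  shows "(cmod (\<Sum>i\<in>I. f i * g i))\<^sup>2 \<le> (\<Sum>i\<in>I. (cmod (f i))\<^sup>2) * (\<Sum>i\<in>I. (cmod (g i))\<^sup>2)"
proof -
  have "cmod (\<Sum>i\<in>I. f i * g i) \<le> (\<Sum>i\<in>I. \<bar>cmod (f i)\<bar> * \<bar>cmod (g i)\<bar>)"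
    using norm_sum[of "\<lambda>i. f i * g i" I] by (simp add: norm_mult)
  also have "\<dots> \<le> L2_set (\<lambda>i. cmod (f i)) I * L2_set (\<lambda>i. cmod (g i)) I" by (rule L2_set_mult_ineq)
  finally have "(cmod (\<Sum>i\<in>I. f i * g i))\<^sup>2 \<le> (L2_set (\<lambda>i. cmod (f i)) I * L2_set (\<lambda>i. cmod (g i)) I)\<^sup>2"
    by (rule power_mono) simp
  thus ?thesis by (simp add: power_mult_distrib L2_set_def sum_nonneg)
qed

definition blk :: "nat \<Rightarrow> nat \<Rightarrow> (nat \<Rightarrow> complex mat) \<Rightarrow> complex mat" where
  "blk d E F = mat (d*E) (d*E) (\<lambda>(i,k). if i div E = k div E then F (i div E) $$ (i mod E, k mod E) else 0)"

lemma blk_carrier [simp]: "blk d E F \<in> carrier_mat (d*E) (d*E)"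
  by (simp add: blk_def)

lemma blk_index:
  assumes "x < d" "y < d" "e < E" "f < E"
  shows "blk d E F $$ (x*E+e, y*E+f) = (if x = y then F x $$ (e,f) else 0)"
  using assms by (simp add: blk_def pair_index_bound)

lemma blk_cong: "(\<And>x. x < d \<Longrightarrow> F x = H x) \<Longrightarrow> blk d E F = blk d E H"
  by (rule eq_matI) (auto simp: blk_def less_mult_imp_div_less)

lemma pair_index_cases:
  fixes d E i :: nat
  assumes "i < d*E"
  obtains x e where "x < d" "e < E" "i = x*E+e"
proof
  show "i div E < d" using assms by (simp add: less_mult_imp_div_less)
  have "0 < E" using assms by (cases E) auto
  thus "i mod E < E" by simp
  show "i = i div E * E + i mod E" by simp
qed

lemma blk_mult_vec:
  assumes v: "v \<in> carrier_vec (d*E)" and x: "x < d" and e: "e < E"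
  shows "(blk d E F *\<^sub>v v) $ (x*E+e) = (\<Sum>f<E. F x $$ (e,f) * v $ (x*E+f))"
proof -
  have "(blk d E F *\<^sub>v v) $ (x*E+e) = (\<Sum>k<d*E. blk d E F $$ (x*E+e,k) * v $ k)"
    by (rule index_mult_mat_vec_sum[OF blk_carrier v]) (use x e in \<open>simp add: pair_index_bound\<close>)
  also have "\<dots> = (\<Sum>y<d. \<Sum>f<E. blk d E F $$ (x*E+e,y*E+f) * v $ (y*E+f))" by (rule sum_pair)
  also have "\<dots> = (\<Sum>y<d. if y = x then (\<Sum>f<E. F x $$ (e,f) * v $ (x*E+f)) else 0)"
    by (intro sum.cong refl) (use x e in \<open>auto simp: blk_index\<close>)
  finally show ?thesis using x by simp
qed

lemma blk_mult:
  assumes F: "\<And>x. x < d \<Longrightarrow> F x \<in> carrier_mat E E" and H: "\<And>x. x < d \<Longrightarrow> H x \<in> carrier_mat E E"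
  shows "blk d E F * blk d E H = blk d E (\<lambda>x. F x * H x)"
proof (rule eq_matI)
  fix i k assume "i < dim_row (blk d E (\<lambda>x. F x * H x))" "k < dim_col (blk d E (\<lambda>x. F x * H x))"
  hence ik: "i < d*E" "k < d*E" by (auto simp: blk_def)
  obtain x e where i: "x < d" "e < E" "i = x*E+e" using ik(1) by (rule pair_index_cases)
  obtain y f where k: "y < d" "f < E" "k = y*E+f" using ik(2) by (rule pair_index_cases)
  have "(blk d E F * blk d E H) $$ (i,k) = (\<Sum>l<d*E. blk d E F $$ (i,l) * blk d E H $$ (l,k))"
    by (rule index_mult_mat_sum) (use ik in auto)
  also have "\<dots> = (\<Sum>z<d. \<Sum>g<E. blk d E F $$ (i,z*E+g) * blk d E H $$ (z*E+g,k))" by (rule sum_pair)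
  also have "\<dots> = (\<Sum>z<d. if z = x then (if x = y then \<Sum>g<E. F x $$ (e,g) * H x $$ (g,f) else 0) else 0)"
    by (intro sum.cong refl) (use i k in \<open>auto simp: blk_index\<close>)
  also have "\<dots> = blk d E (\<lambda>x. F x * H x) $$ (i,k)"
    unfolding i(3) k(3) blk_index[OF i(1) k(1) i(2) k(2)]
      index_mult_mat_sum[OF F[OF i(1)] H[OF i(1)] i(2) k(2)] using i(1) by simp
  finally show "(blk d E F * blk d E H) $$ (i,k) = blk d E (\<lambda>x. F x * H x) $$ (i,k)" .
qed (auto simp: blk_def)

lemma adj_blk:
  assumes F: "\<And>x. x < d \<Longrightarrow> F x \<in> carrier_mat E E"
  shows "adj (blk d E F) = blk d E (\<lambda>x. adj (F x))"
proof (rule eq_matI)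
  fix i k assume "i < dim_row (blk d E (\<lambda>x. adj (F x)))" "k < dim_col (blk d E (\<lambda>x. adj (F x)))"
  hence ik: "i < d*E" "k < d*E" by (auto simp: blk_def)
  obtain x e where i: "x < d" "e < E" "i = x*E+e" using ik(1) by (rule pair_index_cases)
  obtain y f where k: "y < d" "f < E" "k = y*E+f" using ik(2) by (rule pair_index_cases)
  have "adj (blk d E F) $$ (i,k) = cnj (blk d E F $$ (k,i))" using ik by (simp add: blk_def)
  thus "adj (blk d E F) $$ (i,k) = blk d E (\<lambda>x. adj (F x)) $$ (i,k)"
    using i k F[OF i(1)] by (auto simp: blk_index)
qed (auto simp: blk_def)

lemma vnsq_pair: "v \<in> carrier_vec (d*E) \<Longrightarrow> vnsq v = (\<Sum>x<d. \<Sum>e<E. (cmod (v $ (x*E+e)))\<^sup>2)"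
  by (simp add: vnsq_def sum_pair)

text \<open>Distinct blocks act on orthogonal summands, so squared norms add and each block can be
  estimated alone.\<close>

lemma contraction_blk:
  assumes F: "\<And>x. x < d \<Longrightarrow> F x \<in> carrier_mat E E" and c: "\<And>x. x < d \<Longrightarrow> contraction (F x)"
  shows "contraction (blk d E F)"
  unfolding contraction_def
proof
  fix v :: "complex vec" assume "v \<in> carrier_vec (dim_col (blk d E F))"
  hence v: "v \<in> carrier_vec (d*E)" by (simp add: blk_def)
  have "vnsq (blk d E F *\<^sub>v v) = (\<Sum>x<d. \<Sum>e<E. (cmod ((blk d E F *\<^sub>v v) $ (x*E+e)))\<^sup>2)"
    by (rule vnsq_pair[OF mult_mat_vec_carrier[OF blk_carrier v]])
  also have "\<dots> \<le> (\<Sum>x<d. \<Sum>e<E. (cmod (v $ (x*E+e)))\<^sup>2)"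
  proof (rule sum_mono)
    fix x assume "x \<in> {..<d}" hence x: "x < d" by simp
    let ?w = "vec E (\<lambda>f. v $ (x*E+f))"
    have "(\<Sum>e<E. (cmod ((blk d E F *\<^sub>v v) $ (x*E+e)))\<^sup>2) = vnsq (F x *\<^sub>v ?w)"
      using F[OF x] by (auto simp: vnsq_def blk_mult_vec[OF v x] index_mult_mat_vec_sum[OF F[OF x]] 
          simp del: index_mult_mat_vec intro!: sum.cong)
    also have "\<dots> \<le> vnsq ?w" by (rule contractionD[OF c[OF x] F[OF x]]) simp
    also have "\<dots> = (\<Sum>e<E. (cmod (v $ (x*E+e)))\<^sup>2)" by (simp add: vnsq_def)
    finally show "(\<Sum>e<E. (cmod ((blk d E F *\<^sub>v v) $ (x*E+e)))\<^sup>2) \<le> (\<Sum>e<E. (cmod (v $ (x*E+e)))\<^sup>2)" .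
  qed
  also have "\<dots> = vnsq v" by (rule vnsq_pair[OF v, symmetric])
  finally show "vnsq (blk d E F *\<^sub>v v) \<le> vnsq v" .
qed

text \<open>The block diagonal matrix of the roots is Hermitian with the given matrix as its square,
  which reduces positivity to that of a Gram matrix.\<close>

lemma psd_blk:
  assumes F: "\<And>x. x < d \<Longrightarrow> psd E (F x)"
  shows "psd (d*E) (blk d E F)"
proof -
  let ?S = "\<lambda>x. msqrt (F x)"
  have S: "?S x \<in> carrier_mat E E" "adj (?S x) = ?S x" "?S x * ?S x = F x" if "x < d" for x
    using psdD[OF msqrt_psd(1)[OF F[OF that]]] msqrt_psd(2)[OF F[OF that]] by auto
  have "adj (blk d E ?S) * blk d E ?S = blk d E (\<lambda>x. adj (?S x) * ?S x)"
  proof -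
    have "adj (blk d E ?S) = blk d E (\<lambda>x. adj (?S x))" by (rule adj_blk) (use S in auto)
    moreover have "blk d E (\<lambda>x. adj (?S x)) * blk d E ?S = blk d E (\<lambda>x. adj (?S x) * ?S x)"
      by (rule blk_mult) (use S in auto)
    ultimately show ?thesis by simp
  qed
  also have "\<dots> = blk d E F" by (rule blk_cong) (use S in auto)
  finally show ?thesis using psd_adj_mult[OF blk_carrier[of d E ?S]] by simp
qed

text \<open>A block is a compression: place \<open>v\<close> in block \<open>y\<close>, apply
  \<open>C\<close>, and keep block \<open>x\<close> only. The embedding preserves norms and the
  restriction does not increase them.\<close>

lemma contraction_block:
  assumes C: "C \<in> carrier_mat (d*E) (d*E)" and c: "contraction C" and x: "x < d" and y: "y < d"
  shows "contraction (mat E E (\<lambda>(e,f). C $$ (x*E+e, y*E+f)))" (is "contraction ?B")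
  unfolding contraction_def
proof
  fix v :: "complex vec" assume "v \<in> carrier_vec (dim_col ?B)"
  hence v: "v \<in> carrier_vec E" by simp
  define w where "w = vec (d*E) (\<lambda>k. if k div E = y then v $ (k mod E) else 0)"
  have w: "w \<in> carrier_vec (d*E)" by (simp add: w_def)
  have wi: "w $ (z*E+f) = (if z = y then v $ f else 0)" if "z < d" "f < E" for z f
    using that by (simp add: w_def pair_index_bound)
  have "vnsq w = (\<Sum>z<d. if z = y then \<Sum>e<E. (cmod (v $ e))\<^sup>2 else 0)"
    unfolding vnsq_pair[OF w] by (intro sum.cong refl) (auto simp: wi)
  hence vw: "vnsq w = vnsq v" using y v by (simp add: vnsq_def)
  have Cw: "(C *\<^sub>v w) $ (x*E+e) = (?B *\<^sub>v v) $ e" if e: "e < E" for e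
  proof -
    have "(C *\<^sub>v w) $ (x*E+e) = (\<Sum>k<d*E. C $$ (x*E+e,k) * w $ k)"
      by (rule index_mult_mat_vec_sum[OF C w]) (use x e in \<open>simp add: pair_index_bound\<close>)
    also have "\<dots> = (\<Sum>z<d. \<Sum>f<E. C $$ (x*E+e,z*E+f) * w $ (z*E+f))" by (rule sum_pair)
    also have "\<dots> = (\<Sum>z<d. if z = y then \<Sum>f<E. C $$ (x*E+e,y*E+f) * v $ f else 0)"
      by (intro sum.cong refl) (auto simp: wi)
    also have "\<dots> = (\<Sum>f<E. ?B $$ (e,f) * v $ f)" using y e by simp
    also have "\<dots> = (?B *\<^sub>v v) $ e" by (rule index_mult_mat_vec_sum[symmetric]) (use v e in auto)
    finally show ?thesis .
  qed
  have "vnsq (?B *\<^sub>v v) = (\<Sum>e<E. (cmod ((C *\<^sub>v w) $ (x*E+e)))\<^sup>2)"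
    using Cw by (simp add: vnsq_def del: index_mult_mat_vec)
  also have "\<dots> \<le> (\<Sum>z<d. \<Sum>e<E. (cmod ((C *\<^sub>v w) $ (z*E+e)))\<^sup>2)"
    by (rule member_le_sum[of x _ "\<lambda>z. \<Sum>e<E. (cmod ((C *\<^sub>v w) $ (z*E+e)))\<^sup>2"]) (use x in \<open>auto intro: sum_nonneg\<close>)
  also have "\<dots> = vnsq (C *\<^sub>v w)" by (rule vnsq_pair[symmetric]) (use C w in auto)
  also have "\<dots> \<le> vnsq w" by (rule contractionD[OF c C w])
  finally show "vnsq (?B *\<^sub>v v) \<le> vnsq v" by (simp add: vw)
qed

text \<open>Both roots are positive, so Powers-Stormer bounds their distance by the trace of a
  contraction \<open>C\<close> against the difference of their squares. That difference has no
  diagonal blocks, and trace norm duality bounds the contribution of each other block because a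
  block of \<open>C\<close> is again a contraction.\<close>

lemma fro_sqrt_le:
  assumes M: "psd (d*E) M" and R: "\<And>x y. x < d \<Longrightarrow> y < d \<Longrightarrow> R x y \<in> carrier_mat E E"
    and MR: "\<And>x y e f. x < d \<Longrightarrow> y < d \<Longrightarrow> e < E \<Longrightarrow> f < E \<Longrightarrow> M $$ (x*E+e,y*E+f) = R x y $$ (e,f)"
    and Rx: "\<And>x. x < d \<Longrightarrow> psd E (R x x)"
    and \<nu>: "0 \<le> \<nu>" "\<And>x y. x < d \<Longrightarrow> y < d \<Longrightarrow> x \<noteq> y \<Longrightarrow> trace_norm (R x y) \<le> \<nu>"
  shows "fro (msqrt M - blk d E (\<lambda>x. msqrt (R x x))) \<le> (real d * sqrt \<nu>)\<^sup>2"
proof -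
  define G where "G = msqrt M"
  define G0 where "G0 = blk d E (\<lambda>x. msqrt (R x x))"
  define D where "D = blk d E (\<lambda>x. R x x)"
  have G: "psd (d*E) G" "G * G = M" using msqrt_psd[OF M] by (auto simp: G_def)
  have G0: "psd (d*E) G0" unfolding G0_def by (rule psd_blk) (use msqrt_psd(1)[OF Rx] in auto)
  have "G0 * G0 = blk d E (\<lambda>x. msqrt (R x x) * msqrt (R x x))"
    unfolding G0_def by (rule blk_mult) (use psdD(1)[OF msqrt_psd(1)[OF Rx]] in auto)
  also have "\<dots> = D" unfolding D_def by (rule blk_cong) (use msqrt_psd(2)[OF Rx] in auto)
  finally have G0D: "G0 * G0 = D" .
  obtain C where C: "C \<in> carrier_mat (d*E) (d*E)" "contraction C" 
      and le: "fro (G - G0) \<le> Re (mtrace (C * (M - D)))"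
    using powers_stormer[OF G(1) G0] unfolding G(2) G0D by blast
  have Mc: "M \<in> carrier_mat (d*E) (d*E)" by (rule psdD[OF M])
  have Dc: "D \<in> carrier_mat (d*E) (d*E)" by (simp add: D_def)
  let ?B = "\<lambda>x y. mat E E (\<lambda>(e,f). C $$ (x*E+e, y*E+f))"
  have "mtrace (C * (M - D)) = (\<Sum>i<d*E. \<Sum>k<d*E. C $$ (i,k) * (M - D) $$ (k,i))"
    by (rule mtrace_mult) (use C Mc Dc in auto)
  also have "\<dots> = (\<Sum>x<d. \<Sum>e<E. \<Sum>y<d. \<Sum>f<E. C $$ (x*E+e,y*E+f) * (M - D) $$ (y*E+f,x*E+e))"
    unfolding sum_pair ..
  also have "\<dots> = (\<Sum>x<d. \<Sum>y<d. \<Sum>e<E. \<Sum>f<E. C $$ (x*E+e,y*E+f) * (M - D) $$ (y*E+f,x*E+e))"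
    by (intro sum.cong refl sum.swap)
  also have "\<dots> = (\<Sum>x<d. \<Sum>y<d. if x = y then 0 else mtrace (?B x y * R y x))"
  proof (intro sum.cong refl)
    fix x y assume "x \<in> {..<d}" "y \<in> {..<d}"
    hence xy: "x < d" "y < d" by auto
    have md: "(M - D) $$ (y*E+f,x*E+e) = (if x = y then 0 else R y x $$ (f,e))" if "e < E" "f < E" for e f
    proof -
      have "(M - D) $$ (y*E+f,x*E+e) = M $$ (y*E+f,x*E+e) - D $$ (y*E+f,x*E+e)"
        using that xy Dc by (simp add: pair_index_bound)
      thus ?thesis using that xy by (simp add: MR D_def blk_index)
    qed
    show "(\<Sum>e<E. \<Sum>f<E. C $$ (x*E+e,y*E+f) * (M - D) $$ (y*E+f,x*E+e)) = (if x = y then 0 else mtrace (?B x y * R y x))"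
    proof (cases "x = y")
      case False
      have "mtrace (?B x y * R y x) = (\<Sum>e<E. \<Sum>f<E. ?B x y $$ (e,f) * R y x $$ (f,e))"
        by (rule mtrace_mult) (use R xy in auto)
      thus ?thesis using False by (simp add: md)
    next
      case True
      thus ?thesis using md by simp
    qed
  qed
  finally have tr: "mtrace (C * (M - D)) = (\<Sum>x<d. \<Sum>y<d. if x = y then 0 else mtrace (?B x y * R y x))" .
  have "fro (G - G0) \<le> cmod (mtrace (C * (M - D)))" using le complex_Re_le_cmod order_trans by blast
  also have "\<dots> \<le> (\<Sum>x<d. \<Sum>y<d. cmod (if x = y then 0 else mtrace (?B x y * R y x)))"
    unfolding tr by (intro order_trans[OF norm_sum] sum_mono order_refl)
  \<comment> \<open>The vanishing diagonal pairs are charged \<open>\<nu>\<close> as well, which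
    rounds \<open>d * (d - 1)\<close> up to \<open>d * d\<close> and fixes the constant
    \<open>d * sqrt \<nu>\<close>.\<close>
  also have "\<dots> \<le> (\<Sum>x<d. \<Sum>y<d. \<nu>)"
  proof (intro sum_mono)
    fix x y assume "x \<in> {..<d}" "y \<in> {..<d}"
    hence xy: "x < d" "y < d" by auto
    show "cmod (if x = y then 0 else mtrace (?B x y * R y x)) \<le> \<nu>"
    proof (cases "x = y")
      case False
      have "cmod (mtrace (?B x y * R y x)) \<le> trace_norm (R y x)"
        by (rule cmod_mtrace_le_trace_norm[of _ E E]) (use R xy contraction_block[OF C xy] in auto)
      also have "\<dots> \<le> \<nu>" using \<nu>(2) xy False by simp
      finally show ?thesis using False by simp
    qed (use \<nu> in simp)
  qed
  also have "\<dots> = (real d * sqrt \<nu>)\<^sup>2" using \<nu>(1) by (simp add: power_mult_distrib power2_eq_square)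
  finally show ?thesis unfolding G_def G0_def .
qed

subsection \<open>The overlap functional\<close>

text \<open>Column \<open>(j,e)\<close> of the entrywise conjugate of \<open>\<Phi>\<close> tensored
  with the identity on the environment. The conjugate matches the adjoint in \<open>adj T\<close>,
  whose entries are conjugates of those of \<open>W\<close>.\<close>

definition slice_vec :: "nat \<Rightarrow> nat \<Rightarrow> complex mat \<Rightarrow> nat \<Rightarrow> nat \<Rightarrow> complex vec" where
  "slice_vec d E \<Phi> j e = vec (d*E) (\<lambda>i. if i mod E = e then cnj (\<Phi> $$ (i div E, j)) else 0)"

lemma slice_vec_carrier [simp]: "slice_vec d E \<Phi> j e \<in> carrier_vec (d*E)"
  by (simp add: slice_vec_def)

lemma slice_vec_index:
  "x < d \<Longrightarrow> f < E \<Longrightarrow> slice_vec d E \<Phi> j e $ (x*E+f) = (if f = e then cnj (\<Phi> $$ (x,j)) else 0)"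
  by (simp add: slice_vec_def pair_index_bound)

lemma mult_slice_vec:
  assumes A: "A \<in> carrier_mat n (d*E)" and k: "k < n" and e: "e < E"
  shows "(A *\<^sub>v slice_vec d E \<Phi> j e) $ k = (\<Sum>x<d. A $$ (k,x*E+e) * cnj (\<Phi> $$ (x,j)))"
proof -
  have "(A *\<^sub>v slice_vec d E \<Phi> j e) $ k = (\<Sum>i<d*E. A $$ (k,i) * slice_vec d E \<Phi> j e $ i)"
    by (rule index_mult_mat_vec_sum[OF A slice_vec_carrier k])
  also have "\<dots> = (\<Sum>x<d. \<Sum>f<E. if f = e then A $$ (k,x*E+e) * cnj (\<Phi> $$ (x,j)) else 0)"
    unfolding sum_pair by (intro sum.cong refl) (auto simp: slice_vec_index)
  finally show ?thesis using e by simp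
qed

text \<open>Cauchy-Schwarz is applied to the code index only, separately for each environment index.
  Submultiplicativity of the Frobenius norm for the whole tensor product would cost a factor
  \<open>E\<close>.\<close>

lemma sum_vnsq_mult_slice_vec_le:
  assumes A: "A \<in> carrier_mat n (d*E)" and \<Phi>: "\<Phi> \<in> carrier_mat d r"
  shows "(\<Sum>j<r. \<Sum>e<E. vnsq (A *\<^sub>v slice_vec d E \<Phi> j e)) \<le> fro A * fro \<Phi>"
proof -
  have "(\<Sum>j<r. \<Sum>e<E. vnsq (A *\<^sub>v slice_vec d E \<Phi> j e))
      \<le> (\<Sum>j<r. \<Sum>e<E. \<Sum>k<n. (\<Sum>x<d. (cmod (A $$ (k,x*E+e)))\<^sup>2) * (\<Sum>x<d. (cmod (\<Phi> $$ (x,j)))\<^sup>2))"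
  proof (intro sum_mono)
    fix j e assume "e \<in> {..<E}"
    hence e: "e < E" by simp
    have "vnsq (A *\<^sub>v slice_vec d E \<Phi> j e) = (\<Sum>k<n. (cmod ((A *\<^sub>v slice_vec d E \<Phi> j e) $ k))\<^sup>2)"
      using A by (simp add: vnsq_def)
    also have "\<dots> \<le> (\<Sum>k<n. (\<Sum>x<d. (cmod (A $$ (k,x*E+e)))\<^sup>2) * (\<Sum>x<d. (cmod (\<Phi> $$ (x,j)))\<^sup>2))"
    proof (intro sum_mono)
      fix k assume "k \<in> {..<n}"
      thus "(cmod ((A *\<^sub>v slice_vec d E \<Phi> j e) $ k))\<^sup>2
          \<le> (\<Sum>x<d. (cmod (A $$ (k,x*E+e)))\<^sup>2) * (\<Sum>x<d. (cmod (\<Phi> $$ (x,j)))\<^sup>2)"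
        using Cauchy_Schwarz_sum[of "\<lambda>x. A $$ (k,x*E+e)" "\<lambda>x. cnj (\<Phi> $$ (x,j))" "{..<d}"]
          mult_slice_vec[OF A _ e, of k] by simp
    qed
    finally show "vnsq (A *\<^sub>v slice_vec d E \<Phi> j e)
      \<le> (\<Sum>k<n. (\<Sum>x<d. (cmod (A $$ (k,x*E+e)))\<^sup>2) * (\<Sum>x<d. (cmod (\<Phi> $$ (x,j)))\<^sup>2))" .
  qed
  also have "\<dots> = (\<Sum>e<E. \<Sum>k<n. \<Sum>x<d. (cmod (A $$ (k,x*E+e)))\<^sup>2) * (\<Sum>j<r. \<Sum>x<d. (cmod (\<Phi> $$ (x,j)))\<^sup>2)"
    by (simp add: sum_distrib_left[symmetric] sum_distrib_right[symmetric])
  also have "(\<Sum>e<E. \<Sum>k<n. \<Sum>x<d. (cmod (A $$ (k,x*E+e)))\<^sup>2) = fro A"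
  proof -
    have "fro A = (\<Sum>k<n. \<Sum>x<d. \<Sum>e<E. (cmod (A $$ (k,x*E+e)))\<^sup>2)"
      using A by (simp add: fro_def sum_pair)
    also have "\<dots> = (\<Sum>k<n. \<Sum>e<E. \<Sum>x<d. (cmod (A $$ (k,x*E+e)))\<^sup>2)"
      by (intro sum.cong refl sum.swap)
    also have "\<dots> = (\<Sum>e<E. \<Sum>k<n. \<Sum>x<d. (cmod (A $$ (k,x*E+e)))\<^sup>2)" by (rule sum.swap)
    finally show ?thesis ..
  qed
  also have "(\<Sum>j<r. \<Sum>x<d. (cmod (\<Phi> $$ (x,j)))\<^sup>2) = fro \<Phi>"
    using \<Phi> unfolding fro_def by (subst sum.swap) simp
  finally show ?thesis .
qed

text \<open>Expanding in matrix entries, the overlap is the pairing of the conjugated entries of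
  \<open>S\<close> with the conjugated amplitudes for \<open>(f,e)\<close>. Since
  \<open>fro S = 1\<close>, Cauchy-Schwarz passes from a lower bound on this one overlap to one on
  the sum of squared amplitudes, which is a squared entanglement fidelity.\<close>

lemma overlap_functional_cmod_le:
  assumes S: "S \<in> carrier_mat E E" "fro S = 1" and \<Phi>: "\<Phi> \<in> carrier_mat d r"
    and U: "U \<in> carrier_mat (d*E) (d*E)" and G: "G \<in> carrier_mat (d*E) (d*E)"
    and t: "\<And>j e. t j e = vec (d*E) (\<lambda>i. S $$ (i mod E, e) * cnj (\<Phi> $$ (i div E, j)))"
  shows "(cmod (\<Sum>j<r. \<Sum>e<E. cdot (U *\<^sub>v t j e) (G *\<^sub>v slice_vec d E \<Phi> j e)))\<^sup>2
    \<le> (\<Sum>f<E. \<Sum>e<E. (cmod (\<Sum>j<r. \<Sum>y<d. \<Sum>x<d. cnj (\<Phi> $$ (y,j)) * \<Phi> $$ (x,j) * (adj G * U) $$ (x*E+e,y*E+f)))\<^sup>2)"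
proof -
  define H where "H = adj U * G"
  have H: "H \<in> carrier_mat (d*E) (d*E)" using U G by (auto simp: H_def)
  have aH: "adj G * U = adj H" unfolding H_def using U G by (simp add: adj_mult)
  let ?K = "\<lambda>f e. \<Sum>j<r. \<Sum>y<d. \<Sum>x<d. cnj (\<Phi> $$ (y,j)) * \<Phi> $$ (x,j) * (adj G * U) $$ (x*E+e,y*E+f)"
  have tc: "t j e \<in> carrier_vec (d*E)" for j e by (simp add: t)
  have ti: "t j e $ (y*E+f) = S $$ (f,e) * cnj (\<Phi> $$ (y,j))" if "y < d" "f < E" for j e y f
    using that by (simp add: t pair_index_bound)
  have "cdot (U *\<^sub>v t j e) (G *\<^sub>v slice_vec d E \<Phi> j e)
      = (\<Sum>f<E. \<Sum>y<d. \<Sum>x<d. cnj (S $$ (f,e)) * (\<Phi> $$ (y,j) * cnj (\<Phi> $$ (x,j)) * H $$ (y*E+f,x*E+e)))"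
    if e: "e < E" for j e
  proof -
    have "cdot (U *\<^sub>v t j e) (G *\<^sub>v slice_vec d E \<Phi> j e) = cdot (t j e) (adj U *\<^sub>v (G *\<^sub>v slice_vec d E \<Phi> j e))"
      using cdot_adj[OF adj_carrier[OF U] tc mult_mat_vec_carrier[OF G slice_vec_carrier]] by simp
    also have "adj U *\<^sub>v (G *\<^sub>v slice_vec d E \<Phi> j e) = H *\<^sub>v slice_vec d E \<Phi> j e"
      unfolding H_def by (rule assoc_mult_mat_vec[symmetric]) (use U G in auto)
    also have "cdot (t j e) (H *\<^sub>v slice_vec d E \<Phi> j e)
        = (\<Sum>i<d*E. cnj (t j e $ i) * (H *\<^sub>v slice_vec d E \<Phi> j e) $ i)"
      using H by (simp add: cdot_def)
    also have "\<dots> = (\<Sum>y<d. \<Sum>f<E. cnj (t j e $ (y*E+f)) * (H *\<^sub>v slice_vec d E \<Phi> j e) $ (y*E+f))"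
      by (rule sum_pair)
    also have "\<dots> = (\<Sum>y<d. \<Sum>f<E. \<Sum>x<d. cnj (S $$ (f,e)) * (\<Phi> $$ (y,j) * cnj (\<Phi> $$ (x,j)) * H $$ (y*E+f,x*E+e)))"
    proof (intro sum.cong refl)
      fix y f assume "y \<in> {..<d}" "f \<in> {..<E}"
      hence yf: "y < d" "f < E" by auto
      show "cnj (t j e $ (y*E+f)) * (H *\<^sub>v slice_vec d E \<Phi> j e) $ (y*E+f)
        = (\<Sum>x<d. cnj (S $$ (f,e)) * (\<Phi> $$ (y,j) * cnj (\<Phi> $$ (x,j)) * H $$ (y*E+f,x*E+e)))"
        unfolding ti[OF yf] mult_slice_vec[OF H pair_index_bound[OF yf] e]
        by (simp add: sum_distrib_left mult_ac)
    qed
    also have "\<dots> = (\<Sum>f<E. \<Sum>y<d. \<Sum>x<d. cnj (S $$ (f,e)) * (\<Phi> $$ (y,j) * cnj (\<Phi> $$ (x,j)) * H $$ (y*E+f,x*E+e)))"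
      by (rule sum.swap)
    finally show ?thesis .
  qed
  hence "(\<Sum>j<r. \<Sum>e<E. cdot (U *\<^sub>v t j e) (G *\<^sub>v slice_vec d E \<Phi> j e))
      = (\<Sum>j<r. \<Sum>e<E. \<Sum>f<E. \<Sum>y<d. \<Sum>x<d. cnj (S $$ (f,e)) * (\<Phi> $$ (y,j) * cnj (\<Phi> $$ (x,j)) * H $$ (y*E+f,x*E+e)))"
    by simp
  also have "\<dots> = (\<Sum>e<E. \<Sum>f<E. \<Sum>j<r. \<Sum>y<d. \<Sum>x<d. cnj (S $$ (f,e)) * (\<Phi> $$ (y,j) * cnj (\<Phi> $$ (x,j)) * H $$ (y*E+f,x*E+e)))"
    by (subst sum.swap, rule sum.cong[OF refl], rule sum.swap)
  also have "\<dots> = (\<Sum>f<E. \<Sum>e<E. \<Sum>j<r. \<Sum>y<d. \<Sum>x<d. cnj (S $$ (f,e)) * (\<Phi> $$ (y,j) * cnj (\<Phi> $$ (x,j)) * H $$ (y*E+f,x*E+e)))"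
    by (rule sum.swap)
  also have "\<dots> = (\<Sum>f<E. \<Sum>e<E. cnj (S $$ (f,e)) * cnj (?K f e))"
  proof (rule sum.cong[OF refl], rule sum.cong[OF refl])
    fix f e assume "f \<in> {..<E}" "e \<in> {..<E}"
    hence ef: "e < E" "f < E" by auto
    have "(adj G * U) $$ (x*E+e,y*E+f) = cnj (H $$ (y*E+f,x*E+e))" if "x < d" "y < d" for x y
      unfolding aH by (rule adj_index) (use H that ef in \<open>auto simp: pair_index_bound\<close>)
    thus "(\<Sum>j<r. \<Sum>y<d. \<Sum>x<d. cnj (S $$ (f,e)) * (\<Phi> $$ (y,j) * cnj (\<Phi> $$ (x,j)) * H $$ (y*E+f,x*E+e)))
        = cnj (S $$ (f,e)) * cnj (?K f e)"
      by (simp add: sum_distrib_left del: index_mult_mat)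
  qed
  also have "\<dots> = (\<Sum>p\<in>{..<E}\<times>{..<E}. cnj (S $$ p) * cnj (?K (fst p) (snd p)))"
    unfolding sum.cartesian_product by (intro sum.cong refl) auto
  finally have eq: "(\<Sum>j<r. \<Sum>e<E. cdot (U *\<^sub>v t j e) (G *\<^sub>v slice_vec d E \<Phi> j e))
    = (\<Sum>p\<in>{..<E}\<times>{..<E}. cnj (S $$ p) * cnj (?K (fst p) (snd p)))" .
  have "(cmod (\<Sum>p\<in>{..<E}\<times>{..<E}. cnj (S $$ p) * cnj (?K (fst p) (snd p))))\<^sup>2
     \<le> (\<Sum>p\<in>{..<E}\<times>{..<E}. (cmod (cnj (S $$ p)))\<^sup>2) * (\<Sum>p\<in>{..<E}\<times>{..<E}. (cmod (cnj (?K (fst p) (snd p))))\<^sup>2)"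
    by (rule Cauchy_Schwarz_sum)
  also have "(\<Sum>p\<in>{..<E}\<times>{..<E}. (cmod (cnj (S $$ p)))\<^sup>2) = fro S"
    using S(1) unfolding fro_def sum.cartesian_product by (simp add: case_prod_unfold)
  also have "(\<Sum>p\<in>{..<E}\<times>{..<E}. (cmod (cnj (?K (fst p) (snd p))))\<^sup>2) = (\<Sum>f<E. \<Sum>e<E. (cmod (?K f e))\<^sup>2)"
    unfolding sum.cartesian_product complex_mod_cnj by (intro sum.cong refl) auto
  finally show ?thesis unfolding eq S(2) by simp
qed

text \<open>The contraction attaining the trace norm gives the two roots in the order used by
  \<open>fidelity\<close>. Its adjoint serves for the reversed order, and the trace, being real,
  survives the conjugation.\<close>

lemma fidelity_optimiser:
  assumes \<rho>: "psd n \<rho>" and \<sigma>: "psd n \<sigma>"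
  shows "\<exists>U \<in> carrier_mat n n. contraction U \<and> mtrace (U * (msqrt \<sigma> * msqrt \<rho>)) = of_real (fidelity \<rho> \<sigma>)"
proof -
  note r = psdD[OF msqrt_psd(1)[OF \<rho>]] and s = psdD[OF msqrt_psd(1)[OF \<sigma>]]
  have A: "msqrt \<rho> * msqrt \<sigma> \<in> carrier_mat n n" using r s by auto
  obtain V where V: "V \<in> carrier_mat n n" "contraction V"
      "mtrace (V * (msqrt \<rho> * msqrt \<sigma>)) = of_real (fidelity \<rho> \<sigma>)"
    using trace_norm_attained[OF A] unfolding fidelity_def by blast
  have "mtrace (adj V * (msqrt \<sigma> * msqrt \<rho>)) = mtrace ((msqrt \<sigma> * msqrt \<rho>) * adj V)"
    by (rule mtrace_mult_comm[of _ n n]) (use V r s in auto)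
  also have "(msqrt \<sigma> * msqrt \<rho>) * adj V = adj (V * (msqrt \<rho> * msqrt \<sigma>))"
    using V r s by (simp add: adj_mult)
  also have "mtrace \<dots> = cnj (mtrace (V * (msqrt \<rho> * msqrt \<sigma>)))"
    by (rule mtrace_adj[of _ n]) (use V A in auto)
  finally have "mtrace (adj V * (msqrt \<sigma> * msqrt \<rho>)) = of_real (fidelity \<rho> \<sigma>)" by (simp add: V(3))
  thus ?thesis using V contraction_adj[OF V(1,2)] by (meson adj_carrier)
qed

lemma fro_msqrt:
  assumes "psd n A"
  shows "complex_of_real (fro (msqrt A)) = mtrace A"
  using mtrace_adj_mult[of "msqrt A"] psdD(2)[OF msqrt_psd(1)[OF assms]] msqrt_psd(2)[OF assms] by simp

subsection \<open>The recovery contraction\<close>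

lemma sum_triple:
  "(\<Sum>p\<in>({..<r}\<times>{..<E})\<times>{..<m}. f p) = (\<Sum>j<r. \<Sum>e<E. \<Sum>k<m. f ((j,e),k))"
  for r E m :: nat
  by (simp add: sum.cartesian_product[symmetric] sum.cartesian_product')

text \<open>Three arrays are compared over the same index set: \<open>u\<close> from the true root
  \<open>G\<close>, \<open>v\<close> from its block diagonal model \<open>G0\<close>, and the target
  \<open>w\<close> from the rotated root of \<open>\<zeta>\<close>. The target overlaps well with
  \<open>v\<close> by the fidelity hypothesis, and \<open>u\<close> is close to \<open>v\<close> by
  the off-diagonal hypothesis. The matrix \<open>Y\<close> depends on neither the input state nor
  the reference, which is what makes one recovery serve all of them.\<close>

lemma core_recovery:
  fixes W :: "complex mat" and R :: "nat \<Rightarrow> nat \<Rightarrow> complex mat"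
  assumes W: "W \<in> carrier_mat (B*E) d" "adj W * W = 1\<^sub>m d"
    and R: "\<And>x y. R x y = mat E E (\<lambda>(e,f). \<Sum>\<beta><B. W $$ (\<beta>*E+e,x) * cnj (W $$ (\<beta>*E+f,y)))"
    and \<zeta>: "density E \<zeta>" and \<epsilon>: "0 \<le> \<epsilon>" and \<nu>: "0 \<le> \<nu>"
    and fid: "\<And>x. x < d \<Longrightarrow> sqrt (1 - \<epsilon>\<^sup>2) \<le> fidelity (R x x) \<zeta>"
    and off: "\<And>x y. x < d \<Longrightarrow> y < d \<Longrightarrow> x \<noteq> y \<Longrightarrow> trace_norm (R x y) \<le> \<nu>"
  shows "\<exists>Y \<in> carrier_mat B (d*E). contraction Y \<and> (\<forall>r. \<forall>\<Phi> \<in> carrier_mat d r. fro \<Phi> = 1 \<longrightarrow>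
     1 - (\<epsilon> + real d * sqrt \<nu>)\<^sup>2 \<le> (\<Sum>f<E. \<Sum>e<E. (cmod (\<Sum>j<r. \<Sum>y<d. \<Sum>x<d.
        cnj (\<Phi> $$ (y,j)) * \<Phi> $$ (x,j) * (\<Sum>\<beta><B. W $$ (\<beta>*E+e,x) * Y $$ (\<beta>,y*E+f))))\<^sup>2))"
proof -
  define T where "T = mat (d*E) B (\<lambda>(i,\<beta>). W $$ (\<beta>*E + i mod E, i div E))"
  have T: "T \<in> carrier_mat (d*E) B" by (simp add: T_def)
  have Ti: "T $$ (x*E+e,\<beta>) = W $$ (\<beta>*E+e,x)" if "x < d" "e < E" "\<beta> < B" for x e \<beta>
    using that by (simp add: T_def pair_index_bound)
  define M where "M = T * adj T"
  have M: "psd (d*E) M" unfolding M_def using psd_adj_mult[OF adj_carrier[OF T]] by simp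
  have Rc: "R x y \<in> carrier_mat E E" for x y by (simp add: R)
  have MR: "M $$ (x*E+e,y*E+f) = R x y $$ (e,f)" if "x < d" "y < d" "e < E" "f < E" for x y e f
  proof -
    have "M $$ (x*E+e,y*E+f) = (\<Sum>\<beta><B. T $$ (x*E+e,\<beta>) * adj T $$ (\<beta>,y*E+f))"
      unfolding M_def by (rule index_mult_mat_sum) (use T that in \<open>auto simp: pair_index_bound\<close>)
    also have "\<dots> = (\<Sum>\<beta><B. W $$ (\<beta>*E+e,x) * cnj (W $$ (\<beta>*E+f,y)))"
    proof (intro sum.cong refl)
      fix \<beta> assume "\<beta> \<in> {..<B}"
      hence \<beta>: "\<beta> < B" by simp
      have "adj T $$ (\<beta>,y*E+f) = cnj (T $$ (y*E+f,\<beta>))"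
        by (rule adj_index) (use T that \<beta> in \<open>auto simp: pair_index_bound\<close>)
      thus "T $$ (x*E+e,\<beta>) * adj T $$ (\<beta>,y*E+f) = W $$ (\<beta>*E+e,x) * cnj (W $$ (\<beta>*E+f,y))"
        using that \<beta> by (simp add: Ti)
    qed
    finally show ?thesis using that by (simp add: R)
  qed
  have Rx: "psd E (R x x)" for x
  proof -
    define A where "A = mat E B (\<lambda>(e,\<beta>). W $$ (\<beta>*E+e,x))"
    have A: "A \<in> carrier_mat E B" by (simp add: A_def)
    have "R x x = A * adj A"
      by (rule eq_matI) (auto simp: R A_def scalar_prod_def atLeast0LessThan)
    thus ?thesis using psd_adj_mult[OF adj_carrier[OF A]] by simp
  qed
  define sR where "sR x = msqrt (R x x)" for x
  have sR: "sR x \<in> carrier_mat E E" "adj (sR x) = sR x" for x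
    using psdD[OF msqrt_psd(1)[OF Rx]] by (auto simp: sR_def)
  define S where "S = msqrt \<zeta>"
  have \<zeta>p: "psd E \<zeta>" "mtrace \<zeta> = 1" using \<zeta> by (auto simp: density_def)
  have S: "S \<in> carrier_mat E E" "adj S = S" "fro S = 1"
    using psdD[OF msqrt_psd(1)[OF \<zeta>p(1)]] fro_msqrt[OF \<zeta>p(1)] \<zeta>p(2) by (auto simp: S_def)
  have "\<exists>Us. \<forall>x. Us x \<in> carrier_mat E E \<and> contraction (Us x) \<and> mtrace (Us x * (S * sR x)) = of_real (fidelity (R x x) \<zeta>)"
    using fidelity_optimiser[OF Rx \<zeta>p(1)] unfolding S_def sR_def by (intro choice) blast
  then obtain Us where Us: "\<And>x. Us x \<in> carrier_mat E E" "\<And>x. contraction (Us x)"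
      "\<And>x. mtrace (Us x * (S * sR x)) = of_real (fidelity (R x x) \<zeta>)" by blast
  define U where "U = blk d E Us"
  have U: "U \<in> carrier_mat (d*E) (d*E)" "contraction U"
    unfolding U_def by (simp, rule contraction_blk) (use Us in auto)
  define G where "G = msqrt M"
  define G0 where "G0 = blk d E sR"
  have G: "G \<in> carrier_mat (d*E) (d*E)" "adj G = G" "G * G = M"
    using psdD[OF msqrt_psd(1)[OF M]] msqrt_psd(2)[OF M] by (auto simp: G_def)
  have G0: "G0 \<in> carrier_mat (d*E) (d*E)" by (simp add: G0_def)
  obtain V where V: "V \<in> carrier_mat (d*E) B" "contraction V" "V * adj T = G"
    using polar_contraction[OF adj_carrier[OF T]] unfolding adj_adj M_def[symmetric] G_def by blast
  have "adj (V * adj T) = T * adj V" using V(1) T by (simp add: adj_mult)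
  hence TV: "T * adj V = G" unfolding V(3) G(2) ..
  \<comment> \<open>Chosen so that \<open>T * Y = G * U\<close>. The left side holds the amplitudes
    of the recovered channel, the right side the overlaps that can be estimated.\<close>
  define Y where "Y = adj V * U"
  have Y: "Y \<in> carrier_mat B (d*E)" using V U by (auto simp: Y_def)
  have TY: "T * Y = G * U" unfolding Y_def TV[symmetric] using T V U by (simp add: mat_assoc)
  have Yc: "contraction Y" unfolding Y_def
    by (rule contraction_mult[OF adj_carrier[OF V(1)] U(1) contraction_adj[OF V(1,2)] U(2)])
  have dist: "fro (G - G0) \<le> (real d * sqrt \<nu>)\<^sup>2"
    unfolding G_def G0_def sR_def by (rule fro_sqrt_le[OF M Rc MR Rx \<nu> off])
  have trR: "fro (sR x) = 1" if x: "x < d" for x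
  proof -
    have "complex_of_real (fro (sR x)) = mtrace (R x x)" unfolding sR_def by (rule fro_msqrt[OF Rx])
    also have "\<dots> = (\<Sum>e<E. \<Sum>\<beta><B. W $$ (\<beta>*E+e,x) * cnj (W $$ (\<beta>*E+e,x)))" by (simp add: mtrace_def R)
    also have "\<dots> = (\<Sum>\<beta><B. \<Sum>e<E. W $$ (\<beta>*E+e,x) * cnj (W $$ (\<beta>*E+e,x)))" by (rule sum.swap)
    also have "\<dots> = (\<Sum>i<B*E. W $$ (i,x) * cnj (W $$ (i,x)))" by (rule sum_pair[symmetric])
    also have "\<dots> = (\<Sum>i<B*E. adj W $$ (x,i) * W $$ (i,x))"
      by (intro sum.cong refl) (use W x in \<open>simp add: mult.commute\<close>)
    also have "\<dots> = (adj W * W) $$ (x,x)" by (rule index_mult_mat_sum[symmetric]) (use W x in auto)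
    finally show ?thesis using x by (simp add: W(2))
  qed
  have "1 - (\<epsilon> + real d * sqrt \<nu>)\<^sup>2 \<le> (\<Sum>f<E. \<Sum>e<E. (cmod (\<Sum>j<r. \<Sum>y<d. \<Sum>x<d.
        cnj (\<Phi> $$ (y,j)) * \<Phi> $$ (x,j) * (\<Sum>\<beta><B. W $$ (\<beta>*E+e,x) * Y $$ (\<beta>,y*E+f))))\<^sup>2)"
    if \<Phi>: "\<Phi> \<in> carrier_mat d r" and \<Phi>1: "fro \<Phi> = 1" for r \<Phi>
  proof -
    let ?c = "slice_vec d E \<Phi>"
    \<comment> \<open>Column \<open>(j,e)\<close> of the conjugate of \<open>\<Phi>\<close> tensored
      with \<open>S\<close>: the array that would arise if the environment held
      \<open>\<zeta>\<close> for every basis state.\<close>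
    define t where "t j e = vec (d*E) (\<lambda>i. S $$ (i mod E, e) * cnj (\<Phi> $$ (i div E, j)))" for j e
    have tc: "t j e \<in> carrier_vec (d*E)" for j e by (simp add: t_def)
    have ti: "t j e $ (y*E+f) = S $$ (f,e) * cnj (\<Phi> $$ (y,j))" if "y < d" "f < E" for j e y f
      using that by (simp add: t_def pair_index_bound)
    have \<Phi>sum: "(\<Sum>x<d. \<Sum>j<r. (cmod (\<Phi> $$ (x,j)))\<^sup>2) = 1" using \<Phi> \<Phi>1 by (simp add: fro_def)
    define u where "u = (\<lambda>((j,e),k). (G *\<^sub>v ?c j e) $ k)"
    define v where "v = (\<lambda>((j,e),k). (G0 *\<^sub>v ?c j e) $ k)"
    \<comment> \<open>The conjugate is inserted because the perturbation bound pairs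
      \<open>w\<close> and \<open>u\<close> bilinearly.\<close>
    define w where "w = (\<lambda>((j,e),k). cnj ((U *\<^sub>v t j e) $ k))"
    let ?I = "({..<r}\<times>{..<E})\<times>{..<d*E}"
    have w1: "(\<Sum>p\<in>?I. (cmod (w p))\<^sup>2) \<le> 1"
    proof -
      have "(\<Sum>p\<in>?I. (cmod (w p))\<^sup>2) = (\<Sum>j<r. \<Sum>e<E. vnsq (U *\<^sub>v t j e))"
        unfolding sum_triple using U by (simp add: w_def vnsq_def)
      also have "\<dots> \<le> (\<Sum>j<r. \<Sum>e<E. vnsq (t j e))"
        by (intro sum_mono contractionD[OF U(2,1) tc])
      also have "\<dots> = (\<Sum>j<r. \<Sum>e<E. \<Sum>y<d. \<Sum>f<E. (cmod (\<Phi> $$ (y,j)))\<^sup>2 * (cmod (S $$ (f,e)))\<^sup>2)"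
        unfolding vnsq_pair[OF tc] by (simp add: ti norm_mult power_mult_distrib mult.commute)
      also have "\<dots> = (\<Sum>j<r. \<Sum>y<d. (cmod (\<Phi> $$ (y,j)))\<^sup>2) * (\<Sum>e<E. \<Sum>f<E. (cmod (S $$ (f,e)))\<^sup>2)"
        by (simp add: sum_distrib_left[symmetric] sum_distrib_right[symmetric])
      also have "(\<Sum>j<r. \<Sum>y<d. (cmod (\<Phi> $$ (y,j)))\<^sup>2) = 1" using \<Phi>sum by (subst sum.swap)
      also have "(\<Sum>e<E. \<Sum>f<E. (cmod (S $$ (f,e)))\<^sup>2) = 1"
        using S by (subst sum.swap) (simp add: fro_def)
      finally show ?thesis by simp
    qed
    have u1: "(\<Sum>p\<in>?I. (cmod (u p))\<^sup>2) = 1"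
    proof -
      have "(\<Sum>p\<in>?I. (cmod (u p))\<^sup>2) = (\<Sum>j<r. \<Sum>e<E. vnsq (G *\<^sub>v ?c j e))"
        unfolding sum_triple using G by (simp add: u_def vnsq_def)
      \<comment> \<open>\<open>G\<close> is Hermitian with square \<open>M = T * adj T\<close>, so
        \<open>G\<close> and \<open>adj T\<close> give every vector the same norm. Up to conjugation
        the latter produces the entries of \<open>W\<close> applied to the columns of
        \<open>\<Phi>\<close>, and \<open>W\<close> is an isometry.\<close>
      also have "\<dots> = (\<Sum>j<r. \<Sum>e<E. vnsq (adj T *\<^sub>v ?c j e))"
      proof (intro sum.cong refl)
        fix j e
        have "complex_of_real (vnsq (G *\<^sub>v ?c j e)) = cdot (M *\<^sub>v ?c j e) (?c j e)"
          using vnsq_mult[OF G(1) slice_vec_carrier] by (simp add: G(2,3))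
        also have "\<dots> = complex_of_real (vnsq (adj T *\<^sub>v ?c j e))"
          using vnsq_mult[OF adj_carrier[OF T] slice_vec_carrier] by (simp add: M_def)
        finally show "vnsq (G *\<^sub>v ?c j e) = vnsq (adj T *\<^sub>v ?c j e)" by simp
      qed
      also have "\<dots> = (\<Sum>j<r. vnsq (W *\<^sub>v col \<Phi> j))"
      proof (intro sum.cong refl)
        fix j assume "j \<in> {..<r}"
        hence j: "j < r" by simp
        have cj: "col \<Phi> j \<in> carrier_vec d" using \<Phi> j by auto
        have ent: "(adj T *\<^sub>v ?c j e) $ \<beta> = cnj ((W *\<^sub>v col \<Phi> j) $ (\<beta>*E+e))" if e: "e < E" and \<beta>: "\<beta> < B" for e \<beta>
        proof -
          have aT: "adj T $$ (\<beta>,x*E+e) = cnj (T $$ (x*E+e,\<beta>))" if "x < d" for x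
            by (rule adj_index) (use T that e \<beta> in \<open>auto simp: pair_index_bound\<close>)
          show ?thesis
            unfolding mult_slice_vec[OF adj_carrier[OF T] \<beta> e]
              index_mult_mat_vec_sum[OF W(1) cj pair_index_bound[OF \<beta> e]]
            using \<Phi> j e \<beta> by (simp add: aT Ti)
        qed
        have "(\<Sum>e<E. vnsq (adj T *\<^sub>v ?c j e)) = (\<Sum>e<E. \<Sum>\<beta><B. (cmod ((W *\<^sub>v col \<Phi> j) $ (\<beta>*E+e)))\<^sup>2)"
          using T by (simp add: vnsq_def ent del: index_mult_mat_vec)
        also have "\<dots> = (\<Sum>\<beta><B. \<Sum>e<E. (cmod ((W *\<^sub>v col \<Phi> j) $ (\<beta>*E+e)))\<^sup>2)" by (rule sum.swap)
        also have "\<dots> = vnsq (W *\<^sub>v col \<Phi> j)"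
          by (rule vnsq_pair[symmetric]) (rule mult_mat_vec_carrier[OF W(1) cj])
        finally show "(\<Sum>e<E. vnsq (adj T *\<^sub>v ?c j e)) = vnsq (W *\<^sub>v col \<Phi> j)" .
      qed
      also have "\<dots> = (\<Sum>j<r. vnsq (col \<Phi> j))"
        by (intro sum.cong refl vnsq_isometry[OF W]) (use \<Phi> in auto)
      also have "\<dots> = (\<Sum>j<r. \<Sum>x<d. (cmod (\<Phi> $$ (x,j)))\<^sup>2)"
        by (intro sum.cong refl) (use \<Phi> in \<open>auto simp: vnsq_def intro!: sum.cong\<close>)
      also have "\<dots> = 1" using \<Phi>sum by (subst sum.swap)
      finally show ?thesis .
    qed
    have G0c: "(G0 *\<^sub>v ?c j e) $ (x*E+f) = sR x $$ (f,e) * cnj (\<Phi> $$ (x,j))" if "x < d" "f < E" "e < E" for x f e j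
    proof -
      have "(G0 *\<^sub>v ?c j e) $ (x*E+f) = (\<Sum>g<E. sR x $$ (f,g) * ?c j e $ (x*E+g))"
        unfolding G0_def by (rule blk_mult_vec[OF slice_vec_carrier that(1,2)])
      also have "\<dots> = (\<Sum>g<E. if g = e then sR x $$ (f,e) * cnj (\<Phi> $$ (x,j)) else 0)"
        by (intro sum.cong refl) (use that in \<open>auto simp: slice_vec_index\<close>)
      finally show ?thesis using that by simp
    qed
    have v1: "(\<Sum>p\<in>?I. (cmod (v p))\<^sup>2) \<le> 1"
    proof -
      have "(\<Sum>p\<in>?I. (cmod (v p))\<^sup>2) = (\<Sum>j<r. \<Sum>e<E. \<Sum>x<d. \<Sum>f<E. (cmod (\<Phi> $$ (x,j)))\<^sup>2 * (cmod (sR x $$ (f,e)))\<^sup>2)"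
        unfolding sum_triple sum_pair by (simp add: v_def G0c norm_mult power_mult_distrib mult.commute)
      also have "\<dots> = (\<Sum>j<r. \<Sum>x<d. \<Sum>e<E. \<Sum>f<E. (cmod (\<Phi> $$ (x,j)))\<^sup>2 * (cmod (sR x $$ (f,e)))\<^sup>2)"
        by (rule sum.cong[OF refl], rule sum.swap)
      also have "\<dots> = (\<Sum>j<r. \<Sum>x<d. (cmod (\<Phi> $$ (x,j)))\<^sup>2)"
      proof (rule sum.cong[OF refl], rule sum.cong[OF refl])
        fix j x assume "x \<in> {..<d}"
        hence x: "x < d" by simp
        have "(\<Sum>e<E. \<Sum>f<E. (cmod (sR x $$ (f,e)))\<^sup>2) = 1"
          using trR[OF x] sR(1)[of x] by (subst sum.swap) (simp add: fro_def)
        thus "(\<Sum>e<E. \<Sum>f<E. (cmod (\<Phi> $$ (x,j)))\<^sup>2 * (cmod (sR x $$ (f,e)))\<^sup>2) = (cmod (\<Phi> $$ (x,j)))\<^sup>2"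
          by (simp add: sum_distrib_left[symmetric])
      qed
      also have "\<dots> = 1" using \<Phi>sum by (subst sum.swap)
      finally show ?thesis by simp
    qed
    have uv: "(\<Sum>p\<in>?I. (cmod (u p - v p))\<^sup>2) \<le> (real d * sqrt \<nu>)\<^sup>2"
    proof -
      have D: "G - G0 \<in> carrier_mat (d*E) (d*E)" using G G0 by auto
      have "(\<Sum>p\<in>?I. (cmod (u p - v p))\<^sup>2) = (\<Sum>j<r. \<Sum>e<E. vnsq ((G - G0) *\<^sub>v ?c j e))"
        unfolding sum_triple using G G0
        by (simp add: u_def v_def vnsq_def minus_mult_distrib_mat_vec[OF G(1) G0 slice_vec_carrier] del: index_mult_mat_vec)
      also have "\<dots> \<le> fro (G - G0) * fro \<Phi>" by (rule sum_vnsq_mult_slice_vec_le[OF D \<Phi>])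
      finally show ?thesis using dist \<Phi>1 by simp
    qed
    \<comment> \<open>By the choice of \<open>Us x\<close>, block \<open>x\<close> contributes
      exactly the fidelity of \<open>R x x\<close> and \<open>\<zeta>\<close>, a real number, so no
      phases cancel between blocks. The weights are the squared moduli of the entries of
      \<open>\<Phi>\<close>, which sum to one.\<close>
    have ov: "sqrt (1 - \<epsilon>\<^sup>2) \<le> cmod (\<Sum>p\<in>?I. w p * v p)"
    proof -
      have "(\<Sum>p\<in>?I. w p * v p) = (\<Sum>j<r. \<Sum>e<E. \<Sum>x<d. \<Sum>f<E.
          of_real ((cmod (\<Phi> $$ (x,j)))\<^sup>2) * (cnj ((Us x * S) $$ (f,e)) * sR x $$ (f,e)))"
        unfolding sum_triple sum_pair
      proof (rule sum.cong[OF refl], rule sum.cong[OF refl], rule sum.cong[OF refl], rule sum.cong[OF refl])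
        fix j e x f assume "e \<in> {..<E}" "x \<in> {..<d}" "f \<in> {..<E}"
        hence exf: "e < E" "x < d" "f < E" by auto
        have "(U *\<^sub>v t j e) $ (x*E+f) = (\<Sum>g<E. Us x $$ (f,g) * t j e $ (x*E+g))"
          unfolding U_def by (rule blk_mult_vec[OF tc exf(2,3)])
        also have "\<dots> = (Us x * S) $$ (f,e) * cnj (\<Phi> $$ (x,j))"
          unfolding index_mult_mat_sum[OF Us(1) S(1) exf(3,1)] using exf by (simp add: ti sum_distrib_right mult.assoc)
        finally have wi: "w ((j,e),x*E+f) = cnj ((Us x * S) $$ (f,e)) * \<Phi> $$ (x,j)"
          by (simp add: w_def del: index_mult_mat index_mult_mat_vec)
        have vi: "v ((j,e),x*E+f) = sR x $$ (f,e) * cnj (\<Phi> $$ (x,j))"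
          using exf by (simp add: v_def G0c del: index_mult_mat_vec)
        show "w ((j,e),x*E+f) * v ((j,e),x*E+f)
          = of_real ((cmod (\<Phi> $$ (x,j)))\<^sup>2) * (cnj ((Us x * S) $$ (f,e)) * sR x $$ (f,e))"
          unfolding wi vi complex_norm_square by (simp only: mult_ac)
      qed
      also have "\<dots> = (\<Sum>j<r. \<Sum>x<d. \<Sum>e<E. \<Sum>f<E.
          of_real ((cmod (\<Phi> $$ (x,j)))\<^sup>2) * (cnj ((Us x * S) $$ (f,e)) * sR x $$ (f,e)))"
        by (rule sum.cong[OF refl], rule sum.swap)
      also have "\<dots> = (\<Sum>j<r. \<Sum>x<d. of_real ((cmod (\<Phi> $$ (x,j)))\<^sup>2) * of_real (fidelity (R x x) \<zeta>))"
      proof (rule sum.cong[OF refl], rule sum.cong[OF refl])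
        fix j x
        have US: "Us x * S \<in> carrier_mat E E" using Us(1)[of x] S by auto
        have "(\<Sum>e<E. \<Sum>f<E. cnj ((Us x * S) $$ (f,e)) * sR x $$ (f,e)) = (\<Sum>f<E. \<Sum>e<E. cnj ((Us x * S) $$ (f,e)) * sR x $$ (f,e))"
          by (rule sum.swap)
        also have "\<dots> = (\<Sum>f<E. \<Sum>e<E. cnj ((Us x * S) $$ (f,e) * sR x $$ (e,f)))"
          by (intro sum.cong refl) (simp add: hermitian_index[OF sR(2,1)] del: index_mult_mat)
        also have "\<dots> = cnj (mtrace ((Us x * S) * sR x))"
          unfolding mtrace_mult[OF US sR(1)] cnj_sum ..
        also have "(Us x * S) * sR x = Us x * (S * sR x)" using Us(1)[of x] S sR(1)[of x] by (simp add: mat_assoc)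
        finally show "(\<Sum>e<E. \<Sum>f<E. of_real ((cmod (\<Phi> $$ (x,j)))\<^sup>2) * (cnj ((Us x * S) $$ (f,e)) * sR x $$ (f,e)))
          = of_real ((cmod (\<Phi> $$ (x,j)))\<^sup>2) * of_real (fidelity (R x x) \<zeta>)"
          by (simp add: sum_distrib_left[symmetric] Us(3) del: index_mult_mat)
      qed
      also have "\<dots> = of_real (\<Sum>j<r. \<Sum>x<d. (cmod (\<Phi> $$ (x,j)))\<^sup>2 * fidelity (R x x) \<zeta>)" by simp
      finally have eq: "(\<Sum>p\<in>?I. w p * v p) = of_real (\<Sum>j<r. \<Sum>x<d. (cmod (\<Phi> $$ (x,j)))\<^sup>2 * fidelity (R x x) \<zeta>)" .
      have "(\<Sum>j<r. \<Sum>x<d. (cmod (\<Phi> $$ (x,j)))\<^sup>2) = 1" using \<Phi>sum by (subst sum.swap)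
      hence "sqrt (1 - \<epsilon>\<^sup>2) = (\<Sum>j<r. \<Sum>x<d. (cmod (\<Phi> $$ (x,j)))\<^sup>2 * sqrt (1 - \<epsilon>\<^sup>2))"
        by (simp add: sum_distrib_right[symmetric])
      also have "\<dots> \<le> (\<Sum>j<r. \<Sum>x<d. (cmod (\<Phi> $$ (x,j)))\<^sup>2 * fidelity (R x x) \<zeta>)"
        by (intro sum_mono mult_left_mono fid) auto
      also have "\<dots> \<le> cmod (\<Sum>p\<in>?I. w p * v p)" unfolding eq norm_of_real by (rule abs_ge_self)
      finally show ?thesis .
    qed
    have "1 - (\<epsilon> + real d * sqrt \<nu>)\<^sup>2 \<le> (cmod (\<Sum>p\<in>?I. w p * u p))\<^sup>2"
      by (rule overlap_perturbation[OF w1 u1 v1 uv _ \<epsilon> ov]) (use \<nu> in simp)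
    also have "(\<Sum>p\<in>?I. w p * u p) = (\<Sum>j<r. \<Sum>e<E. cdot (U *\<^sub>v t j e) (G *\<^sub>v ?c j e))"
      unfolding sum_triple using G by (simp add: w_def u_def cdot_def)
    also have "(cmod \<dots>)\<^sup>2 \<le> (\<Sum>f<E. \<Sum>e<E. (cmod (\<Sum>j<r. \<Sum>y<d. \<Sum>x<d. cnj (\<Phi> $$ (y,j)) * \<Phi> $$ (x,j) * (adj G * U) $$ (x*E+e,y*E+f)))\<^sup>2)"
      by (rule overlap_functional_cmod_le[OF S(1,3) \<Phi> U(1) G(1) t_def])
    also have "\<dots> = (\<Sum>f<E. \<Sum>e<E. (cmod (\<Sum>j<r. \<Sum>y<d. \<Sum>x<d.
        cnj (\<Phi> $$ (y,j)) * \<Phi> $$ (x,j) * (\<Sum>\<beta><B. W $$ (\<beta>*E+e,x) * Y $$ (\<beta>,y*E+f))))\<^sup>2)"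
    proof -
      have "(adj G * U) $$ (x*E+e,y*E+f) = (\<Sum>\<beta><B. W $$ (\<beta>*E+e,x) * Y $$ (\<beta>,y*E+f))"
        if "x < d" "y < d" "e < E" "f < E" for x y e f
      proof -
        have "(adj G * U) $$ (x*E+e,y*E+f) = (T * Y) $$ (x*E+e,y*E+f)" unfolding G(2) TY ..
        also have "\<dots> = (\<Sum>\<beta><B. T $$ (x*E+e,\<beta>) * Y $$ (\<beta>,y*E+f))"
          by (rule index_mult_mat_sum[OF T Y]) (use that in \<open>auto simp: pair_index_bound\<close>)
        finally show ?thesis using that by (simp add: Ti)
      qed
      thus ?thesis by (simp del: index_mult_mat)
    qed
    finally show ?thesis .
  qed
  thus ?thesis using Y Yc by blast
qed

subsection \<open>From Stinespring isometries to Kraus operators\<close>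

text \<open>The Kraus operator that results from projecting the environment of the dilation
  \<open>W\<close> onto the basis vector \<open>e\<close>.\<close>

definition slice :: "nat \<Rightarrow> nat \<Rightarrow> complex mat \<Rightarrow> nat \<Rightarrow> complex mat" where
  "slice B E W e = mat B (dim_col W) (\<lambda>(\<beta>,l). W $$ (\<beta>*E+e,l))"

definition slices :: "nat \<Rightarrow> nat \<Rightarrow> complex mat \<Rightarrow> complex mat list" where
  "slices B E W = map (slice B E W) [0..<E]"

lemma slice_carrier [simp]: "W \<in> carrier_mat n d \<Longrightarrow> slice B E W e \<in> carrier_mat B d"
  by (auto simp: slice_def)

lemma slices_carrier: "W \<in> carrier_mat n d \<Longrightarrow> set (slices B E W) \<subseteq> carrier_mat B d"
  by (auto simp: slices_def)

lemma sum_list_map_upt: "(\<Sum>x\<leftarrow>map g [0..<n]. f x) = (\<Sum>i<n. f (g i))"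
  by (simp add: o_def interv_sum_list_conv_sum_set_nat atLeast0LessThan)

lemma conj_index:
  assumes K: "K \<in> carrier_mat n m" and \<rho>: "\<rho> \<in> carrier_mat m m" and i: "i < n" and j: "j < n"
  shows "(K * \<rho> * adj K) $$ (i,j) = (\<Sum>l'<m. \<Sum>l<m. K $$ (i,l) * \<rho> $$ (l,l') * cnj (K $$ (j,l')))"
proof -
  have "(K * \<rho> * adj K) $$ (i,j) = (\<Sum>l'<m. (K * \<rho>) $$ (i,l') * adj K $$ (l',j))"
    by (rule index_mult_mat_sum) (use assms in auto)
  also have "\<dots> = (\<Sum>l'<m. (\<Sum>l<m. K $$ (i,l) * \<rho> $$ (l,l')) * cnj (K $$ (j,l')))"
    using K j by (intro sum.cong refl) (simp add: index_mult_mat_sum[OF K \<rho> i] del: index_mult_mat)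
  finally show ?thesis by (simp add: sum_distrib_right)
qed

lemma slice_conj_index:
  assumes W: "W \<in> carrier_mat (B*E) d" and \<rho>: "\<rho> \<in> carrier_mat d d" and "a < B" "a' < B" "e < E"
  shows "(slice B E W e * \<rho> * adj (slice B E W e)) $$ (a,a') = (W * \<rho> * adj W) $$ (a*E+e,a'*E+e)"
  unfolding conj_index[OF slice_carrier[OF W] \<rho> assms(3,4)]
    conj_index[OF W \<rho> pair_index_bound[OF assms(3,5)] pair_index_bound[OF assms(4,5)]]
  using assms by (intro sum.cong refl) (simp add: slice_def)

lemma stinespring_kraus:
  assumes "stinespring d B E \<Phi> W" "\<rho> \<in> carrier_mat d d"
  shows "\<Phi> \<rho> = kapply B (slices B E W) \<rho>"
proof -
  have W: "W \<in> carrier_mat (B*E) d" and \<Phi>: "\<Phi> \<rho> = ptrace2 B E (W * \<rho> * adj W)"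
    using assms by (auto simp: stinespring_def isometry_def)
  note c = kapply_carrier[OF slices_carrier[OF W, of B E], of \<rho>]
  show ?thesis
  proof (rule eq_matI)
    fix i j assume "i < dim_row (kapply B (slices B E W) \<rho>)" "j < dim_col (kapply B (slices B E W) \<rho>)"
    hence ij: "i < B" "j < B" using c by auto
    have "kapply B (slices B E W) \<rho> $$ (i,j) = (\<Sum>e<E. (slice B E W e * \<rho> * adj (slice B E W e)) $$ (i,j))"
      unfolding kapply_index[OF slices_carrier[OF W] ij] unfolding slices_def by (rule sum_list_map_upt)
    also have "\<dots> = (\<Sum>e<E. (W * \<rho> * adj W) $$ (i*E+e,j*E+e))"
      by (intro sum.cong refl slice_conj_index[OF W assms(2) ij]) simp
    finally show "\<Phi> \<rho> $$ (i,j) = kapply B (slices B E W) \<rho> $$ (i,j)"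
      unfolding \<Phi> using ij by (simp add: ptrace2_def)
  qed (use c in \<open>auto simp: \<Phi> ptrace2_def\<close>)
qed

lemma slices_vnsq:
  assumes W: "W \<in> carrier_mat (B*E) d" "adj W * W = 1\<^sub>m d" and v: "v \<in> carrier_vec d"
  shows "(\<Sum>A\<leftarrow>slices B E W. vnsq (A *\<^sub>v v)) = vnsq v"
proof -
  have "(\<Sum>A\<leftarrow>slices B E W. vnsq (A *\<^sub>v v)) = (\<Sum>e<E. vnsq (slice B E W e *\<^sub>v v))"
    unfolding slices_def by (rule sum_list_map_upt)
  also have "\<dots> = (\<Sum>e<E. \<Sum>\<beta><B. (cmod ((W *\<^sub>v v) $ (\<beta>*E+e)))\<^sup>2)"
  proof (rule sum.cong[OF refl])
    fix e assume "e \<in> {..<E}"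
    hence e: "e < E" by simp
    have "(slice B E W e *\<^sub>v v) $ \<beta> = (W *\<^sub>v v) $ (\<beta>*E+e)" if "\<beta> < B" for \<beta>
      unfolding index_mult_mat_vec_sum[OF slice_carrier[OF W(1)] v that]
        index_mult_mat_vec_sum[OF W(1) v pair_index_bound[OF that e]]
      using W that by (simp add: slice_def)
    thus "vnsq (slice B E W e *\<^sub>v v) = (\<Sum>\<beta><B. (cmod ((W *\<^sub>v v) $ (\<beta>*E+e)))\<^sup>2)"
      by (simp add: vnsq_def slice_def del: index_mult_mat_vec)
  qed
  also have "\<dots> = (\<Sum>\<beta><B. \<Sum>e<E. (cmod ((W *\<^sub>v v) $ (\<beta>*E+e)))\<^sup>2)" by (rule sum.swap)
  also have "\<dots> = vnsq (W *\<^sub>v v)" by (rule vnsq_pair[symmetric]) (rule mult_mat_vec_carrier[OF W(1) v])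
  also have "\<dots> = vnsq v" by (rule vnsq_isometry[OF W v])
  finally show ?thesis .
qed

text \<open>Reshaping \<open>\<phi>\<close> into the matrix \<open>m\<close> turns the action on the
  first tensor factor into left multiplication, and the overlap into a Hilbert-Schmidt inner
  product. A change of basis of the code then becomes cyclic bookkeeping in a trace.\<close>

lemma cdot_ampl_vec:
  assumes X: "X \<in> carrier_mat d d" and \<phi>: "\<phi> \<in> carrier_vec (d*r)"
  defines "m \<equiv> mat d r (\<lambda>(l,j). \<phi> $ (l*r+j))"
  shows "cdot \<phi> (ampl_vec d r \<phi> X) = mtrace (adj m * (X * m))"
proof -
  have m: "m \<in> carrier_mat d r" by (simp add: m_def)
  have "cdot \<phi> (ampl_vec d r \<phi> X) = (\<Sum>l<d. \<Sum>j<r. cnj (\<phi> $ (l*r+j)) * ampl_vec d r \<phi> X $ (l*r+j))"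
  proof -
    have "dim_vec (ampl_vec d r \<phi> X) = d*r" by (simp add: ampl_vec_def)
    thus ?thesis by (simp only: cdot_def sum_pair)
  qed
  also have "\<dots> = (\<Sum>l<d. \<Sum>j<r. adj m $$ (j,l) * (X * m) $$ (l,j))"
  proof (rule sum.cong[OF refl], rule sum.cong[OF refl])
    fix l j assume "l \<in> {..<d}" "j \<in> {..<r}"
    hence lj: "l < d" "j < r" by auto
    have "ampl_vec d r \<phi> X $ (l*r+j) = (\<Sum>a<d. X $$ (l,a) * \<phi> $ (a*r+j))"
      using lj by (simp add: ampl_vec_def pair_index_bound)
    also have "\<dots> = (X * m) $$ (l,j)"
      unfolding index_mult_mat_sum[OF X m lj] using lj by (simp add: m_def)
    finally show "cnj (\<phi> $ (l*r+j)) * ampl_vec d r \<phi> X $ (l*r+j) = adj m $$ (j,l) * (X * m) $$ (l,j)"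
      using lj by (simp add: m_def del: index_mult_mat)
  qed
  also have "\<dots> = (\<Sum>j<r. \<Sum>l<d. adj m $$ (j,l) * (X * m) $$ (l,j))" by (rule sum.swap)
  also have "\<dots> = mtrace (adj m * (X * m))" by (rule mtrace_mult[symmetric]) (use X m in auto)
  finally show ?thesis .
qed

text \<open>The basis \<open>b\<close> is absorbed into the isometry as \<open>W * b'\<close>, which
  reduces to the standard basis. The recovery operators are rotated back by \<open>b'\<close>, and
  the reshaped state is rotated by \<open>adj b'\<close>, so Frobenius norm one is kept.\<close>

lemma recovery_kraus:
  assumes iso: "isometry d (B*E) W" and b: "orthonormal_c d d b"
    and \<zeta>: "density E \<zeta>" and \<epsilon>: "0 \<le> \<epsilon>" and \<nu>: "0 \<le> \<nu>"
    and fid: "\<And>x. x < d \<Longrightarrow> sqrt (1 - \<epsilon>\<^sup>2) \<le> fidelity (complementary B E W (ketbra (b x) (b x))) \<zeta>"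
    and off: "\<And>x y. x < d \<Longrightarrow> y < d \<Longrightarrow> x \<noteq> y \<Longrightarrow> trace_norm (complementary B E W (ketbra (b x) (b y))) \<le> \<nu>"
  shows "\<exists>Ks. recovers d B (\<epsilon> + real d * sqrt \<nu>) Ks (slices B E W)"
proof -
  have W: "W \<in> carrier_mat (B*E) d" "adj W * W = 1\<^sub>m d" using iso by (auto simp: isometry_def)
  have bc: "b x \<in> carrier_vec d" if "x < d" for x using b that by (simp add: orthonormal_c_def)
  define b' where "b' = mat d d (\<lambda>(i,x). b x $ i)"
  have b': "b' \<in> carrier_mat d d" by (simp add: b'_def)
  have bb: "adj b' * b' = 1\<^sub>m d"
  proof (rule eq_matI)
    fix x y assume "x < dim_row (1\<^sub>m d :: complex mat)" "y < dim_col (1\<^sub>m d :: complex mat)"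
    hence xy: "x < d" "y < d" by auto
    have "(adj b' * b') $$ (x,y) = (\<Sum>i<d. adj b' $$ (x,i) * b' $$ (i,y))"
      by (rule index_mult_mat_sum) (use b' xy in auto)
    also have "\<dots> = (\<Sum>i<d. b y $ i * cnj (b x $ i))" using xy by (simp add: b'_def mult.commute)
    finally show "(adj b' * b') $$ (x,y) = 1\<^sub>m d $$ (x,y)" using b xy by (auto simp: orthonormal_c_def)
  qed (use b' in auto)
  have U: "unitary_mat d b'"
    using mat_mult_left_right_inverse[OF adj_carrier[OF b'] b' bb] b' bb by (simp add: unitary_mat_def)
  define W1 where "W1 = W * b'"
  have W1: "W1 \<in> carrier_mat (B*E) d" using W b' by (auto simp: W1_def)
  have W1i: "adj W1 * W1 = 1\<^sub>m d"
  proof -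
    have "adj W1 * W1 = adj b' * (adj W * (W * b'))"
      unfolding W1_def using W b' by (simp add: adj_mult mat_assoc)
    also have "adj W * (W * b') = (adj W * W) * b'"
      by (rule assoc_mult_mat[OF adj_carrier[OF W(1)] W(1) b', symmetric])
    finally show ?thesis unfolding W(2) using b' bb by simp
  qed
  have W1x: "W1 $$ (i,x) = (\<Sum>l<d. W $$ (i,l) * b x $ l)" if "i < B*E" "x < d" for i x
    unfolding W1_def index_mult_mat_sum[OF W(1) b' that] using that by (simp add: b'_def)
  define R where "R x y = mat E E (\<lambda>(e,f). \<Sum>\<beta><B. W1 $$ (\<beta>*E+e,x) * cnj (W1 $$ (\<beta>*E+f,y)))" for x y
  have compl: "complementary B E W (ketbra (b x) (b y)) = R x y" if xy: "x < d" "y < d" for x y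
  proof (rule eq_matI)
    fix e f assume "e < dim_row (R x y)" "f < dim_col (R x y)"
    hence ef: "e < E" "f < E" by (auto simp: R_def)
    let ?k = "ketbra (b x) (b y)"
    have k: "?k \<in> carrier_mat d d" using bc[OF xy(1)] bc[OF xy(2)] by (auto simp: ketbra_def)
    have "(W * ?k * adj W) $$ (\<beta>*E+e,\<beta>*E+f) = W1 $$ (\<beta>*E+e,x) * cnj (W1 $$ (\<beta>*E+f,y))" if \<beta>: "\<beta> < B" for \<beta>
    proof -
      let ?i = "\<beta>*E+e" and ?j = "\<beta>*E+f"
      have ij: "?i < B*E" "?j < B*E" using pair_index_bound[OF \<beta> ef(1)] pair_index_bound[OF \<beta> ef(2)] by auto
      have "(W * ?k * adj W) $$ (?i,?j) = (\<Sum>l'<d. (W * ?k) $$ (?i,l') * adj W $$ (l',?j))"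
        by (rule index_mult_mat_sum) (use W k ij in auto)
      also have "\<dots> = (\<Sum>l'<d. (\<Sum>l<d. W $$ (?i,l) * b x $ l) * cnj (W $$ (?j,l') * b y $ l'))"
      proof (rule sum.cong[OF refl])
        fix l' assume "l' \<in> {..<d}"
        hence l': "l' < d" by simp
        have "(W * ?k) $$ (?i,l') = (\<Sum>l<d. W $$ (?i,l) * b x $ l) * cnj (b y $ l')"
          unfolding index_mult_mat_sum[OF W(1) k ij(1) l'] sum_distrib_right
          by (intro sum.cong refl) (use l' bc[OF xy(1)] bc[OF xy(2)] in \<open>simp add: ketbra_def\<close>)
        thus "(W * ?k) $$ (?i,l') * adj W $$ (l',?j) = (\<Sum>l<d. W $$ (?i,l) * b x $ l) * cnj (W $$ (?j,l') * b y $ l')"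
          using W l' ij by (simp add: mult_ac del: index_mult_mat)
      qed
      also have "\<dots> = W1 $$ (?i,x) * cnj (W1 $$ (?j,y))"
        unfolding W1x[OF ij(1) xy(1)] W1x[OF ij(2) xy(2)] cnj_sum by (rule sum_distrib_left[symmetric])
      finally show ?thesis .
    qed
    thus "complementary B E W ?k $$ (e,f) = R x y $$ (e,f)"
      using ef by (simp add: complementary_def ptrace1_def R_def del: index_mult_mat)
  qed (auto simp: complementary_def ptrace1_def R_def)
  obtain Y where Y: "Y \<in> carrier_mat B (d*E)" "contraction Y"
    and ov: "\<And>r \<Phi>. \<Phi> \<in> carrier_mat d r \<Longrightarrow> fro \<Phi> = 1 \<Longrightarrow>
     1 - (\<epsilon> + real d * sqrt \<nu>)\<^sup>2 \<le> (\<Sum>f<E. \<Sum>e<E. (cmod (\<Sum>j<r. \<Sum>y<d. \<Sum>x<d.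
        cnj (\<Phi> $$ (y,j)) * \<Phi> $$ (x,j) * (\<Sum>\<beta><B. W1 $$ (\<beta>*E+e,x) * Y $$ (\<beta>,y*E+f))))\<^sup>2)"
  proof -
    have "\<And>x. x < d \<Longrightarrow> sqrt (1 - \<epsilon>\<^sup>2) \<le> fidelity (R x x) \<zeta>" using fid compl by simp
    moreover have "\<And>x y. x < d \<Longrightarrow> y < d \<Longrightarrow> x \<noteq> y \<Longrightarrow> trace_norm (R x y) \<le> \<nu>" using off compl by simp
    ultimately show ?thesis
      using core_recovery[OF W1 W1i R_def \<zeta> \<epsilon> \<nu>] that by blast
  qed
  \<comment> \<open>The columns of \<open>Y\<close> sharing the environment index \<open>f\<close>,
    as rows and without conjugation, since the amplitudes multiply entries of \<open>W1\<close> and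
    \<open>Y\<close> directly.\<close>
  define K' where "K' f = mat d B (\<lambda>(y,\<beta>). Y $$ (\<beta>,y*E+f))" for f
  have K': "K' f \<in> carrier_mat d B" for f by (simp add: K'_def)
  define Ks where "Ks = map (\<lambda>f. b' * K' f) [0..<E]"
  have Ks: "set Ks \<subseteq> carrier_mat d B" using b' K' by (auto simp: Ks_def)
  have "(\<Sum>K\<leftarrow>Ks. vnsq (K *\<^sub>v v)) \<le> vnsq v" if v: "v \<in> carrier_vec B" for v
  proof -
    \<comment> \<open>As \<open>K' f\<close> is a transpose rather than an adjoint, its outputs are
      conjugates of those of \<open>adj Y\<close> on the conjugated vector; norms are
      unaffected.\<close>
    let ?v = "vec B (\<lambda>\<beta>. cnj (v $ \<beta>))"
    have "(\<Sum>K\<leftarrow>Ks. vnsq (K *\<^sub>v v)) = (\<Sum>f<E. vnsq ((b' * K' f) *\<^sub>v v))"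
      unfolding Ks_def by (rule sum_list_map_upt)
    also have "\<dots> = (\<Sum>f<E. vnsq (K' f *\<^sub>v v))"
      by (rule sum.cong[OF refl])
         (simp add: assoc_mult_mat_vec[OF b' K' v] vnsq_isometry[OF b' bb mult_mat_vec_carrier[OF K' v]])
    also have "\<dots> = (\<Sum>f<E. \<Sum>y<d. (cmod ((adj Y *\<^sub>v ?v) $ (y*E+f)))\<^sup>2)"
    proof (rule sum.cong[OF refl])
      fix f assume "f \<in> {..<E}"
      hence f: "f < E" by simp
      have "(K' f *\<^sub>v v) $ y = cnj ((adj Y *\<^sub>v ?v) $ (y*E+f))" if y: "y < d" for y
      proof -
        have "adj Y $$ (y*E+f,\<beta>) = cnj (Y $$ (\<beta>,y*E+f))" if "\<beta> < B" for \<beta>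
          by (rule adj_index) (use Y that y f in \<open>auto simp: pair_index_bound\<close>)
        thus ?thesis
          unfolding index_mult_mat_vec_sum[OF K' v y]
            index_mult_mat_vec_sum[OF adj_carrier[OF Y(1)] vec_carrier pair_index_bound[OF y f]]
          using y by (simp add: K'_def)
      qed
      thus "vnsq (K' f *\<^sub>v v) = (\<Sum>y<d. (cmod ((adj Y *\<^sub>v ?v) $ (y*E+f)))\<^sup>2)"
        using K'[of f] by (simp add: vnsq_def del: index_mult_mat_vec)
    qed
    also have "\<dots> = (\<Sum>y<d. \<Sum>f<E. (cmod ((adj Y *\<^sub>v ?v) $ (y*E+f)))\<^sup>2)" by (rule sum.swap)
    also have "\<dots> = vnsq (adj Y *\<^sub>v ?v)"
      by (rule vnsq_pair[symmetric]) (rule mult_mat_vec_carrier[OF adj_carrier[OF Y(1)] vec_carrier])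
    also have "\<dots> \<le> vnsq ?v" by (rule contractionD[OF contraction_adj[OF Y] adj_carrier[OF Y(1)] vec_carrier])
    also have "\<dots> = vnsq v" using v by (simp add: vnsq_def)
    finally show ?thesis .
  qed
  moreover have "1 - (\<epsilon> + real d * sqrt \<nu>)\<^sup>2
      \<le> (\<Sum>K\<leftarrow>Ks. \<Sum>A\<leftarrow>slices B E W. (cmod (cdot \<phi> (ampl_vec d r \<phi> (K * A))))\<^sup>2)"
    if \<phi>: "unit_vec_c (d * r) \<phi>" for r \<phi>
  proof -
    have \<phi>c: "\<phi> \<in> carrier_vec (d*r)" "vnsq \<phi> = 1" using \<phi> by (auto simp: unit_vec_c_def vnsq_def)
    define m where "m = mat d r (\<lambda>(l,j). \<phi> $ (l*r+j))"
    have m: "m \<in> carrier_mat d r" by (simp add: m_def)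
    have m1: "fro m = 1" using \<phi>c unfolding vnsq_pair[OF \<phi>c(1)] by (simp add: fro_def m_def)
    define \<Phi> where "\<Phi> = adj b' * m"
    have \<Phi>: "\<Phi> \<in> carrier_mat d r" using b' m by (auto simp: \<Phi>_def)
    have b\<Phi>: "b' * \<Phi> = m" unfolding \<Phi>_def using unitary_cancel(2)[OF U] m by simp
    have "complex_of_real (fro \<Phi>) = mtrace (adj \<Phi> * \<Phi>)" by (rule mtrace_adj_mult[symmetric])
    also have "adj \<Phi> * \<Phi> = adj m * (b' * \<Phi>)" unfolding \<Phi>_def using b' m by (simp add: adj_mult mat_assoc)
    also have "mtrace \<dots> = complex_of_real (fro m)" unfolding b\<Phi> by (rule mtrace_adj_mult)
    finally have \<Phi>1: "fro \<Phi> = 1" using m1 by simp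
    have eq: "cdot \<phi> (ampl_vec d r \<phi> (b' * K' f * slice B E W e)) = (\<Sum>j<r. \<Sum>y<d. \<Sum>x<d.
        cnj (\<Phi> $$ (y,j)) * \<Phi> $$ (x,j) * (\<Sum>\<beta><B. W1 $$ (\<beta>*E+e,x) * Y $$ (\<beta>,y*E+f)))"
      if e: "e < E" and f: "f < E" for e f
    proof -
      let ?A = "slice B E W e"
      note A = slice_carrier[OF W(1), of B E e]
      have Ab: "(?A * b') $$ (\<beta>,x) = W1 $$ (\<beta>*E+e,x)" if "\<beta> < B" "x < d" for \<beta> x
        unfolding index_mult_mat_sum[OF A b' that] W1x[OF pair_index_bound[OF that(1) e] that(2)]
        using that W by (simp add: slice_def b'_def)
      define Z where "Z = K' f * (?A * b')"
      have Z: "Z \<in> carrier_mat d d" using K'[of f] A b' by (auto simp: Z_def)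
      have Zi: "Z $$ (y,x) = (\<Sum>\<beta><B. W1 $$ (\<beta>*E+e,x) * Y $$ (\<beta>,y*E+f))" if "y < d" "x < d" for y x
        unfolding Z_def index_mult_mat_sum[OF K' mult_carrier_mat[OF A b'] that]
        using that by (simp add: Ab K'_def mult.commute del: index_mult_mat)
      have "cdot \<phi> (ampl_vec d r \<phi> (b' * K' f * ?A)) = mtrace (adj m * ((b' * K' f * ?A) * m))"
        unfolding m_def by (rule cdot_ampl_vec[OF _ \<phi>c(1)]) (use b' K'[of f] A in auto)
      also have "adj m * ((b' * K' f * ?A) * m) = adj \<Phi> * (Z * \<Phi>)"
      proof -
        have "adj m * ((b' * K' f * ?A) * m) = adj m * ((b' * K' f * ?A) * (b' * \<Phi>))" unfolding b\<Phi> ..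
        also have "\<dots> = adj \<Phi> * (Z * \<Phi>)"
          unfolding Z_def using b' m K'[of f] A \<Phi> by (simp add: \<Phi>_def adj_mult mat_assoc)
        finally show ?thesis .
      qed
      also have "mtrace \<dots> = (\<Sum>j<r. \<Sum>y<d. adj \<Phi> $$ (j,y) * (Z * \<Phi>) $$ (y,j))"
        by (rule mtrace_mult) (use \<Phi> Z in auto)
      also have "\<dots> = (\<Sum>j<r. \<Sum>y<d. \<Sum>x<d. cnj (\<Phi> $$ (y,j)) * \<Phi> $$ (x,j) * Z $$ (y,x))"
      proof (rule sum.cong[OF refl], rule sum.cong[OF refl])
        fix j y assume "j \<in> {..<r}" "y \<in> {..<d}"
        hence jy: "j < r" "y < d" by auto
        show "adj \<Phi> $$ (j,y) * (Z * \<Phi>) $$ (y,j) = (\<Sum>x<d. cnj (\<Phi> $$ (y,j)) * \<Phi> $$ (x,j) * Z $$ (y,x))"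
          unfolding index_mult_mat_sum[OF Z \<Phi> jy(2,1)] using \<Phi> jy
          by (simp add: sum_distrib_left mult_ac)
      qed
      finally show ?thesis by (simp add: Zi)
    qed
    have "1 - (\<epsilon> + real d * sqrt \<nu>)\<^sup>2
      \<le> (\<Sum>f<E. \<Sum>e<E. (cmod (cdot \<phi> (ampl_vec d r \<phi> (b' * K' f * slice B E W e))))\<^sup>2)"
      using ov[OF \<Phi> \<Phi>1] by (simp add: eq)
    thus ?thesis unfolding Ks_def slices_def sum_list_map_upt .
  qed
  ultimately show ?thesis using Ks unfolding recovers_def by blast
qed

subsection \<open>Classical records\<close>

lemma sum_list_concat_map:
  fixes f :: "'b \<Rightarrow> 'c::comm_monoid_add"
  shows "(\<Sum>x\<leftarrow>concat (map g xs). f x) = (\<Sum>a\<leftarrow>xs. \<Sum>x\<leftarrow>g a. f x)"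
  by (induction xs) auto

text \<open>The operators \<open>s (c \<otimes> L)\<close> and \<open>K (c\<^sup>* \<otimes> 1)\<close>.\<close>

definition tag :: "nat \<Rightarrow> nat \<Rightarrow> real \<Rightarrow> complex vec \<Rightarrow> complex mat \<Rightarrow> complex mat" where
  "tag C B s c L = mat (C*B) (dim_col L) (\<lambda>(i,l). of_real s * c $ (i div B) * L $$ (i mod B,l))"

definition untag :: "nat \<Rightarrow> nat \<Rightarrow> complex vec \<Rightarrow> complex mat \<Rightarrow> complex mat" where
  "untag C B c K = mat (dim_row K) (C*B) (\<lambda>(l,i). cnj (c $ (i div B)) * K $$ (l,i mod B))"

lemma tag_carrier [simp]: "L \<in> carrier_mat B d \<Longrightarrow> tag C B s c L \<in> carrier_mat (C*B) d"
  by (auto simp: tag_def)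

lemma untag_carrier [simp]: "K \<in> carrier_mat d B \<Longrightarrow> untag C B c K \<in> carrier_mat d (C*B)"
  by (auto simp: untag_def)

lemma tag_index:
  "L \<in> carrier_mat B d \<Longrightarrow> \<gamma> < C \<Longrightarrow> \<beta> < B \<Longrightarrow> l < d \<Longrightarrow>
    tag C B s c L $$ (\<gamma>*B+\<beta>,l) = of_real s * c $ \<gamma> * L $$ (\<beta>,l)"
  by (simp add: tag_def pair_index_bound)

lemma untag_index:
  "K \<in> carrier_mat d B \<Longrightarrow> \<gamma> < C \<Longrightarrow> \<beta> < B \<Longrightarrow> l < d \<Longrightarrow>
    untag C B c K $$ (l,\<gamma>*B+\<beta>) = cnj (c $ \<gamma>) * K $$ (l,\<beta>)"
  by (simp add: untag_def pair_index_bound)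

lemma tag_conj_index:
  assumes L: "L \<in> carrier_mat B d" and \<rho>: "\<rho> \<in> carrier_mat d d" and q: "0 \<le> q"
    and \<gamma>: "\<gamma> < C" "\<gamma>' < C" and \<beta>: "\<beta> < B" "\<beta>' < B"
  shows "(tag C B (sqrt q) c L * \<rho> * adj (tag C B (sqrt q) c L)) $$ (\<gamma>*B+\<beta>,\<gamma>'*B+\<beta>')
    = of_real q * (c $ \<gamma> * cnj (c $ \<gamma>')) * (L * \<rho> * adj L) $$ (\<beta>,\<beta>')"
proof -
  have s: "complex_of_real (sqrt q) * complex_of_real (sqrt q) = of_real q"
    using q by (simp flip: of_real_mult)
  show ?thesis
    unfolding conj_index[OF tag_carrier[OF L] \<rho> pair_index_bound[OF \<gamma>(1) \<beta>(1)] pair_index_bound[OF \<gamma>(2) \<beta>(2)]]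
      conj_index[OF L \<rho> \<beta>] sum_distrib_left
  proof (intro sum.cong refl)
    fix l' l assume "l' \<in> {..<d}" "l \<in> {..<d}"
    hence l: "l' < d" "l < d" by auto
    show "tag C B (sqrt q) c L $$ (\<gamma>*B+\<beta>,l) * \<rho> $$ (l,l') * cnj (tag C B (sqrt q) c L $$ (\<gamma>'*B+\<beta>',l'))
      = of_real q * (c $ \<gamma> * cnj (c $ \<gamma>')) * (L $$ (\<beta>,l) * \<rho> $$ (l,l') * cnj (L $$ (\<beta>',l')))"
      unfolding tag_index[OF L \<gamma>(1) \<beta>(1) l(2)] tag_index[OF L \<gamma>(2) \<beta>(2) l(1)] s[symmetric]
      by (simp add: mult_ac)
  qed
qed

text \<open>A branch with weight \<open>q\<close> and record vector \<open>c\<close> has Kraus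
  operators scaled by \<open>sqrt q\<close>, because each operator enters once directly and once
  through its adjoint.\<close>

lemma kron_kapply:
  assumes Ls: "set Ls \<subseteq> carrier_mat B d" and \<rho>: "\<rho> \<in> carrier_mat d d" and q: "0 \<le> q" and c: "c \<in> carrier_vec C"
  shows "complex_of_real q \<cdot>\<^sub>m kron (ketbra c c) (kapply B Ls \<rho>) = kapply (C*B) (map (tag C B (sqrt q) c) Ls) \<rho>"
proof -
  let ?Ts = "map (tag C B (sqrt q) c) Ls"
  have Ts: "set ?Ts \<subseteq> carrier_mat (C*B) d" using Ls by auto
  note k = kapply_carrier[OF Ls, of \<rho>] and t = kapply_carrier[OF Ts, of \<rho>]
  show ?thesis
  proof (rule eq_matI)
    fix i j assume "i < dim_row (kapply (C*B) ?Ts \<rho>)" "j < dim_col (kapply (C*B) ?Ts \<rho>)"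
    hence ij: "i < C*B" "j < C*B" using t by auto
    obtain \<gamma> \<beta> where i: "\<gamma> < C" "\<beta> < B" "i = \<gamma>*B+\<beta>" using ij(1) by (rule pair_index_cases)
    obtain \<gamma>' \<beta>' where j: "\<gamma>' < C" "\<beta>' < B" "j = \<gamma>'*B+\<beta>'" using ij(2) by (rule pair_index_cases)
    have "kapply (C*B) ?Ts \<rho> $$ (i,j) = (\<Sum>L\<leftarrow>Ls. (tag C B (sqrt q) c L * \<rho> * adj (tag C B (sqrt q) c L)) $$ (i,j))"
      unfolding kapply_index[OF Ts ij] by (simp add: o_def)
    also have "\<dots> = (\<Sum>L\<leftarrow>Ls. of_real q * (c $ \<gamma> * cnj (c $ \<gamma>')) * (L * \<rho> * adj L) $$ (\<beta>,\<beta>'))"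
      by (rule arg_cong[where f = sum_list], rule map_cong[OF refl])
         (use Ls i j in \<open>auto simp: tag_conj_index[OF _ \<rho> q] simp del: index_mult_mat\<close>)
    also have "\<dots> = of_real q * (c $ \<gamma> * cnj (c $ \<gamma>')) * kapply B Ls \<rho> $$ (\<beta>,\<beta>')"
      unfolding kapply_index[OF Ls i(2) j(2)] by (rule sum_list_const_mult)
    finally show "(complex_of_real q \<cdot>\<^sub>m kron (ketbra c c) (kapply B Ls \<rho>)) $$ (i,j) = kapply (C*B) ?Ts \<rho> $$ (i,j)"
      using i j k c by (simp add: kron_def ketbra_def pair_index_bound)
  qed (use k t c in \<open>auto simp: kron_def ketbra_def\<close>)
qed

lemma vnsq_tag:
  assumes L: "L \<in> carrier_mat B d" and q: "0 \<le> q" and c: "c \<in> carrier_vec C" "vnsq c = 1" and v: "v \<in> carrier_vec d"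
  shows "vnsq (tag C B (sqrt q) c L *\<^sub>v v) = q * vnsq (L *\<^sub>v v)"
proof -
  have ent: "(tag C B (sqrt q) c L *\<^sub>v v) $ (\<gamma>*B+\<beta>) = of_real (sqrt q) * c $ \<gamma> * (L *\<^sub>v v) $ \<beta>" if "\<gamma> < C" "\<beta> < B" for \<gamma> \<beta>
    unfolding index_mult_mat_vec_sum[OF tag_carrier[OF L] v pair_index_bound[OF that]] index_mult_mat_vec_sum[OF L v that(2)]
      sum_distrib_left
    by (intro sum.cong refl) (use that in \<open>simp add: tag_index[OF L]\<close>)
  have "vnsq (tag C B (sqrt q) c L *\<^sub>v v) = (\<Sum>\<gamma><C. \<Sum>\<beta><B. q * ((cmod (c $ \<gamma>))\<^sup>2 * (cmod ((L *\<^sub>v v) $ \<beta>))\<^sup>2))"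
    unfolding vnsq_pair[OF mult_mat_vec_carrier[OF tag_carrier[OF L] v]]
    by (intro sum.cong refl) (use q in \<open>simp add: ent norm_mult power_mult_distrib del: index_mult_mat_vec\<close>)
  also have "\<dots> = q * (vnsq c * vnsq (L *\<^sub>v v))"
  proof -
    have "vnsq c * vnsq (L *\<^sub>v v) = (\<Sum>\<gamma><C. \<Sum>\<beta><B. (cmod (c $ \<gamma>))\<^sup>2 * (cmod ((L *\<^sub>v v) $ \<beta>))\<^sup>2)"
      unfolding vnsq_def sum_product using c(1) L by (simp del: index_mult_mat_vec)
    thus ?thesis by (simp only: sum_distrib_left)
  qed
  finally show ?thesis using c by simp
qed

lemma untag_mult_tag:
  assumes K: "K \<in> carrier_mat d B" and L: "L \<in> carrier_mat B d" and c: "c \<in> carrier_vec C" "vnsq c = 1"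
  shows "untag C B c K * tag C B s c L = complex_of_real s \<cdot>\<^sub>m (K * L)"
proof (rule eq_matI)
  fix i j assume "i < dim_row (complex_of_real s \<cdot>\<^sub>m (K * L))" "j < dim_col (complex_of_real s \<cdot>\<^sub>m (K * L))"
  hence ij: "i < d" "j < d" using K L by auto
  have cc: "(\<Sum>\<gamma><C. cnj (c $ \<gamma>) * c $ \<gamma>) = 1" using cdot_self[of c] c by (simp add: cdot_def)
  have "(untag C B c K * tag C B s c L) $$ (i,j) = (\<Sum>k<C*B. untag C B c K $$ (i,k) * tag C B s c L $$ (k,j))"
    by (rule index_mult_mat_sum[OF untag_carrier[OF K] tag_carrier[OF L] ij])
  also have "\<dots> = (\<Sum>\<gamma><C. \<Sum>\<beta><B. untag C B c K $$ (i,\<gamma>*B+\<beta>) * tag C B s c L $$ (\<gamma>*B+\<beta>,j))" by (rule sum_pair)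
  also have "\<dots> = (\<Sum>\<gamma><C. \<Sum>\<beta><B. of_real s * ((cnj (c $ \<gamma>) * c $ \<gamma>) * (K $$ (i,\<beta>) * L $$ (\<beta>,j))))"
    by (intro sum.cong refl) (use ij in \<open>simp add: untag_index[OF K] tag_index[OF L] mult_ac\<close>)
  also have "\<dots> = of_real s * ((\<Sum>\<gamma><C. cnj (c $ \<gamma>) * c $ \<gamma>) * (\<Sum>\<beta><B. K $$ (i,\<beta>) * L $$ (\<beta>,j)))"
    unfolding sum_product by (simp only: sum_distrib_left)
  also have "\<dots> = of_real s * (K * L) $$ (i,j)" unfolding cc index_mult_mat_sum[OF K L ij] by simp
  finally show "(untag C B c K * tag C B s c L) $$ (i,j) = (complex_of_real s \<cdot>\<^sub>m (K * L)) $$ (i,j)"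
    using ij K L by simp
qed (use K L in \<open>auto simp: tag_def untag_def\<close>)

lemma cdot_ampl_vec_smult:
  assumes "X \<in> carrier_mat d d" "\<phi> \<in> carrier_vec (d*r)"
  shows "cdot \<phi> (ampl_vec d r \<phi> (a \<cdot>\<^sub>m X)) = a * cdot \<phi> (ampl_vec d r \<phi> X)"
proof -
  have "ampl_vec d r \<phi> (a \<cdot>\<^sub>m X) = a \<cdot>\<^sub>v ampl_vec d r \<phi> X"
    by (rule eq_vecI) (use assms in \<open>auto simp: ampl_vec_def sum_distrib_left mult.assoc less_mult_imp_div_less\<close>)
  thus ?thesis by (simp add: cdot_def sum_distrib_left mult.left_commute ampl_vec_def)
qed

text \<open>Bessel's inequality for the record vectors, used separately for each output index
  \<open>\<beta>\<close>: the matrix with columns \<open>c a\<close> is an isometry, so its adjoint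
  is a contraction. Equality may fail since the records need not span the register.\<close>

lemma sum_vnsq_untag_le:
  assumes c: "orthonormal_c C n c" and v: "v \<in> carrier_vec (C*B)"
  shows "(\<Sum>a<n. vnsq (vec B (\<lambda>\<beta>. \<Sum>\<gamma><C. cnj (c a $ \<gamma>) * v $ (\<gamma>*B+\<beta>)))) \<le> vnsq v"
proof -
  define M where "M = mat C n (\<lambda>(\<gamma>,a). c a $ \<gamma>)"
  have M: "M \<in> carrier_mat C n" by (simp add: M_def)
  have MM: "adj M * M = 1\<^sub>m n"
  proof (rule eq_matI)
    fix x y assume "x < dim_row (1\<^sub>m n :: complex mat)" "y < dim_col (1\<^sub>m n :: complex mat)"
    hence xy: "x < n" "y < n" by auto
    have "(adj M * M) $$ (x,y) = (\<Sum>i<C. adj M $$ (x,i) * M $$ (i,y))"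
      by (rule index_mult_mat_sum) (use M xy in auto)
    also have "\<dots> = (\<Sum>i<C. c y $ i * cnj (c x $ i))" using xy by (simp add: M_def mult.commute)
    finally show "(adj M * M) $$ (x,y) = 1\<^sub>m n $$ (x,y)" using c xy by (auto simp: orthonormal_c_def)
  qed (use M in auto)
  have "contraction M" using M vnsq_isometry[OF M MM] by (auto simp: contraction_def)
  note cM = contraction_adj[OF M this]
  let ?w = "\<lambda>\<beta>. vec C (\<lambda>\<gamma>. v $ (\<gamma>*B+\<beta>))"
  have "(\<Sum>a<n. vnsq (vec B (\<lambda>\<beta>. \<Sum>\<gamma><C. cnj (c a $ \<gamma>) * v $ (\<gamma>*B+\<beta>))))
      = (\<Sum>a<n. \<Sum>\<beta><B. (cmod ((adj M *\<^sub>v ?w \<beta>) $ a))\<^sup>2)"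
  proof (rule sum.cong[OF refl])
    fix a assume "a \<in> {..<n}"
    hence a: "a < n" by simp
    have "(adj M *\<^sub>v ?w \<beta>) $ a = (\<Sum>\<gamma><C. cnj (c a $ \<gamma>) * v $ (\<gamma>*B+\<beta>))" for \<beta>
      unfolding index_mult_mat_vec_sum[OF adj_carrier[OF M] vec_carrier a] using a by (simp add: M_def)
    thus "vnsq (vec B (\<lambda>\<beta>. \<Sum>\<gamma><C. cnj (c a $ \<gamma>) * v $ (\<gamma>*B+\<beta>))) = (\<Sum>\<beta><B. (cmod ((adj M *\<^sub>v ?w \<beta>) $ a))\<^sup>2)"
      by (simp add: vnsq_def del: index_mult_mat_vec)
  qed
  also have "\<dots> = (\<Sum>\<beta><B. \<Sum>a<n. (cmod ((adj M *\<^sub>v ?w \<beta>) $ a))\<^sup>2)" by (rule sum.swap)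
  also have "\<dots> = (\<Sum>\<beta><B. vnsq (adj M *\<^sub>v ?w \<beta>))" using M by (simp add: vnsq_def del: index_mult_mat_vec)
  also have "\<dots> \<le> (\<Sum>\<beta><B. vnsq (?w \<beta>))"
    by (intro sum_mono contractionD[OF cM adj_carrier[OF M] vec_carrier])
  also have "\<dots> = (\<Sum>\<gamma><C. \<Sum>\<beta><B. (cmod (v $ (\<gamma>*B+\<beta>)))\<^sup>2)" unfolding vnsq_def by (subst sum.swap) simp
  also have "\<dots> = vnsq v" by (rule vnsq_pair[OF v, symmetric])
  finally show ?thesis .
qed

lemma untag_mult_vec:
  assumes K: "K \<in> carrier_mat d B" and v: "v \<in> carrier_vec (C*B)"
  shows "untag C B c K *\<^sub>v v = K *\<^sub>v vec B (\<lambda>\<beta>. \<Sum>\<gamma><C. cnj (c $ \<gamma>) * v $ (\<gamma>*B+\<beta>))"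
proof (rule eq_vecI)
  let ?w = "vec B (\<lambda>\<beta>. \<Sum>\<gamma><C. cnj (c $ \<gamma>) * v $ (\<gamma>*B+\<beta>))"
  fix l assume "l < dim_vec (K *\<^sub>v ?w)"
  hence l: "l < d" using K by simp
  have "(untag C B c K *\<^sub>v v) $ l = (\<Sum>k<C*B. untag C B c K $$ (l,k) * v $ k)"
    by (rule index_mult_mat_vec_sum[OF untag_carrier[OF K] v l])
  also have "\<dots> = (\<Sum>\<gamma><C. \<Sum>\<beta><B. untag C B c K $$ (l,\<gamma>*B+\<beta>) * v $ (\<gamma>*B+\<beta>))" by (rule sum_pair)
  also have "\<dots> = (\<Sum>\<gamma><C. \<Sum>\<beta><B. K $$ (l,\<beta>) * (cnj (c $ \<gamma>) * v $ (\<gamma>*B+\<beta>)))"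
    by (rule sum.cong[OF refl], rule sum.cong[OF refl]) (use l in \<open>simp add: untag_index[OF K]\<close>)
  also have "\<dots> = (\<Sum>\<beta><B. \<Sum>\<gamma><C. K $$ (l,\<beta>) * (cnj (c $ \<gamma>) * v $ (\<gamma>*B+\<beta>)))" by (rule sum.swap)
  also have "\<dots> = (\<Sum>\<beta><B. K $$ (l,\<beta>) * ?w $ \<beta>)" by (simp add: sum_distrib_left)
  also have "\<dots> = (K *\<^sub>v ?w) $ l" by (rule index_mult_mat_vec_sum[OF K vec_carrier l, symmetric])
  finally show "(untag C B c K *\<^sub>v v) $ l = (K *\<^sub>v ?w) $ l" .
qed (use K in \<open>auto simp: untag_def\<close>)

lemma orthonormal_c_unit:
  assumes c: "orthonormal_c C n c" and a: "a < n"
  shows "c a \<in> carrier_vec C" "vnsq (c a) = 1"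
proof -
  show "c a \<in> carrier_vec C" using c a by (simp add: orthonormal_c_def)
  hence "complex_of_real (vnsq (c a)) = (\<Sum>i<C. c a $ i * cnj (c a $ i))"
    by (simp add: vnsq_def complex_norm_square del: of_real_power)
  thus "vnsq (c a) = 1" using c a by (simp add: orthonormal_c_def)
qed

text \<open>Bessel's inequality makes the combined family trace-nonincreasing. For the fidelity,
  reading the matching record leaves \<open>sqrt (q a)\<close> times the branch product, hence a
  share \<open>q a\<close> of that branch's squared fidelity; terms with mismatched records are
  squares and are dropped from the lower bound. Averaging over \<open>q\<close> preserves the common
  bound \<open>1 - \<delta>\<^sup>2\<close>.\<close>

lemma recovers_tagged:
  assumes c: "orthonormal_c C n c" and q: "\<And>a. a < n \<Longrightarrow> 0 \<le> q a" "(\<Sum>a<n. q a) = 1"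
    and rec: "\<And>a. a < n \<Longrightarrow> recovers d B \<delta> (Ks a) (Ms a)"
    and Ms: "\<And>a. a < n \<Longrightarrow> set (Ms a) \<subseteq> carrier_mat B d"
  shows "recovers d (C*B) \<delta> (concat (map (\<lambda>a. map (untag C B (c a)) (Ks a)) [0..<n]))
    (concat (map (\<lambda>a. map (tag C B (sqrt (q a)) (c a)) (Ms a)) [0..<n]))"
    (is "recovers d (C*B) \<delta> ?K ?M")
proof -
  have Ks: "set (Ks a) \<subseteq> carrier_mat d B" if "a < n" for a using rec[OF that] by (simp add: recovers_def)
  note ca = orthonormal_c_unit[OF c]
  have "set ?K \<subseteq> carrier_mat d (C*B)" using Ks by (auto simp: subset_iff)
  moreover have "(\<Sum>K\<leftarrow>?K. vnsq (K *\<^sub>v v)) \<le> vnsq v" if v: "v \<in> carrier_vec (C*B)" for v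
  proof -
    let ?w = "\<lambda>a. vec B (\<lambda>\<beta>. \<Sum>\<gamma><C. cnj (c a $ \<gamma>) * v $ (\<gamma>*B+\<beta>))"
    have "(\<Sum>K\<leftarrow>?K. vnsq (K *\<^sub>v v)) = (\<Sum>a<n. \<Sum>K\<leftarrow>Ks a. vnsq (untag C B (c a) K *\<^sub>v v))"
      unfolding sum_list_concat_map by (simp add: o_def interv_sum_list_conv_sum_set_nat atLeast0LessThan)
    also have "\<dots> \<le> (\<Sum>a<n. vnsq (?w a))"
    proof (rule sum_mono)
      fix a assume "a \<in> {..<n}"
      hence a: "a < n" by simp
      have "(\<Sum>K\<leftarrow>Ks a. vnsq (untag C B (c a) K *\<^sub>v v)) = (\<Sum>K\<leftarrow>Ks a. vnsq (K *\<^sub>v ?w a))"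
        by (rule arg_cong[where f = sum_list], rule map_cong[OF refl])
           (use Ks[OF a] v in \<open>auto simp: untag_mult_vec\<close>)
      also have "\<dots> \<le> vnsq (?w a)" using rec[OF a] by (simp add: recovers_def)
      finally show "(\<Sum>K\<leftarrow>Ks a. vnsq (untag C B (c a) K *\<^sub>v v)) \<le> vnsq (?w a)" .
    qed
    also have "\<dots> \<le> vnsq v" by (rule sum_vnsq_untag_le[OF c v])
    finally show ?thesis .
  qed
  moreover have "1 - \<delta>\<^sup>2 \<le> (\<Sum>K\<leftarrow>?K. \<Sum>A\<leftarrow>?M. (cmod (cdot \<phi> (ampl_vec d r \<phi> (K * A))))\<^sup>2)"
    if r: "0 < r" and \<phi>: "unit_vec_c (d * r) \<phi>" for r \<phi>
  proof -
    have \<phi>c: "\<phi> \<in> carrier_vec (d*r)" using \<phi> by (simp add: unit_vec_c_def)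
    let ?g = "\<lambda>X. (cmod (cdot \<phi> (ampl_vec d r \<phi> X)))\<^sup>2"
    have "1 - \<delta>\<^sup>2 = (\<Sum>a<n. q a * (1 - \<delta>\<^sup>2))" by (simp add: sum_distrib_right[symmetric] q(2))
    also have "\<dots> \<le> (\<Sum>a<n. \<Sum>K\<leftarrow>Ks a. \<Sum>A\<leftarrow>?M. ?g (untag C B (c a) K * A))"
    proof (rule sum_mono)
      fix a assume "a \<in> {..<n}"
      hence a: "a < n" by simp
      have "1 - \<delta>\<^sup>2 \<le> (\<Sum>K\<leftarrow>Ks a. \<Sum>A\<leftarrow>Ms a. ?g (K * A))"
        using rec[OF a] r \<phi> by (simp add: recovers_def)
      hence "q a * (1 - \<delta>\<^sup>2) \<le> q a * (\<Sum>K\<leftarrow>Ks a. \<Sum>A\<leftarrow>Ms a. ?g (K * A))"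
        using q(1)[OF a] by (rule mult_left_mono)
      also have "\<dots> = (\<Sum>K\<leftarrow>Ks a. \<Sum>A\<leftarrow>Ms a. q a * ?g (K * A))"
        by (simp add: sum_list_const_mult)
      also have "\<dots> \<le> (\<Sum>K\<leftarrow>Ks a. \<Sum>A\<leftarrow>?M. ?g (untag C B (c a) K * A))"
      proof (rule sum_list_mono)
        fix K assume "K \<in> set (Ks a)"
        hence K: "K \<in> carrier_mat d B" using Ks[OF a] by auto
        let ?h = "\<lambda>a'. \<Sum>A\<leftarrow>Ms a'. ?g (untag C B (c a) K * tag C B (sqrt (q a')) (c a') A)"
        have "(\<Sum>A\<leftarrow>Ms a. q a * ?g (K * A)) = ?h a"
        proof (rule arg_cong[where f = sum_list], rule map_cong[OF refl])
          fix A assume "A \<in> set (Ms a)"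
          hence A: "A \<in> carrier_mat B d" using Ms[OF a] by auto
          show "q a * ?g (K * A) = ?g (untag C B (c a) K * tag C B (sqrt (q a)) (c a) A)"
            unfolding untag_mult_tag[OF K A ca[OF a]] cdot_ampl_vec_smult[OF mult_carrier_mat[OF K A] \<phi>c]
            using q(1)[OF a] by (simp add: norm_mult power_mult_distrib)
        qed
        also have "\<dots> \<le> (\<Sum>a'<n. ?h a')"
          by (rule member_le_sum) (use a in \<open>auto intro!: sum_list_nonneg\<close>)
        also have "\<dots> = (\<Sum>A\<leftarrow>?M. ?g (untag C B (c a) K * A))"
          unfolding sum_list_concat_map by (simp add: o_def interv_sum_list_conv_sum_set_nat atLeast0LessThan)
        finally show "(\<Sum>A\<leftarrow>Ms a. q a * ?g (K * A)) \<le> (\<Sum>A\<leftarrow>?M. ?g (untag C B (c a) K * A))" .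
      qed
      finally show "q a * (1 - \<delta>\<^sup>2) \<le> (\<Sum>K\<leftarrow>Ks a. \<Sum>A\<leftarrow>?M. ?g (untag C B (c a) K * A))" .
    qed
    also have "\<dots> = (\<Sum>K\<leftarrow>?K. \<Sum>A\<leftarrow>?M. ?g (K * A))"
      unfolding sum_list_concat_map[of _ "\<lambda>a. map (untag C B (c a)) (Ks a)"]
      by (simp add: o_def interv_sum_list_conv_sum_set_nat atLeast0LessThan)
    finally show ?thesis .
  qed
  ultimately show ?thesis unfolding recovers_def by blast
qed

section \<open>The error bounds with and without a record\<close>

lemma eps_worst_stinespring:
  assumes d: "0 < d" and st: "stinespring d B E M W" and b: "orthonormal_c d d b"
    and \<zeta>: "density E \<zeta>" and \<epsilon>: "0 \<le> \<epsilon>" and \<nu>: "0 \<le> \<nu>"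
    and fid: "\<And>x. x < d \<Longrightarrow> sqrt (1 - \<epsilon>\<^sup>2) \<le> fidelity (complementary B E W (ketbra (b x) (b x))) \<zeta>"
    and off: "\<And>x y. x < d \<Longrightarrow> y < d \<Longrightarrow> x \<noteq> y \<Longrightarrow> trace_norm (complementary B E W (ketbra (b x) (b y))) \<le> \<nu>"
  shows "eps_worst d B M \<le> \<epsilon> + real d * sqrt \<nu>"
proof -
  have iso: "isometry d (B*E) W" using st by (simp add: stinespring_def)
  hence W: "W \<in> carrier_mat (B*E) d" "adj W * W = 1\<^sub>m d" by (auto simp: isometry_def)
  obtain Ks where Ks: "recovers d B (\<epsilon> + real d * sqrt \<nu>) Ks (slices B E W)"
    using recovery_kraus[OF iso b \<zeta> \<epsilon> \<nu> fid off] by blast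
  show ?thesis
    by (rule eps_worst_le[OF d slices_carrier[OF W(1)] slices_vnsq[OF W] stinespring_kraus[OF st] _ Ks])
       (use \<epsilon> \<nu> in auto)
qed

text \<open>Tagging and concatenating the branch Kraus families gives a Kraus family of the whole
  encoded noise straight from the formula for \<open>N\<close>. Branches may thus have environments
  of different dimensions, and no joint dilation has to be formed.\<close>

lemma eps_worst_recorded:
  assumes d: "0 < d" and Enc: "is_channel d A Enc" and q: "\<And>a. a < n \<Longrightarrow> 0 \<le> q a" "(\<Sum>a<n. q a) = 1"
    and c: "orthonormal_c C n c"
    and N: "\<And>\<rho>. \<rho> \<in> carrier_mat A A \<Longrightarrow> N \<rho> =
          foldr (\<lambda>a acc. complex_of_real (q a) \<cdot>\<^sub>m kron (ketbra (c a) (c a)) (Na a \<rho>) + acc) [0..<n] (0\<^sub>m (C*B) (C*B))"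
    and st: "\<And>a. a < n \<Longrightarrow> stinespring d B (Ea a) (Na a \<circ> Enc) (Wa a)"
    and \<delta>: "0 \<le> \<delta>" and rec: "\<And>a. a < n \<Longrightarrow> \<exists>Ks. recovers d B \<delta> Ks (slices B (Ea a) (Wa a))"
  shows "eps_worst d (C*B) (N \<circ> Enc) \<le> \<delta>"
proof -
  let ?S = "\<lambda>a. slices B (Ea a) (Wa a)"
  let ?T = "\<lambda>a. map (tag C B (sqrt (q a)) (c a)) (?S a)"
  let ?M = "concat (map ?T [0..<n])"
  have W: "Wa a \<in> carrier_mat (B*Ea a) d" "adj (Wa a) * Wa a = 1\<^sub>m d" if "a < n" for a
    using st[OF that] by (auto simp: stinespring_def isometry_def)
  have S: "set (?S a) \<subseteq> carrier_mat B d" if "a < n" for a by (rule slices_carrier[OF W(1)[OF that]])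
  note ca = orthonormal_c_unit[OF c]
  have T: "set (?T a) \<subseteq> carrier_mat (C*B) d" if "a < n" for a using S[OF that] by auto
  obtain Ks where Ks: "\<And>a. a < n \<Longrightarrow> recovers d B \<delta> (Ks a) (?S a)" using rec by metis
  show ?thesis
  proof (rule eps_worst_le[OF d _ _ _ \<delta> recovers_tagged[OF c q Ks S]])
    show "set ?M \<subseteq> carrier_mat (C*B) d" using T by (auto simp: subset_iff)
    fix v :: "complex vec" assume v: "v \<in> carrier_vec d"
    have "(\<Sum>A\<leftarrow>?M. vnsq (A *\<^sub>v v)) = (\<Sum>a<n. \<Sum>A\<leftarrow>?S a. vnsq (tag C B (sqrt (q a)) (c a) A *\<^sub>v v))"
      unfolding sum_list_concat_map by (simp add: o_def interv_sum_list_conv_sum_set_nat atLeast0LessThan)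
    also have "\<dots> = (\<Sum>a<n. q a * vnsq v)"
    proof (rule sum.cong[OF refl])
      fix a assume "a \<in> {..<n}"
      hence a: "a < n" by simp
      have "(\<Sum>A\<leftarrow>?S a. vnsq (tag C B (sqrt (q a)) (c a) A *\<^sub>v v)) = (\<Sum>A\<leftarrow>?S a. q a * vnsq (A *\<^sub>v v))"
        by (rule arg_cong[where f = sum_list], rule map_cong[OF refl], rule vnsq_tag)
           (use S[OF a] q(1)[OF a] ca[OF a] v in auto)
      also have "\<dots> = q a * (\<Sum>A\<leftarrow>?S a. vnsq (A *\<^sub>v v))" by (rule sum_list_const_mult)
      also have "\<dots> = q a * vnsq v" unfolding slices_vnsq[OF W[OF a] v] ..
      finally show "(\<Sum>A\<leftarrow>?S a. vnsq (tag C B (sqrt (q a)) (c a) A *\<^sub>v v)) = q a * vnsq v" .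
    qed
    also have "\<dots> = vnsq v" by (simp add: sum_distrib_right[symmetric] q(2))
    finally show "(\<Sum>A\<leftarrow>?M. vnsq (A *\<^sub>v v)) = vnsq v" .
  next
    fix \<rho> :: "complex mat" assume \<rho>: "\<rho> \<in> carrier_mat d d"
    obtain Es where "set Es \<subseteq> carrier_mat A d" "Enc \<rho> = kapply A Es \<rho>"
      using Enc \<rho> unfolding is_channel_iff by auto
    hence "Enc \<rho> \<in> carrier_mat A A" using kapply_carrier by metis
    hence "(N \<circ> Enc) \<rho> = foldr (\<lambda>a acc. complex_of_real (q a) \<cdot>\<^sub>m kron (ketbra (c a) (c a)) (Na a (Enc \<rho>)) + acc) [0..<n] (0\<^sub>m (C*B) (C*B))"
      by (simp add: N)
    also have "\<dots> = kapply (C*B) ?M \<rho>"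
    proof -
      have fold: "foldr (\<lambda>a acc. complex_of_real (q a) \<cdot>\<^sub>m kron (ketbra (c a) (c a)) (Na a (Enc \<rho>)) + acc) as (0\<^sub>m (C*B) (C*B))
          = kapply (C*B) (concat (map ?T as)) \<rho>" if "set as \<subseteq> {..<n}" for as
        using that
      proof (induction as)
        case (Cons a as)
        hence a: "a < n" by auto
        have R: "set (concat (map ?T as)) \<subseteq> carrier_mat (C*B) d" using Cons.prems T by (auto simp: subset_iff)
        have "Na a (Enc \<rho>) = kapply B (?S a) \<rho>" using stinespring_kraus[OF st[OF a] \<rho>] by simp
        hence "complex_of_real (q a) \<cdot>\<^sub>m kron (ketbra (c a) (c a)) (Na a (Enc \<rho>)) = kapply (C*B) (?T a) \<rho>"
          using kron_kapply[OF S[OF a] \<rho> q(1)[OF a] ca(1)[OF a]] by simp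
        thus ?case using Cons kapply_append[OF T[OF a] R, of \<rho>] by simp
      qed simp
      show ?thesis by (rule fold) auto
    qed
    finally show "(N \<circ> Enc) \<rho> = kapply (C*B) ?M \<rho>" .
  qed
qed

theorem theorem3:
  shows
  "(\<forall>(dL::nat) (dA::nat) (dB::nat) (dE::nat) (Enc :: complex mat \<Rightarrow> complex mat)
      (N :: complex mat \<Rightarrow> complex mat) (W :: complex mat) (b :: nat \<Rightarrow> complex vec)
      (\<zeta> :: complex mat) (\<epsilon>::real) (\<nu>::real).
      0 < dL \<and> is_channel dL dA Enc \<and> is_channel dA dB N \<and>
      stinespring dL dB dE (N \<circ> Enc) W \<and>
      orthonormal_c dL dL b \<and>
      density dE \<zeta> \<and> 0 \<le> \<epsilon> \<and> 0 \<le> \<nu> \<and>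
      (\<forall>x<dL. fidelity (complementary dB dE W (ketbra (b x) (b x))) \<zeta> \<ge> sqrt (1 - \<epsilon>\<^sup>2)) \<and>
      (\<forall>x<dL. \<forall>x'<dL. x \<noteq> x' \<longrightarrow> trace_norm (complementary dB dE W (ketbra (b x) (b x'))) \<le> \<nu>)
      \<longrightarrow> eps_worst dL dB (N \<circ> Enc) \<le> \<epsilon> + real dL * sqrt \<nu>)
   \<and>
   (\<forall>(dL::nat) (dA::nat) (dC::nat) (dB::nat) (nA::nat) (Enc :: complex mat \<Rightarrow> complex mat)
      (N :: complex mat \<Rightarrow> complex mat) (q :: nat \<Rightarrow> real) (c :: nat \<Rightarrow> complex vec)
      (Na :: nat \<Rightarrow> complex mat \<Rightarrow> complex mat) (dEa :: nat \<Rightarrow> nat) (Wa :: nat \<Rightarrow> complex mat)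
      (b :: nat \<Rightarrow> complex vec) (\<zeta>a :: nat \<Rightarrow> complex mat) (\<epsilon>::real) (\<nu>::real).
      0 < dL \<and> is_channel dL dA Enc \<and>
      (\<forall>a<nA. 0 \<le> q a) \<and> (\<Sum>a<nA. q a) = 1 \<and>
      orthonormal_c dC nA c \<and>
      (\<forall>a<nA. is_channel dA dB (Na a)) \<and>
      (\<forall>\<rho> \<in> carrier_mat dA dA. N \<rho> =
          foldr (\<lambda>a acc. complex_of_real (q a) \<cdot>\<^sub>m kron (ketbra (c a) (c a)) (Na a \<rho>) + acc)
            [0..<nA] (0\<^sub>m (dC*dB) (dC*dB))) \<and>
      (\<forall>a<nA. stinespring dL dB (dEa a) (Na a \<circ> Enc) (Wa a)) \<and>
      orthonormal_c dL dL b \<and>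
      (\<forall>a<nA. density (dEa a) (\<zeta>a a)) \<and> 0 \<le> \<epsilon> \<and> 0 \<le> \<nu> \<and>
      (\<forall>a<nA. \<forall>x<dL.
          fidelity (complementary dB (dEa a) (Wa a) (ketbra (b x) (b x))) (\<zeta>a a) \<ge> sqrt (1 - \<epsilon>\<^sup>2)) \<and>
      (\<forall>a<nA. \<forall>x<dL. \<forall>x'<dL. x \<noteq> x' \<longrightarrow>
          trace_norm (complementary dB (dEa a) (Wa a) (ketbra (b x) (b x'))) \<le> \<nu>)
      \<longrightarrow> eps_worst dL (dC*dB) (N \<circ> Enc) \<le> \<epsilon> + real dL * sqrt \<nu>)"
proof (intro conjI allI impI)
  fix dL dA dB dE :: nat and Enc N :: "complex mat \<Rightarrow> complex mat" and W :: "complex mat"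
    and b :: "nat \<Rightarrow> complex vec" and \<zeta> :: "complex mat" and \<epsilon> \<nu> :: real
  assume h: "0 < dL \<and> is_channel dL dA Enc \<and> is_channel dA dB N \<and>
      stinespring dL dB dE (N \<circ> Enc) W \<and>
      orthonormal_c dL dL b \<and>
      density dE \<zeta> \<and> 0 \<le> \<epsilon> \<and> 0 \<le> \<nu> \<and>
      (\<forall>x<dL. fidelity (complementary dB dE W (ketbra (b x) (b x))) \<zeta> \<ge> sqrt (1 - \<epsilon>\<^sup>2)) \<and>
      (\<forall>x<dL. \<forall>x'<dL. x \<noteq> x' \<longrightarrow> trace_norm (complementary dB dE W (ketbra (b x) (b x'))) \<le> \<nu>)"
  show "eps_worst dL dB (N \<circ> Enc) \<le> \<epsilon> + real dL * sqrt \<nu>"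
    by (rule eps_worst_stinespring[of dL dB dE _ W b \<zeta>]) (use h in auto)
next
  fix dL dA dC dB nA :: nat and Enc N :: "complex mat \<Rightarrow> complex mat" and q :: "nat \<Rightarrow> real"
    and c :: "nat \<Rightarrow> complex vec" and Na :: "nat \<Rightarrow> complex mat \<Rightarrow> complex mat" and dEa :: "nat \<Rightarrow> nat"
    and Wa :: "nat \<Rightarrow> complex mat" and b :: "nat \<Rightarrow> complex vec" and \<zeta>a :: "nat \<Rightarrow> complex mat" and \<epsilon> \<nu> :: real
  assume h: "0 < dL \<and> is_channel dL dA Enc \<and>
      (\<forall>a<nA. 0 \<le> q a) \<and> (\<Sum>a<nA. q a) = 1 \<and>
      orthonormal_c dC nA c \<and>
      (\<forall>a<nA. is_channel dA dB (Na a)) \<and>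
      (\<forall>\<rho> \<in> carrier_mat dA dA. N \<rho> =
          foldr (\<lambda>a acc. complex_of_real (q a) \<cdot>\<^sub>m kron (ketbra (c a) (c a)) (Na a \<rho>) + acc)
            [0..<nA] (0\<^sub>m (dC*dB) (dC*dB))) \<and>
      (\<forall>a<nA. stinespring dL dB (dEa a) (Na a \<circ> Enc) (Wa a)) \<and>
      orthonormal_c dL dL b \<and>
      (\<forall>a<nA. density (dEa a) (\<zeta>a a)) \<and> 0 \<le> \<epsilon> \<and> 0 \<le> \<nu> \<and>
      (\<forall>a<nA. \<forall>x<dL.
          fidelity (complementary dB (dEa a) (Wa a) (ketbra (b x) (b x))) (\<zeta>a a) \<ge> sqrt (1 - \<epsilon>\<^sup>2)) \<and>
      (\<forall>a<nA. \<forall>x<dL. \<forall>x'<dL. x \<noteq> x' \<longrightarrow>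
          trace_norm (complementary dB (dEa a) (Wa a) (ketbra (b x) (b x'))) \<le> \<nu>)"
  \<comment> \<open>The hypotheses concern each branch with its own environment and its own
    \<open>\<zeta>a a\<close>, so recoveries are obtained branch by branch with the same error and
    then joined.\<close>
  have "\<exists>Ks. recovers dL dB (\<epsilon> + real dL * sqrt \<nu>) Ks (slices dB (dEa a) (Wa a))" if "a < nA" for a
    by (rule recovery_kraus[of dL dB "dEa a" "Wa a" b "\<zeta>a a" \<epsilon> \<nu>])
       (use h that in \<open>auto simp: stinespring_def\<close>)
  thus "eps_worst dL (dC*dB) (N \<circ> Enc) \<le> \<epsilon> + real dL * sqrt \<nu>"
    using h by (intro eps_worst_recorded[of dL dA Enc nA q dC c N Na dB dEa Wa]) auto
qed

end
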